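(* The Zeta operator $Zf(x)=\sum_{n=1}^\infty f(nx)$ ($f\in\mathcal H_+$, $x>0$) is a continuous linear map $Z:\mathcal H_+\to\mathcal H_\cup$. It has closed range and is a topological isomorphism onto its range. Moreover, for $f\in\mathcal H_+$ we have $Zf\in\mathcal H_-$ if and only if $f\in\mathcal H_\cap$.
   Context: $\mathbb R^\times_+$ is the multiplicative group of positive reals, identified with $\mathbb R$ via $\ln$, with Schwartz space $\mathcal S(\mathbb R^\times_+)$. For $s\in\mathbb R$, $\mathcal S(\mathbb R^\times_+)_s=\{f\mid x\mapsto f(x)x^s\in\mathcal S(\mathbb R^\times_+)\}$; $\mathcal H_-=\mathcal O(\mathbb R^\times_+)=\bigcap_{s\in\mathbb R}\mathcal S(\mathbb R^\times_+)_s$ with its Fréchet topology. $\mathcal H_+=\{f\in\mathcal S(\mathbb R)\mid f(-x)=f(x)\}$, its elements viewed as functions on $(0,\infty)$. Fourier transform $\mathfrak F f(y)=\int_{\mathbb R}f(x)e^{2\pi ixy}\,\mathrm dx$. $\mathcal H_\cap=\{f\in\mathcal H_+\mid f(0)=\mathfrak Ff(0)=0\}$. Fix a smooth $h_0:\mathbb R^\times_+\to[0,1]$ with $h_0(t)=1$ for $t$ small and $h_0(t)=0$ for $t$ large; $\mathcal H_\cup=\mathcal H_-\oplus\mathbb C h_0\oplus\mathbb C\, x^{-1}h_0$ (a space of functions on $\mathbb R^\times_+$), topologised as the direct sum of the Fréchet space $\mathcal H_-$ and $\mathbb C^2$. *)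

theory Defs
  imports "HOL-Analysis.Analysis"
begin

definition vderiv :: "(real \<Rightarrow> 'a::real_normed_vector) \<Rightarrow> real \<Rightarrow> 'a" where
  "vderiv f = (\<lambda>x. vector_derivative f (at x))"

text \<open>The set \<open>S\<close> is meant to be open.\<close>

definition smooth_on :: "real set \<Rightarrow> (real \<Rightarrow> 'a::real_normed_vector) \<Rightarrow> bool" where
  "smooth_on S f \<longleftrightarrow> (\<forall>m. \<forall>x\<in>S. (vderiv ^^ m) f differentiable (at x))"

definition Schwartz :: "(real \<Rightarrow> complex) set" where
  "Schwartz = {f. smooth_on UNIV f \<and>
     (\<forall>k m. bounded (range (\<lambda>x. \<bar>x\<bar> ^ k * norm ((vderiv ^^ m) f x))))}"

definition Schwartz_seminorm :: "nat \<Rightarrow> nat \<Rightarrow> (real \<Rightarrow> complex) \<Rightarrow> real" where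
  "Schwartz_seminorm k m f = (SUP x. \<bar>x\<bar> ^ k * norm ((vderiv ^^ m) f x))"

definition seminorm_topology ::
    "(real \<Rightarrow> complex) set \<Rightarrow> ((real \<Rightarrow> complex) \<Rightarrow> real) set \<Rightarrow> (real \<Rightarrow> complex) topology" where
  "seminorm_topology V P = topology_generated_by
     {{g\<in>V. p (\<lambda>x. g x - f x) < e} | f p e. f \<in> V \<and> p \<in> P \<and> 0 < e}"

definition Schwartz_top :: "(real \<Rightarrow> complex) topology" where
  "Schwartz_top = seminorm_topology Schwartz {Schwartz_seminorm k m | k m. True}"

text \<open>A function on the group of positive reals is represented by its extension by \<open>0\<close>
  to the whole real line.\<close>

definition ext0 :: "(real \<Rightarrow> complex) \<Rightarrow> real \<Rightarrow> complex" where
  "ext0 f = (\<lambda>x. if 0 < x then f x else 0)"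

definition Schwartz_pos :: "(real \<Rightarrow> complex) set" where
  "Schwartz_pos = {f. (\<forall>x\<le>0. f x = 0) \<and> f \<circ> exp \<in> Schwartz}"

definition twist :: "real \<Rightarrow> (real \<Rightarrow> complex) \<Rightarrow> real \<Rightarrow> complex" where
  "twist s f = (\<lambda>x. f x * of_real (x powr s))"

text \<open>The conjunct on \<open>x \<le> 0\<close> repeats the representation convention, because
  \<open>0 powr s = 0\<close> erases the value at \<open>0\<close> in \<open>twist s f\<close>.\<close>

definition Schwartz_pos_s :: "real \<Rightarrow> (real \<Rightarrow> complex) set" where
  "Schwartz_pos_s s = {f. (\<forall>x\<le>0. f x = 0) \<and> twist s f \<in> Schwartz_pos}"

definition Hminus :: "(real \<Rightarrow> complex) set" where
  "Hminus = (\<Inter>s. Schwartz_pos_s s)"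

text \<open>The initial topology for the inclusions into all \<open>Schwartz_pos_s s\<close>, where
  \<open>Schwartz_pos_s s\<close> carries the seminorms of the Schwartz space transported along \<open>twist s\<close>
  and \<open>exp\<close>.\<close>

definition Hminus_top :: "(real \<Rightarrow> complex) topology" where
  "Hminus_top = seminorm_topology Hminus
     {\<lambda>f. Schwartz_seminorm k m (twist s f \<circ> exp) | s k m. True}"

definition Hplus :: "(real \<Rightarrow> complex) set" where
  "Hplus = {f \<in> Schwartz. \<forall>x. f (- x) = f x}"

definition Hplus_top :: "(real \<Rightarrow> complex) topology" where
  "Hplus_top = subtopology Schwartz_top Hplus"

definition Fourier :: "(real \<Rightarrow> complex) \<Rightarrow> real \<Rightarrow> complex" where
  "Fourier f y = (\<integral>x. f x * exp (2 * of_real pi * \<i> * of_real x * of_real y) \<partial>lborel)"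

definition Hcap :: "(real \<Rightarrow> complex) set" where
  "Hcap = {f \<in> Hplus. f 0 = 0 \<and> Fourier f 0 = 0}"

definition cutoff :: "(real \<Rightarrow> real) \<Rightarrow> bool" where
  "cutoff h0 \<longleftrightarrow> smooth_on {0<..} h0 \<and> (\<forall>t>0. 0 \<le> h0 t \<and> h0 t \<le> 1) \<and>
     (\<forall>\<^sub>F t in at_right 0. h0 t = 1) \<and> (\<forall>\<^sub>F t in at_top. h0 t = 0)"

definition Hcup_sum :: "(real \<Rightarrow> real) \<Rightarrow> (real \<Rightarrow> complex) \<times> complex \<times> complex \<Rightarrow> real \<Rightarrow> complex" where
  "Hcup_sum h0 = (\<lambda>(g, a, b) x.
     g x + a * ext0 (\<lambda>x. of_real (h0 x)) x + b * ext0 (\<lambda>x. of_real (inverse x * h0 x)) x)"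

definition Hcup :: "(real \<Rightarrow> real) \<Rightarrow> (real \<Rightarrow> complex) set" where
  "Hcup h0 = Hcup_sum h0 ` (Hminus \<times> UNIV \<times> UNIV)"

text \<open>The product topology, transported along the bijection \<open>Hcup_sum h0\<close>;
  see \<open>inj_on_Hcup_sum\<close> below.\<close>

definition Hcup_top :: "(real \<Rightarrow> real) \<Rightarrow> (real \<Rightarrow> complex) topology" where
  "Hcup_top h0 = pullback_topology (Hcup h0)
     (the_inv_into (Hminus \<times> UNIV \<times> UNIV) (Hcup_sum h0))
     (prod_topology Hminus_top (prod_topology euclidean euclidean))"

definition Zeta :: "(real \<Rightarrow> complex) \<Rightarrow> real \<Rightarrow> complex" where
  "Zeta f = ext0 (\<lambda>x. \<Sum>n. f (real (Suc n) * x))"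

definition clinear_on ::
    "(real \<Rightarrow> complex) set \<Rightarrow> ((real \<Rightarrow> complex) \<Rightarrow> (real \<Rightarrow> complex)) \<Rightarrow> bool" where
  "clinear_on V T \<longleftrightarrow>
     (\<forall>f\<in>V. \<forall>g\<in>V. T (\<lambda>x. f x + g x) = (\<lambda>x. T f x + T g x)) \<and>
     (\<forall>c. \<forall>f\<in>V. T (\<lambda>x. c * f x) = (\<lambda>x. c * T f x))"

lemma vderiv_zero: "(vderiv ^^ m) (\<lambda>x. 0) = (\<lambda>x. 0)"
  by (induction m) (auto simp: vderiv_def)

lemma Schwartz_seminorm_zero: "Schwartz_seminorm k m (\<lambda>x. 0) = 0"
  by (simp add: Schwartz_seminorm_def vderiv_zero)

lemma topspace_seminorm_topology:
  assumes "p \<in> P" "p (\<lambda>x. 0) = 0"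
  shows "topspace (seminorm_topology V P) = V"
proof -
  have "f \<in> \<Union> {{g\<in>V. p (\<lambda>x. g x - f x) < e} | f p e. f \<in> V \<and> p \<in> P \<and> 0 < e}" if "f \<in> V" for f
    using that assms by (intro UnionI[of "{g\<in>V. p (\<lambda>x. g x - f x) < 1}"]) force+
  then show ?thesis
    by (auto simp: seminorm_topology_def topology_generated_by_topspace)
qed

lemma topspace_Schwartz_top: "topspace Schwartz_top = Schwartz"
  unfolding Schwartz_top_def
  by (rule topspace_seminorm_topology[where p = "Schwartz_seminorm 0 0"])
    (auto simp: Schwartz_seminorm_zero)

lemma topspace_Hplus_top: "topspace Hplus_top = Hplus"
  by (auto simp: Hplus_top_def topspace_Schwartz_top Hplus_def)

lemma topspace_Hminus_top: "topspace Hminus_top = Hminus"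
  unfolding Hminus_top_def
  by (rule topspace_seminorm_topology[where p = "\<lambda>f. Schwartz_seminorm 0 0 (twist 0 f \<circ> exp)"])
    (blast, simp add: Schwartz_seminorm_zero twist_def o_def)

lemma Hminus_tendsto_0:
  assumes "f \<in> Hminus"
  shows "((\<lambda>x. f x * of_real (x powr s)) \<longlongrightarrow> 0) (at_right 0)"
proof -
  have "twist (s - 1) f \<circ> exp \<in> Schwartz"
    using assms by (auto simp: Hminus_def Schwartz_pos_s_def Schwartz_pos_def)
  then have "bounded (range (\<lambda>x. \<bar>x\<bar> ^ 0 * norm ((vderiv ^^ 0) (twist (s - 1) f \<circ> exp) x)))"
    unfolding Schwartz_def by blast
  then obtain B where B: "norm (twist (s - 1) f (exp t)) \<le> B" for t
    by (auto simp: bounded_iff)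
  have "norm (f x * of_real (x powr s)) \<le> B * x" if "0 < x" for x
  proof -
    have "x powr s = x powr (s - 1) * x"
      using that by (simp add: powr_diff)
    then show ?thesis
      using B[of "ln x"] that by (simp add: twist_def norm_mult mult_right_mono flip: mult.assoc)
  qed
  then have "\<forall>\<^sub>F x in at_right 0. norm (f x * of_real (x powr s)) \<le> B * x"
    by (auto simp: eventually_at_right_less eventually_at_filter)
  moreover have "((\<lambda>x. B * x) \<longlongrightarrow> 0) (at_right 0)"
    by (auto intro!: tendsto_eq_intros)
  ultimately show ?thesis
    by (rule Lim_null_comparison)
qed

lemma inj_on_Hcup_sum:
  assumes "cutoff h0"
  shows "inj_on (Hcup_sum h0) (Hminus \<times> UNIV \<times> UNIV)"
proof -
  have h0: "\<forall>\<^sub>F x in at_right 0. h0 x = 1 \<and> 0 < x"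
    using assms eventually_at_right_less[of "0::real"]
    by (auto simp: cutoff_def elim: eventually_elim2)
  have "g = g' \<and> a = a' \<and> b = b'"
    if g: "g \<in> Hminus" "g' \<in> Hminus" and eq: "Hcup_sum h0 (g, a, b) = Hcup_sum h0 (g', a', b')"
    for g a b g' a' b'
  proof -
    have eqx: "g x - g' x = (a' - a) * ext0 (\<lambda>x. of_real (h0 x)) x
        + (b' - b) * ext0 (\<lambda>x. of_real (inverse x * h0 x)) x" for x
      using fun_cong[OF eq, of x] by (simp add: Hcup_sum_def algebra_simps)
    have ev: "\<forall>\<^sub>F x in at_right 0. g x - g' x = (a' - a) + (b' - b) * of_real (inverse x)"
      using h0 by eventually_elim (simp add: eqx ext0_def)
    have lim: "((\<lambda>x. g x * of_real (x powr s) - g' x * of_real (x powr s)) \<longlongrightarrow> 0) (at_right 0)" for s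
      using tendsto_diff[OF g[THEN Hminus_tendsto_0]] by simp
    have "((\<lambda>x. (a' - a) * of_real x + (b' - b)) \<longlongrightarrow> 0) (at_right 0)"
    proof (rule Lim_transform_eventually[OF lim[of 1]])
      show "\<forall>\<^sub>F x in at_right 0. g x * of_real (x powr 1) - g' x * of_real (x powr 1)
          = (a' - a) * of_real x + (b' - b)"
        using ev h0
      proof eventually_elim
        case (elim x)
        have "g x * of_real (x powr 1) - g' x * of_real (x powr 1) = (g x - g' x) * of_real x"
          using elim(2) by (simp add: left_diff_distrib)
        also have "\<dots> = (a' - a) * of_real x + (b' - b) * of_real (inverse x * x)"
          by (simp only: elim distrib_right mult.assoc of_real_mult)
        finally show ?case
          using elim by simp
      qed
    qed
    moreover have "((\<lambda>x. (a' - a) * of_real x + (b' - b)) \<longlongrightarrow> b' - b) (at_right 0)"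
      by (auto intro!: tendsto_eq_intros)
    ultimately have b: "b' - b = 0"
      using tendsto_unique trivial_limit_at_right_real by blast
    have "((\<lambda>x::real. a' - a) \<longlongrightarrow> 0) (at_right 0)"
    proof (rule Lim_transform_eventually[OF lim[of 0]])
      show "\<forall>\<^sub>F x in at_right 0. g x * of_real (x powr 0) - g' x * of_real (x powr 0) = a' - a"
        using ev h0 by eventually_elim (use b in simp)
    qed
    then have a: "a' - a = 0"
      by (simp add: tendsto_const_iff)
    have "g = g'"
      using eqx a b by (intro ext) simp
    with a b show ?thesis by simp
  qed
  then show ?thesis
    by (auto simp: inj_on_def)
qed

lemma topspace_Hcup_top:
  assumes "cutoff h0"
  shows "topspace (Hcup_top h0) = Hcup h0"
  using the_inv_into_into[OF inj_on_Hcup_sum[OF assms] _ subset_refl]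
  by (auto simp: Hcup_top_def topspace_pullback_topology topspace_Hminus_top Hcup_def mem_Times_iff)

end

theory Submission
  imports Defs
begin

text \<open>
  Poisson summation gives \<open>Zf(x) = - f(0)/2 + Ff(0)/(2x) + Z(Ff)(1/x)/x\<close> for \<open>f\<close> in \<open>Hplus\<close>.  The last
  term decays rapidly as \<open>x\<close> tends to \<open>0\<close>, so \<open>Zf\<close> lies in \<open>Hcup\<close> with coefficients \<open>- f(0)/2\<close> and
  \<open>Ff(0)/2\<close>.  Derivatives are covered because \<open>Z\<close> commutes with \<open>x d/dx\<close>, which preserves \<open>Hplus\<close>.

  Conversely, for \<open>k \<ge> 2\<close> the first summand of \<open>Z\<phi>\<close> dominates the others in the norm
  \<open>sup x^k \<bar>\<phi>(x)\<bar>\<close>, because \<open>1/2^2 + 1/3^2 + \<dots> < 1\<close>.  Hence \<open>Zf\<close> controls \<open>x^k f(x)\<close>, and by the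
  functional equation also \<open>y^k Ff(y)\<close>, for all \<open>k \<ge> 2\<close>.  The latter bounds all derivatives of \<open>f\<close> of
  order at least \<open>2\<close>, and interpolation yields every Schwartz seminorm of \<open>f\<close>.  So \<open>Z\<close> is injective
  with continuous inverse on its range, and the range is closed because \<open>Hplus\<close> is complete.
\<close>

section \<open>Poisson summation\<close>

text \<open>The exponent 2 is the recurring obstacle. The sum of 1/n^k converges only from k = 2 on,
  so domination by the first summand says nothing about weights 0 and 1: it reaches neither
  \<open>f\<close> near 0 nor the derivatives of order 0 and 1, and interpolation has to bring these
  back. The domination uses sup norms of Zf alone, so the inverse is continuous already for the
  seminorms of \<open>Hminus\<close> with k = m = 0. Fourier inversion is avoided.
  \<open>Fourier f\<close> is only shown to decay, and bounds travel back to \<open>f\<close>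
  through Poisson summation with growing period. Poisson summation in turn rests on an absolutely
  convergent series, the cosine series of the second Bernoulli polynomial; hence its hypothesis of
  two derivatives with quadratic decay. On the group the coordinate is t = ln x. There x d/dx
  becomes d/dt, and membership in \<open>Hminus\<close> follows from exponential bounds of every
  rate for all t-derivatives. Estimates in both directions have the form \<open>controlled\<close>:
  small \<open>\<delta>\<close> gives continuity, \<open>\<delta>\<close> = 0 gives
  injectivity.\<close>

lemma sums_inverse_squares_Suc: "(\<lambda>n. 1 / (real (Suc n))\<^sup>2) sums (pi\<^sup>2 / 6)"
  using inverse_squares_sums by (simp add: add.commute)

lemma summable_inverse_squares_Suc: "summable (\<lambda>n. 1 / (real (Suc n))\<^sup>2)"
  using sums_inverse_squares_Suc by (rule sums_summable)

section \<open>Cosine series of the second Bernoulli polynomial\<close>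

text \<open>The differentiated series is -2 pi times the imaginary part of the power series of -Ln
  (1 - z) at z = r exp(2 pi i t). The Abel factor r < 1 gives it a geometric majorant, which is lost
  at r = 1.\<close>

lemma Abel_cos_series_has_derivative:
  assumes r: "0 \<le> r" "r < 1"
  shows "((\<lambda>t. \<Sum>n. r ^ Suc n * cos (2 * pi * real (Suc n) * t) / (real (Suc n))\<^sup>2)
    has_real_derivative 2 * pi * Im (Ln (1 - of_real r * cis (2 * pi * t)))) (at t)"
proof -
  let ?f = "\<lambda>n t. r ^ Suc n * cos (2 * pi * real (Suc n) * t) / (real (Suc n))\<^sup>2"
  let ?g = "\<lambda>n t. - (2 * pi) * (r ^ Suc n * sin (2 * pi * real (Suc n) * t) / real (Suc n))"
  have d: "(?f n has_real_derivative ?g n x) (at x)" for n x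
    by (rule derivative_eq_intros refl | simp add: power2_eq_square del: power_Suc)+
  have bnd: "norm (?g n x) \<le> 2 * pi * r ^ Suc n" for n x
  proof -
    have "\<bar>sin (2 * pi * real (Suc n) * x)\<bar> / real (Suc n) \<le> 1"
      by (simp add: divide_le_eq) (meson abs_sin_le_one le_add_same_cancel1 of_nat_0_le_iff order_trans)
    then have "r ^ Suc n * (\<bar>sin (2 * pi * real (Suc n) * x)\<bar> / real (Suc n)) \<le> r ^ Suc n * 1"
      using r by (intro mult_left_mono) auto
    then have "2 * pi * (r ^ Suc n * (\<bar>sin (2 * pi * real (Suc n) * x)\<bar> / real (Suc n))) \<le> 2 * pi * r ^ Suc n"
      by (intro mult_left_mono) auto
    then show ?thesis
      using r by (simp add: abs_mult del: power_Suc of_nat_Suc)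
  qed
  have "uniformly_convergent_on UNIV (\<lambda>n x. \<Sum>i<n. ?g i x)"
    using r bnd by (intro Weierstrass_m_test'[where M="\<lambda>n. 2 * pi * r ^ Suc n"]) 
      (auto simp del: power_Suc simp: summable_Suc_iff[of "\<lambda>n. r ^ n"] intro!: summable_mult)
  moreover have "summable (\<lambda>n. ?f n t)"
  proof (rule summable_comparison_test'[OF summable_inverse_squares_Suc, of 0])
    fix n
    have "\<bar>r ^ Suc n * cos (2 * pi * real (Suc n) * t)\<bar> \<le> 1 * 1"
      unfolding abs_mult using r by (intro mult_mono) (auto simp: power_le_one simp del: power_Suc)
    then show "norm (?f n t) \<le> 1 / (real (Suc n))\<^sup>2"
      by (simp add: divide_right_mono del: power_Suc of_nat_Suc)
  qed
  ultimately have main: "((\<lambda>t. \<Sum>n. ?f n t) has_real_derivative (\<Sum>n. ?g n t)) (at t)"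
    using d by (intro has_field_derivative_series'(2)[where S=UNIV and x0=t]) 
      (auto simp del: power_Suc of_nat_Suc)
  let ?z = "of_real r * cis (2 * pi * t)"
  have "norm (- ?z) < 1" using r by (simp add: norm_mult)
  from Ln_series'[OF this] have "(\<lambda>n. - (?z ^ n / of_nat n)) sums Ln (1 - ?z)"
    by simp
  then have "(\<lambda>n. - (?z ^ Suc n / of_nat (Suc n))) sums Ln (1 - ?z)"
    by (subst sums_Suc_iff) simp
  then have "(\<lambda>n. 2 * pi * Im (- (?z ^ Suc n / of_nat (Suc n)))) sums (2 * pi * Im (Ln (1 - ?z)))"
    by (intro sums_mult sums_Im)
  moreover have "2 * pi * Im (- (?z ^ Suc n / of_nat (Suc n))) = ?g n t" for n
  proof -
    have z: "?z ^ Suc n = of_real (r ^ Suc n) * cis (2 * pi * real (Suc n) * t)"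
      unfolding power_mult_distrib Complex.DeMoivre of_real_power
      by (rule arg_cong2[where f="(*)", OF refl arg_cong[where f=cis]]) (simp add: algebra_simps)
    have "Im (?z ^ Suc n / of_nat (Suc n)) = Im (?z ^ Suc n) / real (Suc n)"
      by (rule Im_divide_of_nat)
    then show ?thesis
      unfolding z by (simp del: power_Suc of_nat_Suc)
  qed
  ultimately show ?thesis
    using main by (simp add: sums_iff del: power_Suc of_nat_Suc)
qed

text \<open>The polar form 1 - exp(2 pi i s) = 2 sin(pi s) exp(i (pi s - pi/2)) has positive modulus
  and an angle strictly between -pi/2 and pi/2, so the principal logarithm can be read off. The
  positive real part keeps the limit point off the branch cut when r tends to 1.\<close>

lemma Im_Ln_one_minus_cis:
  assumes "0 < s" "s < 1"
  shows "Im (Ln (1 - cis (2 * pi * s))) = pi * s - pi / 2" and "0 < Re (1 - cis (2 * pi * s))"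
proof -
  have pos: "sin (pi * s) > 0"
    using assms by (intro sin_gt_zero) auto
  have c: "cos (2 * pi * s) = 1 - 2 * (sin (pi * s))\<^sup>2"
    using cos_double_sin[of "pi * s"] by (simp add: algebra_simps)
  have s: "sin (2 * pi * s) = 2 * sin (pi * s) * cos (pi * s)"
    using sin_double[of "pi * s"] by (simp add: algebra_simps)
  have "1 - cis (2 * pi * s) = of_real (2 * sin (pi * s)) * exp (\<i> * of_real (pi * s - pi / 2))"
    unfolding cis_conv_exp[symmetric]
    by (simp add: complex_eq_iff c s cos_diff sin_diff power2_eq_square)
  also have "\<dots> = exp (of_real (ln (2 * sin (pi * s))) + \<i> * of_real (pi * s - pi / 2))"
    using pos by (simp add: exp_add exp_of_real)
  also have "Ln \<dots> = of_real (ln (2 * sin (pi * s))) + \<i> * of_real (pi * s - pi / 2)"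
  proof (rule Ln_exp)
    define u where "u = pi * s"
    have "0 < u" "u < pi"
      using assms by (simp_all add: u_def)
    then show "- pi < Im (of_real (ln (2 * sin (pi * s))) + \<i> * of_real (pi * s - pi / 2))"
      and "Im (of_real (ln (2 * sin (pi * s))) + \<i> * of_real (pi * s - pi / 2)) \<le> pi"
      using pi_gt_zero by (simp_all flip: u_def)
  qed
  finally show "Im (Ln (1 - cis (2 * pi * s))) = pi * s - pi / 2"
    by simp
  show "0 < Re (1 - cis (2 * pi * s))"
    using pos by (simp add: c)
qed

text \<open>Abel's method: integrate the derivative for r < 1 from 0 to t, let r tend to 1, and fix
  the constant by the Basel sum at 0. The limit passes under the integral because |Im Ln| <= pi, and
  into the series by Tannery's theorem with majorant 1/n^2.\<close>

lemma sums_cos_over_squares: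
  assumes t: "0 \<le> t" "t \<le> 1"
  shows "(\<lambda>n. cos (2 * pi * real (Suc n) * t) / (real (Suc n))\<^sup>2) sums (pi\<^sup>2 * (t\<^sup>2 - t + 1 / 6))"
proof -
  define r where "r n = 1 + - inverse (real (Suc n))" for n
  have r: "0 \<le> r n" "r n < 1" for n
    by (auto simp: r_def inverse_le_1_iff)
  have r_lim: "r \<longlonglongrightarrow> 1"
    unfolding r_def by (rule LIMSEQ_inverse_real_of_nat_add_minus)
  define F where "F \<rho> s = (\<Sum>n. \<rho> ^ Suc n * cos (2 * pi * real (Suc n) * s) / (real (Suc n))\<^sup>2)" for \<rho> s :: real
  have bd: "norm (\<rho> ^ Suc k * cos (2 * pi * real (Suc k) * s) / (real (Suc k))\<^sup>2) \<le> 1 / (real (Suc k))\<^sup>2"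
    if "0 \<le> \<rho>" "\<rho> \<le> 1" for \<rho> s k
  proof -
    have "\<bar>\<rho> ^ Suc k * cos (2 * pi * real (Suc k) * s)\<bar> \<le> 1 * 1"
      unfolding abs_mult using that by (intro mult_mono) (auto simp: power_le_one simp del: power_Suc)
    then show ?thesis
      by (simp add: divide_right_mono del: power_Suc of_nat_Suc)
  qed
  have F_lim: "(\<lambda>n. F (r n) s) \<longlonglongrightarrow> F 1 s" for s
    unfolding F_def
  proof (rule tannerys_theorem[where M="\<lambda>k. 1 / (real (Suc k))\<^sup>2", THEN conjunct2, THEN conjunct2])
    show "(\<lambda>n. r n ^ Suc k * cos (2 * pi * real (Suc k) * s) / (real (Suc k))\<^sup>2)
        \<longlonglongrightarrow> 1 ^ Suc k * cos (2 * pi * real (Suc k) * s) / (real (Suc k))\<^sup>2" for k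
      by (intro tendsto_intros r_lim) simp
    show "\<forall>\<^sub>F (k, n) in at_top \<times>\<^sub>F sequentially.
        norm (r n ^ Suc k * cos (2 * pi * real (Suc k) * s) / (real (Suc k))\<^sup>2) \<le> 1 / (real (Suc k))\<^sup>2"
      using bd[OF r(1) less_imp_le[OF r(2)]] by (intro always_eventually) auto
  qed (use summable_inverse_squares_Suc in auto)
  \<comment> \<open>The pointwise limit of the derivatives. At s = 0 and s = 1 the argument of
    \<open>Ln\<close> is the positive real \<open>1 - r n\<close>, whence the value 0; two points do
    not affect the integral.\<close>
  define g where "g s = (if s = 0 \<or> s = 1 then 0 else 2 * pi * (pi * s - pi / 2))" for s :: real
  let ?L = "\<lambda>n s. 2 * pi * Im (Ln (1 - of_real (r n) * cis (2 * pi * s)))"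
  have ftc: "(?L n has_integral F (r n) t - F (r n) 0) {0..t}" for n
    using t(1) unfolding F_def
    by (intro fundamental_theorem_of_calculus)
      (auto simp: has_real_derivative_iff_has_vector_derivative[symmetric] simp del: of_nat_Suc power_Suc
        intro!: Abel_cos_series_has_derivative[OF r] DERIV_subset[OF _ subset_UNIV])
  have nz: "1 - of_real (r n) * cis (2 * pi * s) \<noteq> 0" for n s
  proof
    assume "1 - of_real (r n) * cis (2 * pi * s) = 0"
    then have "norm (of_real (r n) * cis (2 * pi * s)) = 1"
      by (metis eq_iff_diff_eq_0 norm_one)
    then show False
      using r[of n] by (simp add: norm_mult)
  qed
  have "(\<lambda>n. integral {0..t} (?L n)) \<longlonglongrightarrow> integral {0..t} g"
  proof (rule dominated_convergence(2)[where h="\<lambda>_. 2 * pi * pi"])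
    show "?L n integrable_on {0..t}" for n
      using ftc by (rule has_integral_integrable)
    show "norm (?L n s) \<le> 2 * pi * pi" for n s
      using Im_Ln_le_pi[OF nz[of n s]] mpi_less_Im_Ln[OF nz[of n s]]
      by (simp add: abs_mult abs_le_iff)
    show "(\<lambda>n. ?L n s) \<longlonglongrightarrow> g s" if "s \<in> {0..t}" for s
    proof (cases "s = 0 \<or> s = 1")
      case True
      then have cis: "cis (2 * pi * s) = 1"
        by (auto simp: complex_eq_iff)
      have "Im (Ln (1 - of_real (r n))) = 0" for n
        using r[of n] Ln_of_real[of "1 - r n"] by simp
      then show ?thesis
        using True by (simp add: cis g_def)
    next
      case False
      then have s: "0 < s" "s < 1"
        using that t by auto
      have "(\<lambda>n. 1 - of_real (r n) * cis (2 * pi * s)) \<longlonglongrightarrow> 1 - of_real 1 * cis (2 * pi * s)"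
        by (intro tendsto_intros r_lim)
      moreover have "1 - of_real 1 * cis (2 * pi * s) \<notin> \<real>\<^sub>\<le>\<^sub>0"
        using Im_Ln_one_minus_cis(2)[OF s] by (auto simp: complex_nonpos_Reals_iff)
      ultimately have "(\<lambda>n. ?L n s) \<longlonglongrightarrow> 2 * pi * Im (Ln (1 - of_real 1 * cis (2 * pi * s)))"
        by (intro tendsto_mult tendsto_const tendsto_Im tendsto_Ln)
      then show ?thesis
        using False Im_Ln_one_minus_cis(1)[OF s] by (simp add: g_def)
    qed
  qed auto
  moreover have "integral {0..t} g = pi\<^sup>2 * (t\<^sup>2 - t)"
  proof (rule integral_unique, rule has_integral_spike_finite[of "{0, 1}"])
    have "((\<lambda>s. 2 * pi * (pi * s - pi / 2)) has_integral
        pi\<^sup>2 * (t\<^sup>2 - t) - pi\<^sup>2 * (0\<^sup>2 - 0)) {0..t}"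
      using t(1)
      by (intro fundamental_theorem_of_calculus)
        (auto simp: has_real_derivative_iff_has_vector_derivative[symmetric] power2_eq_square algebra_simps
          intro!: derivative_eq_intros)
    then show "((\<lambda>s. 2 * pi * (pi * s - pi / 2)) has_integral pi\<^sup>2 * (t\<^sup>2 - t)) {0..t}"
      by simp
  qed (auto simp: g_def)
  moreover have "(\<lambda>n. integral {0..t} (?L n)) \<longlonglongrightarrow> F 1 t - F 1 0"
    using tendsto_diff[OF F_lim F_lim] integral_unique[OF ftc] by simp
  ultimately have "F 1 t - F 1 0 = pi\<^sup>2 * (t\<^sup>2 - t)"
    using LIMSEQ_unique by metis
  moreover have "F 1 0 = pi\<^sup>2 / 6"
    using sums_inverse_squares_Suc by (simp add: F_def sums_iff)
  ultimately have "F 1 t = pi\<^sup>2 * (t\<^sup>2 - t + 1 / 6)"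
    by (simp add: algebra_simps)
  moreover have "summable (\<lambda>n. 1 ^ Suc n * cos (2 * pi * real (Suc n) * t) / (real (Suc n))\<^sup>2)"
    by (intro summable_comparison_test'[OF summable_inverse_squares_Suc, of 0] bd) auto
  ultimately show ?thesis
    unfolding F_def by (simp add: sums_iff)
qed

section \<open>Euler-Maclaurin formula and Poisson summation\<close>

text \<open>Since \<open>c\<close> is an integer multiple of 2 pi, the sines vanish and the cosines
  are 1 at integer endpoints. The gain is the factor 1/c^2: on [0, 1] it brings in the absolutely
  convergent series above, and on [-N, N] it bounds the terms uniformly in N.\<close>

lemma integral_cos_by_parts_twice:
  fixes \<phi> \<phi>' \<phi>'' :: "real \<Rightarrow> complex" and a b :: int and k :: nat
  assumes d1: "\<And>t. (\<phi> has_vector_derivative \<phi>' t) (at t)"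
    and d2: "\<And>t. (\<phi>' has_vector_derivative \<phi>'' t) (at t)"
    and cont2: "continuous_on UNIV \<phi>''"
    and c: "c = 2 * pi * real (Suc k)" and ab: "a \<le> b"
  shows "2 * integral {of_int a..of_int b} (\<lambda>t. cos (c * t) *\<^sub>R \<phi> t)
      = (2 / c\<^sup>2) *\<^sub>R (\<phi>' b - \<phi>' a) - integral {of_int a..of_int b} (\<lambda>t. (2 * cos (c * t) / c\<^sup>2) *\<^sub>R \<phi>'' t)"
proof -
  let ?v = "\<lambda>t. (cos (c * t) / c\<^sup>2) *\<^sub>R \<phi>'' t" and ?w = "\<lambda>t. cos (c * t) *\<^sub>R \<phi> t"
  let ?I = "{real_of_int a..of_int b}"
  have c0: "c > 0"
    by (simp add: c)
  have cs: "cos (c * of_int n) = 1" "sin (c * of_int n) = 0" for n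
    using cos_int_2pin[of "int (Suc k) * n"] sin_int_2pin[of "int (Suc k) * n"]
    by (simp_all add: c mult.assoc)
  have cont: "continuous_on S \<phi>" "continuous_on S \<phi>''" for S
    using has_vector_derivative_continuous[OF d1] continuous_on_subset[OF cont2]
    by (auto intro: continuous_at_imp_continuous_on)
  \<comment> \<open>Both integrations by parts in one antiderivative: the two sine terms of its
    derivative cancel.\<close>
  let ?P = "\<lambda>t. (sin (c * t) / c) *\<^sub>R \<phi> t + (cos (c * t) / c\<^sup>2) *\<^sub>R \<phi>' t"
  have "((\<lambda>t. ?w t + ?v t)
      has_integral (?P b - ?P a)) ?I"
  proof (rule fundamental_theorem_of_calculus)
    fix t
    have 1: "((\<lambda>t. sin (c * t) / c) has_real_derivative cos (c * t)) (at t within ?I)"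
      using c0 by (auto intro!: derivative_eq_intros)
    have 2: "((\<lambda>t. cos (c * t) / c\<^sup>2) has_real_derivative - sin (c * t) / c) (at t within ?I)"
      using c0 by (auto intro!: derivative_eq_intros simp: power2_eq_square)
    show "(?P has_vector_derivative ?w t + ?v t)
        (at t within ?I)"
      using has_vector_derivative_add[OF has_vector_derivative_scaleR[OF 1 d1[THEN has_vector_derivative_at_within]]
          has_vector_derivative_scaleR[OF 2 d2[THEN has_vector_derivative_at_within]]]
      by (rule has_vector_derivative_eq_rhs) (simp add: algebra_simps)
  qed (use ab in simp)
  moreover have "?P b - ?P a = (1 / c\<^sup>2) *\<^sub>R (\<phi>' b - \<phi>' a)"
    by (simp add: cs scaleR_diff_right)
  moreover have "?v integrable_on ?I"
    using c0 by (intro integrable_continuous_real continuous_intros cont) auto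
  moreover have "?w integrable_on ?I"
    by (intro integrable_continuous_real continuous_intros cont)
  ultimately have *: "integral ?I ?w
      + integral ?I ?v = (1 / c\<^sup>2) *\<^sub>R (\<phi>' b - \<phi>' a)"
    by (subst integral_add[symmetric]) (auto dest: integral_unique)
  have **: "integral ?I (\<lambda>t. (2 * cos (c * t) / c\<^sup>2) *\<^sub>R \<phi>'' t)
      = 2 *\<^sub>R integral ?I ?v"
    using integral_cmul[of ?I 2 ?v] by simp
  have "2 * integral ?I ?w
      = 2 *\<^sub>R ((1 / c\<^sup>2) *\<^sub>R (\<phi>' b - \<phi>' a)) - 2 *\<^sub>R integral ?I ?v"
    unfolding *[symmetric] scaleR_add_right by (simp add: scaleR_conv_of_real)
  then show ?thesis
    unfolding ** by simp
qed

text \<open>After two integrations by parts the sum over \<open>k\<close> produces the Bernoulli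
  polynomial, and what remains is the trapezoidal rule with its second-order remainder. In other
  words, the Fourier series of the periodic extension of \<open>\<phi>\<close> takes the mean of the
  one-sided values at the jump.\<close>

lemma cosine_series_unit_interval:
  fixes \<phi> \<phi>' \<phi>'' :: "real \<Rightarrow> complex"
  assumes d1: "\<And>t. (\<phi> has_vector_derivative \<phi>' t) (at t)"
    and d2: "\<And>t. (\<phi>' has_vector_derivative \<phi>'' t) (at t)"
    and cont2: "continuous_on UNIV \<phi>''"
  shows "(\<lambda>k. 2 * integral {0..1} (\<lambda>t. cos (2 * pi * real (Suc k) * t) *\<^sub>R \<phi> t))
    sums ((\<phi> 0 + \<phi> 1) / 2 - integral {0..1} \<phi>)"
proof -
  define c where "c k = 2 * pi * real (Suc k)" for k :: nat
  have c0: "c k > 0" for k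
    by (simp add: c_def)
  have cont: "continuous_on S \<phi>" "continuous_on S \<phi>'" "continuous_on S \<phi>''" for S
    using has_vector_derivative_continuous[OF d1] has_vector_derivative_continuous[OF d2] continuous_on_subset[OF cont2]
    by (auto intro: continuous_at_imp_continuous_on)
  let ?e = "\<lambda>k t. (2 * cos (c k * t) / (c k)\<^sup>2) *\<^sub>R \<phi>'' t"
  let ?\<Delta> = "\<phi>' 1 - \<phi>' 0"
  have parts: "2 * integral {0..1} (\<lambda>t. cos (c k * t) *\<^sub>R \<phi> t)
      = (2 / (c k)\<^sup>2) *\<^sub>R ?\<Delta> - integral {0..1} (?e k)" for k
    using integral_cos_by_parts_twice[OF d1 d2 cont2 c_def, of 0 1] by simp
  \<comment> \<open>1/12 is the value of \<open>B\<close> below at 0 and at 1: it is pi^2/6 divided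
    by 2 pi^2.\<close>
  have s1: "(\<lambda>k. (2 / (c k)\<^sup>2) *\<^sub>R ?\<Delta>) sums ((1 / 12) *\<^sub>R ?\<Delta>)"
  proof -
    have "(\<lambda>k. 1 / (2 * pi\<^sup>2) * (1 / (real (Suc k))\<^sup>2)) sums (1 / (2 * pi\<^sup>2) * (pi\<^sup>2 / 6))"
      by (intro sums_mult sums_inverse_squares_Suc)
    moreover have "1 / (2 * pi\<^sup>2) * (1 / (real (Suc k))\<^sup>2) = 2 / (c k)\<^sup>2" for k
      by (simp add: c_def power2_eq_square field_simps del: of_nat_Suc)
    ultimately show ?thesis
      by (intro sums_scaleR_left) simp
  qed
  (* B is half the second Bernoulli polynomial; EM below is the Euler-Maclaurin formula of order 2. *)
  define B where "B t = (t\<^sup>2 - t + 1 / 6) / 2" for t :: real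
  have s2: "(\<lambda>k. integral {0..1} (?e k))
      sums integral {0..1} (\<lambda>t. B t *\<^sub>R \<phi>'' t)"
  proof -
    obtain M where M: "norm (\<phi>'' t) \<le> M" if "t \<in> {0..1}" for t
      using compact_imp_bounded[OF compact_continuous_image[OF cont(3) compact_Icc[of 0 1]]]
      unfolding bounded_iff by blast
    have ce: "2 * cos (c k * t) / (c k)\<^sup>2 = 1 / (2 * pi\<^sup>2) * (cos (2 * pi * real (Suc k) * t) / (real (Suc k))\<^sup>2)" for k t
      by (simp add: c_def power2_eq_square field_simps del: of_nat_Suc)
    have pt: "(\<lambda>k. ?e k t) sums (B t *\<^sub>R \<phi>'' t)" if "t \<in> {0..1}" for t
    proof (intro sums_scaleR_left)
      have "(\<lambda>k. 1 / (2 * pi\<^sup>2) * (cos (2 * pi * real (Suc k) * t) / (real (Suc k))\<^sup>2))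
          sums (1 / (2 * pi\<^sup>2) * (pi\<^sup>2 * (t\<^sup>2 - t + 1 / 6)))"
        using that by (intro sums_mult sums_cos_over_squares) auto
      then show "(\<lambda>k. 2 * cos (c k * t) / (c k)\<^sup>2) sums B t"
        by (simp add: B_def ce)
    qed
    have "uniform_limit {0..1} (\<lambda>n t. \<Sum>k<n. ?e k t)
        (\<lambda>t. \<Sum>k. ?e k t) sequentially"
    proof (rule Weierstrass_m_test[where M="\<lambda>k. M * (1 / (real (Suc k))\<^sup>2)"])
      fix k t assume t: "t \<in> {0..1::real}"
      have "2 \<le> 4 * (pi * pi)"
        using pi_gt3 mult_mono[of 1 pi 1 pi] by simp
      then have "2 * \<bar>cos (c k * t)\<bar> \<le> 4 * (pi * pi)"
        using abs_cos_le_one[of "c k * t"] by linarith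
      then have "2 * \<bar>cos (c k * t)\<bar> / (c k)\<^sup>2 \<le> 4 * (pi * pi) / (c k)\<^sup>2"
        by (rule divide_right_mono) simp
      also have "\<dots> = 1 / (real (Suc k))\<^sup>2"
        by (simp add: c_def power2_eq_square field_simps del: of_nat_Suc)
      finally have "2 * \<bar>cos (c k * t)\<bar> / (c k)\<^sup>2 * norm (\<phi>'' t) \<le> 1 / (real (Suc k))\<^sup>2 * M"
        using M[OF t] by (intro mult_mono) auto
      then show "norm (?e k t) \<le> M * (1 / (real (Suc k))\<^sup>2)"
        by (simp add: abs_mult mult.commute)
    qed (intro summable_mult summable_inverse_squares_Suc)
    then have ul: "uniform_limit {0..1} (\<lambda>n t. \<Sum>k<n. ?e k t)
        (\<lambda>t. B t *\<^sub>R \<phi>'' t) sequentially"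
      by (rule uniform_limit_cong'[THEN iffD1, rotated -1]) (use pt in \<open>auto simp: sums_iff\<close>)
    have ct: "continuous_on {0..1} (?e k)" for k
      using c0[of k] by (intro continuous_intros cont) auto
    obtain I J where IJ: "\<And>n. ((\<lambda>t. \<Sum>k<n. ?e k t) has_integral I n) {0..1}"
      "((\<lambda>t. B t *\<^sub>R \<phi>'' t) has_integral J) {0..1}" "I \<longlonglongrightarrow> J"
      by (rule uniform_limit_integral[OF ul _ sequentially_bot]) (auto intro!: continuous_on_sum ct)
    have "I n = (\<Sum>k<n. integral {0..1} (?e k))" for n
      using IJ(1)[of n, THEN integral_unique] by (subst (asm) integral_sum) (auto intro!: integrable_continuous_real ct)
    then have "I = (\<lambda>n. \<Sum>k<n. integral {0..1} (?e k))"
      by (rule ext)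
    then show ?thesis
      using IJ(3) integral_unique[OF IJ(2)] by (simp add: sums_def)
  qed
  have EM: "integral {0..1} (\<lambda>t. B t *\<^sub>R \<phi>'' t)
      = (1 / 12) *\<^sub>R ?\<Delta> - ((\<phi> 0 + \<phi> 1) / 2 - integral {0..1} \<phi>)"
  proof -
    \<comment> \<open>\<open>t - 1 / 2\<close> is the derivative of \<open>B\<close>, so the terms
      with \<open>\<phi>'\<close> cancel.\<close>
    let ?P = "\<lambda>t. B t *\<^sub>R \<phi>' t - (t - 1 / 2) *\<^sub>R \<phi> t"
    have "((\<lambda>t. B t *\<^sub>R \<phi>'' t - \<phi> t) has_integral (?P 1 - ?P 0)) {0..1}"
    proof (rule fundamental_theorem_of_calculus)
      fix t
      have 1: "(B has_real_derivative t - 1 / 2) (at t within {0..1})"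
        unfolding B_def[abs_def] by (auto intro!: derivative_eq_intros)
      have 2: "((\<lambda>t. t - 1 / 2) has_real_derivative 1) (at t within {0..1})"
        by (auto intro!: derivative_eq_intros)
      show "(?P has_vector_derivative B t *\<^sub>R \<phi>'' t - \<phi> t) (at t within {0..1})"
        using has_vector_derivative_diff[OF has_vector_derivative_scaleR[OF 1 d2[THEN has_vector_derivative_at_within]]
            has_vector_derivative_scaleR[OF 2 d1[THEN has_vector_derivative_at_within]]]
        by (rule has_vector_derivative_eq_rhs) (simp add: algebra_simps)
    qed simp
    moreover have "?P 1 - ?P 0 = (1 / 12) *\<^sub>R ?\<Delta> - (\<phi> 0 + \<phi> 1) / 2"
      by (simp add: B_def scaleR_conv_of_real field_simps)
    moreover have "(\<lambda>t. B t *\<^sub>R \<phi>'' t) integrable_on {0..1}"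
      unfolding B_def by (intro integrable_continuous_real continuous_intros cont) auto
    moreover have "\<phi> integrable_on {0..1}"
      by (intro integrable_continuous_real cont)
    ultimately have "integral {0..1} (\<lambda>t. B t *\<^sub>R \<phi>'' t) - integral {0..1} \<phi>
        = (1 / 12) *\<^sub>R ?\<Delta> - (\<phi> 0 + \<phi> 1) / 2"
      by (subst integral_diff[symmetric]) (auto dest: integral_unique)
    then show ?thesis
      by (simp add: algebra_simps)
  qed
  show ?thesis
    using sums_diff[OF s1 s2] unfolding parts[symmetric] EM by (simp add: c_def)
qed

lemma integrable_inverse_1_plus_square: "integrable lborel (\<lambda>x::real. 1 / (1 + x\<^sup>2))"
  and integral_inverse_1_plus_square: "(\<integral>x. 1 / (1 + (x::real)\<^sup>2) \<partial>lborel) = pi"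
proof -
  have pos: "1 + x\<^sup>2 > 0" for x :: real
    by (simp add: add_pos_nonneg)
  have F: "((arctan \<circ> real_of_ereal) \<longlongrightarrow> - (pi / 2)) (at_right (-\<infinity>))"
    "((arctan \<circ> real_of_ereal) \<longlongrightarrow> pi / 2) (at_left \<infinity>)"
    using tendsto_arctan_at_bot tendsto_arctan_at_top
    by (simp_all add: ereal_tendsto_simps1)
  note FTC = interval_integral_FTC_nonneg[of "-\<infinity>" \<infinity> arctan "\<lambda>x. 1 / (1 + x\<^sup>2)", OF _ _ _ _ F]
  have "set_integrable lborel (einterval (-\<infinity>) \<infinity>) (\<lambda>x::real. 1 / (1 + x\<^sup>2))"
    using pos by (intro FTC) (auto intro!: derivative_eq_intros continuous_intros simp: less_imp_neq[symmetric] field_simps)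
  moreover have "(LBINT x=-\<infinity>..\<infinity>. 1 / (1 + x\<^sup>2)) = pi / 2 - (- (pi / 2))"
    using pos by (intro FTC) (auto intro!: derivative_eq_intros continuous_intros simp: less_imp_neq[symmetric] field_simps)
  ultimately show "integrable lborel (\<lambda>x::real. 1 / (1 + x\<^sup>2))" "(\<integral>x. 1 / (1 + (x::real)\<^sup>2) \<partial>lborel) = pi"
    by (simp_all add: set_integrable_def interval_lebesgue_integral_def set_lebesgue_integral_def einterval_eq)
qed

lemma quadratic_decay_integrable:
  fixes f :: "real \<Rightarrow> 'a :: {banach, second_countable_topology}"
  assumes "continuous_on UNIV f" and b: "\<And>t. norm (f t) \<le> B / (1 + t\<^sup>2)"
  shows "integrable lborel f" and "norm (\<integral>t. f t \<partial>lborel) \<le> pi * B"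
    and "(\<integral>t. norm (f t) \<partial>lborel) \<le> pi * B"
proof -
  have i: "integrable lborel (\<lambda>t. B * (1 / (1 + t\<^sup>2)))"
    by (intro integrable_mult_right integrable_inverse_1_plus_square)
  show int: "integrable lborel f"
  proof (rule Bochner_Integration.integrable_bound[OF i])
    show "f \<in> borel_measurable lborel"
      using assms(1) by (simp add: borel_measurable_continuous_onI)
    show "AE t in lborel. norm (f t) \<le> norm (B * (1 / (1 + t\<^sup>2)))"
      using order_trans[OF b abs_ge_self] by (intro AE_I2) simp
  qed
  have "(\<integral>t. norm (f t) \<partial>lborel) \<le> (\<integral>t. B * (1 / (1 + t\<^sup>2)) \<partial>lborel)"
    using b by (intro integral_mono i integrable_norm int) auto
  also have "\<dots> = pi * B"
    by (simp only: integral_mult_right_zero integral_inverse_1_plus_square mult.commute)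
  finally show "(\<integral>t. norm (f t) \<partial>lborel) \<le> pi * B" .
  then show "norm (\<integral>t. f t \<partial>lborel) \<le> pi * B"
    using integral_norm_bound[of lborel f] by linarith
qed

lemma integral_symmetric_interval_LIMSEQ:
  fixes g :: "real \<Rightarrow> complex"
  assumes "integrable lborel g"
  shows "(\<lambda>N. integral {- real N..real N} g) \<longlonglongrightarrow> (\<integral>t. g t \<partial>lborel)"
proof -
  have "(\<lambda>N. \<integral>t. indicator {- real N..real N} t *\<^sub>R g t \<partial>lborel) \<longlonglongrightarrow> (\<integral>t. g t \<partial>lborel)"
  proof (rule integral_dominated_convergence[where w="\<lambda>t. norm (g t)"])
    show "AE t in lborel. (\<lambda>N. indicator {- real N..real N} t *\<^sub>R g t) \<longlonglongrightarrow> g t"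
    proof (intro AE_I2 tendsto_eventually)
      fix t :: real
      show "\<forall>\<^sub>F N in sequentially. indicator {- real N..real N} t *\<^sub>R g t = g t"
        using eventually_ge_at_top[of "nat \<lceil>\<bar>t\<bar>\<rceil>"]
        by eventually_elim (auto simp: indicator_def nat_le_iff ceiling_le_iff abs_le_iff)
    qed
  qed (use assms in \<open>auto simp: indicator_def\<close>)
  moreover have "(\<integral>t. indicator {- real N..real N} t *\<^sub>R g t \<partial>lborel) = integral {- real N..real N} g" for N
    using set_borel_integral_eq_integral(2)[of "{- real N..real N}" g] assms
    by (simp add: set_lebesgue_integral_def set_integrable_def integrable_mult_indicator)
  ultimately show ?thesis
    by simp
qed

lemma has_vector_derivative_affine:
  assumes "(f has_vector_derivative f') (at (x + c * t))"
  shows "((\<lambda>t. f (x + c * t)) has_vector_derivative c *\<^sub>R f') (at t)"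
proof -
  have "((\<lambda>t. x + c * t) has_vector_derivative c) (at t)"
    unfolding has_real_derivative_iff_has_vector_derivative[symmetric] by (auto intro!: derivative_eq_intros)
  from vector_diff_chain_at[OF this assms] show ?thesis
    by (simp add: o_def)
qed

text \<open>Translation by an integer does not change the cosines.\<close>

lemma cosine_series_int_interval:
  fixes \<phi> \<phi>' \<phi>'' :: "real \<Rightarrow> complex" and n :: int
  assumes d1: "\<And>t. (\<phi> has_vector_derivative \<phi>' t) (at t)"
    and d2: "\<And>t. (\<phi>' has_vector_derivative \<phi>'' t) (at t)"
    and cont2: "continuous_on UNIV \<phi>''"
  shows "(\<lambda>k. 2 * integral {of_int n..of_int n + 1} (\<lambda>t. cos (2 * pi * real (Suc k) * t) *\<^sub>R \<phi> t))
    sums ((\<phi> n + \<phi> (n + 1)) / 2 - integral {of_int n..of_int n + 1} \<phi>)"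
proof -
  have d: "((\<lambda>t. f (t + of_int n)) has_vector_derivative f' (t + of_int n)) (at t)"
    if "\<And>t. (f has_vector_derivative f' t) (at t)" for f f' :: "real \<Rightarrow> complex" and t
    using has_vector_derivative_affine[of f "f' (t + of_int n)" "of_int n" 1 t] that by (simp add: add.commute)
  have c: "continuous_on S \<phi>" for S
    using has_vector_derivative_continuous[OF d1] by (auto intro: continuous_at_imp_continuous_on)
  have c2: "continuous_on UNIV (\<lambda>t. \<phi>'' (t + of_int n))"
    by (rule continuous_on_compose2[OF cont2]) (auto intro!: continuous_intros)
  have shift: "integral {0..1} (\<lambda>t. f (t + of_int n)) = integral {of_int n..of_int n + 1} f"
    if "continuous_on UNIV f" for f :: "real \<Rightarrow> complex"
    using integral_shift[of 0 "of_int n" 1 f] continuous_on_subset[OF that] by (simp add: o_def add.commute)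
  have cos: "cos (2 * pi * real (Suc k) * (t + of_int n)) = cos (2 * pi * real (Suc k) * t)" for k t
  proof -
    have "2 * pi * real (Suc k) * (t + of_int n) = 2 * pi * real (Suc k) * t + 2 * pi * of_int (int (Suc k) * n)"
      by (simp add: algebra_simps)
    then show ?thesis
      by (simp only: cos_add cos_int_2pin sin_int_2pin)
  qed
  have "integral {0..1} (\<lambda>t. cos (2 * pi * real (Suc k) * t) *\<^sub>R \<phi> (t + of_int n))
      = integral {of_int n..of_int n + 1} (\<lambda>t. cos (2 * pi * real (Suc k) * t) *\<^sub>R \<phi> t)" for k
    using shift[of "\<lambda>t. cos (2 * pi * real (Suc k) * t) *\<^sub>R \<phi> t"] unfolding cos by (simp add: continuous_intros c)
  then show ?thesis
    using cosine_series_unit_interval[OF d[OF d1] d[OF d2] c2] shift[OF c]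
    by (simp add: add.commute del: of_nat_Suc)
qed

text \<open>Trapezoidal sums over adjacent unit intervals merge: interior integers get weight 1, and
  only the two ends keep weight 1/2, which is the correction subtracted.\<close>

lemma cosine_series_symmetric_interval:
  fixes \<phi> \<phi>' \<phi>'' :: "real \<Rightarrow> complex" and N :: nat
  assumes d1: "\<And>t. (\<phi> has_vector_derivative \<phi>' t) (at t)"
    and d2: "\<And>t. (\<phi>' has_vector_derivative \<phi>'' t) (at t)"
    and cont2: "continuous_on UNIV \<phi>''"
  shows "(\<lambda>k. 2 * integral {- real N..real N} (\<lambda>t. cos (2 * pi * real (Suc k) * t) *\<^sub>R \<phi> t))
    sums (\<phi> 0 + (\<Sum>n<N. \<phi> (real (Suc n)) + \<phi> (- real (Suc n))) - (\<phi> N + \<phi> (- real N)) / 2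
      - integral {- real N..real N} \<phi>)"
proof (induction N)
  case 0
  show ?case by simp
next
  case (Suc N)
  have c: "continuous_on S \<phi>" for S
    using has_vector_derivative_continuous[OF d1] by (auto intro: continuous_at_imp_continuous_on)
  have e: "real N + 1 = real (Suc N)" "- real N - 1 = - real (Suc N)"
    by simp_all
  have split: "integral {- real (Suc N)..real (Suc N)} f = integral {- real N..real N} f
      + integral {real N..real (Suc N)} f + integral {- real (Suc N)..- real N} f"
    if "continuous_on UNIV f" for f :: "real \<Rightarrow> complex"
  proof -
    have i: "f integrable_on {a..b}" for a b
      using continuous_on_subset[OF that] by (intro integrable_continuous_real) auto
    have F: "integral {- real N..real N} f + integral {real N..real (Suc N)} f = integral {- real N..real (Suc N)} f"
      "integral {- real (Suc N)..- real N} f + integral {- real N..real (Suc N)} f = integral {- real (Suc N)..real (Suc N)} f"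
      by (intro Henstock_Kurzweil_Integration.integral_combine i; simp)+
    show ?thesis
      unfolding F(2)[symmetric] F(1)[symmetric] by (simp only: add_ac)
  qed
  let ?c = "\<lambda>k t. cos (2 * pi * real (Suc k) * t) *\<^sub>R \<phi> t"
  have eq: "(\<lambda>k. 2 * integral {- real (Suc N)..real (Suc N)} (?c k)) = (\<lambda>k. 2 * integral {- real N..real N} (?c k)
      + 2 * integral {real N..real (Suc N)} (?c k) + 2 * integral {- real (Suc N)..- real N} (?c k))"
  proof
    fix k
    have "continuous_on UNIV (?c k)"
      by (intro continuous_intros c)
    then show "2 * integral {- real (Suc N)..real (Suc N)} (?c k) = 2 * integral {- real N..real N} (?c k)
      + 2 * integral {real N..real (Suc N)} (?c k) + 2 * integral {- real (Suc N)..- real N} (?c k)"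
      unfolding split[OF \<open>continuous_on UNIV (?c k)\<close>] by (simp only: distrib_left)
  qed
  have s1: "(\<lambda>k. 2 * integral {real N..real (Suc N)} (?c k))
      sums ((\<phi> N + \<phi> (real (Suc N))) / 2 - integral {real N..real (Suc N)} \<phi>)"
    using cosine_series_int_interval[OF assms, of "int N"] by (simp only: of_int_of_nat_eq of_int_add of_int_1 e)
  have s2: "(\<lambda>k. 2 * integral {- real (Suc N)..- real N} (?c k))
      sums ((\<phi> (- real (Suc N)) + \<phi> (- real N)) / 2 - integral {- real (Suc N)..- real N} \<phi>)"
    using cosine_series_int_interval[OF assms, of "- int N - 1"]
    by (simp only: of_int_of_nat_eq of_int_add of_int_diff of_int_minus of_int_1 e(2) diff_add_cancel)
      (simp only: e flip: e(2), simp del: of_nat_Suc)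
  show ?case
    unfolding eq split[OF c] sum.lessThan_Suc
    using sums_add[OF sums_add[OF Suc.IH s1] s2]
    by (rule back_subst[where P="\<lambda>z. _ sums z"]) (simp add: field_simps del: of_nat_Suc)
qed

text \<open>The hypotheses of the Poisson formula in one predicate, so that they can be carried
  through the substitution of x + c t for t; a single \<open>B\<close> serves all three
  functions.\<close>

definition C2_quadratic_decay :: "(real \<Rightarrow> complex) \<Rightarrow> bool" where
  "C2_quadratic_decay \<phi> \<longleftrightarrow> (\<exists>\<phi>' \<phi>'' B. (\<forall>t. (\<phi> has_vector_derivative \<phi>' t) (at t)) \<and>
     (\<forall>t. (\<phi>' has_vector_derivative \<phi>'' t) (at t)) \<and> continuous_on UNIV \<phi>'' \<and>
     (\<forall>t. norm (\<phi> t) \<le> B / (1 + t\<^sup>2) \<and> norm (\<phi>' t) \<le> B / (1 + t\<^sup>2) \<and> norm (\<phi>'' t) \<le> B / (1 + t\<^sup>2)))"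

text \<open>With s = x + c t one has t = (s - x)/c, hence t^2 <= (2 s^2 + 2 x^2)/c^2, and 1 + t^2 is
  at most a constant times 1 + s^2.\<close>

lemma one_plus_square_affine_le:
  fixes x c t :: real
  assumes "c \<noteq> 0"
  shows "1 / (1 + (x + c * t)\<^sup>2) \<le> (1 + 2 / c\<^sup>2 + 2 * x\<^sup>2 / c\<^sup>2) / (1 + t\<^sup>2)"
proof -
  define s where "s = x + c * t"
  have c2: "c\<^sup>2 > 0"
    using assms by simp
  have pos: "1 + s\<^sup>2 > 0" "1 + t\<^sup>2 > 0"
    by (simp_all add: add_pos_nonneg)
  have "c\<^sup>2 * t\<^sup>2 = (s - x)\<^sup>2"
    by (simp add: s_def power_mult_distrib)
  also have "\<dots> \<le> 2 * s\<^sup>2 + 2 * x\<^sup>2"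
    using sum_squares_bound[of s "- x"] by (simp add: power2_diff)
  finally have "t\<^sup>2 \<le> (2 * s\<^sup>2 + 2 * x\<^sup>2) / c\<^sup>2"
    using c2 by (simp add: pos_le_divide_eq mult.commute)
  then have "1 + t\<^sup>2 \<le> 1 + (2 / c\<^sup>2) * s\<^sup>2 + 2 * x\<^sup>2 / c\<^sup>2"
    by (simp add: add_divide_distrib)
  also have "\<dots> \<le> (1 + 2 / c\<^sup>2 + 2 * x\<^sup>2 / c\<^sup>2) * (1 + s\<^sup>2)"
  proof -
    define u v where "u = 2 / c\<^sup>2" and "v = 2 * x\<^sup>2 / c\<^sup>2"
    have "0 \<le> u + s\<^sup>2 + v * s\<^sup>2"
      by (simp add: u_def v_def)
    then show ?thesis
      unfolding u_def[symmetric] v_def[symmetric] by (simp add: algebra_simps)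
  qed
  finally show ?thesis
    using pos unfolding s_def[symmetric] by (simp add: field_simps)
qed

lemma C2_quadratic_decay_affine:
  assumes "C2_quadratic_decay \<phi>" and c: "c \<noteq> 0"
  shows "C2_quadratic_decay (\<lambda>t. \<phi> (x + c * t))"
proof -
  obtain \<phi>' \<phi>'' B where d1: "\<And>t. (\<phi> has_vector_derivative \<phi>' t) (at t)"
    and d2: "\<And>t. (\<phi>' has_vector_derivative \<phi>'' t) (at t)" and c2: "continuous_on UNIV \<phi>''"
    and b: "\<And>t. norm (\<phi> t) \<le> B / (1 + t\<^sup>2)" "\<And>t. norm (\<phi>' t) \<le> B / (1 + t\<^sup>2)" "\<And>t. norm (\<phi>'' t) \<le> B / (1 + t\<^sup>2)"
    using assms(1) unfolding C2_quadratic_decay_def by blast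
  have B: "B \<ge> 0"
    using order_trans[OF norm_ge_zero b(1)[of 0]] by simp
  define K where "K = 1 + 2 / c\<^sup>2 + 2 * x\<^sup>2 / c\<^sup>2"
  have K: "K \<ge> 0"
    by (simp add: K_def)
  have le: "norm (a *\<^sub>R z) \<le> ((1 + \<bar>c\<bar> + c\<^sup>2) * B * K) / (1 + t\<^sup>2)"
    if "\<bar>a\<bar> \<le> 1 + \<bar>c\<bar> + c\<^sup>2" "norm z \<le> B / (1 + (x + c * t)\<^sup>2)" for a t and z :: complex
  proof -
    have "norm z \<le> B * (1 / (1 + (x + c * t)\<^sup>2))"
      using that(2) by simp
    also have "\<dots> \<le> B * (K / (1 + t\<^sup>2))"
      unfolding K_def by (rule mult_left_mono[OF one_plus_square_affine_le[OF c] B])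
    finally have "\<bar>a\<bar> * norm z \<le> (1 + \<bar>c\<bar> + c\<^sup>2) * (B * (K / (1 + t\<^sup>2)))"
      using that(1) by (intro mult_mono) auto
    then show ?thesis
      by (simp add: mult.assoc)
  qed
  show ?thesis
    unfolding C2_quadratic_decay_def
  proof (intro exI conjI allI)
    fix t
    show "((\<lambda>t. \<phi> (x + c * t)) has_vector_derivative c *\<^sub>R \<phi>' (x + c * t)) (at t)"
      by (rule has_vector_derivative_affine[OF d1])
    show "((\<lambda>t. c *\<^sub>R \<phi>' (x + c * t)) has_vector_derivative (c\<^sup>2) *\<^sub>R \<phi>'' (x + c * t)) (at t)"
      using has_vector_derivative_scaleR[OF DERIV_const has_vector_derivative_affine[OF d2], of c x c t]
      by (simp add: power2_eq_square)
    show "continuous_on UNIV (\<lambda>t. (c\<^sup>2) *\<^sub>R \<phi>'' (x + c * t))"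
      by (intro continuous_on_scaleR continuous_on_const continuous_on_compose2[OF c2]) (auto intro!: continuous_intros)
    show "norm (\<phi> (x + c * t)) \<le> ((1 + \<bar>c\<bar> + c\<^sup>2) * B * K) / (1 + t\<^sup>2)"
      using le[of 1, OF _ b(1)] by simp
    show "norm (c *\<^sub>R \<phi>' (x + c * t)) \<le> ((1 + \<bar>c\<bar> + c\<^sup>2) * B * K) / (1 + t\<^sup>2)"
      by (rule le[OF _ b(2)]) simp
    show "norm ((c\<^sup>2) *\<^sub>R \<phi>'' (x + c * t)) \<le> ((1 + \<bar>c\<bar> + c\<^sup>2) * B * K) / (1 + t\<^sup>2)"
      by (rule le[OF _ b(3)]) simp
  qed
qed

text \<open>Let N tend to infinity in the formula on [-N, N]: the end correction dies and the
  integrals extend to the line. Sum over \<open>k\<close> and limit in N are exchanged by Tannery's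
  theorem, which asks for a bound of order 1/k^2 independent of N.\<close>

lemma Poisson_summation_unit:
  fixes \<phi> :: "real \<Rightarrow> complex"
  assumes "C2_quadratic_decay \<phi>"
  shows "summable (\<lambda>n. \<phi> (real (Suc n)) + \<phi> (- real (Suc n)))"
    and "(\<lambda>k. 2 * (\<integral>t. cos (2 * pi * real (Suc k) * t) *\<^sub>R \<phi> t \<partial>lborel))
      sums (\<phi> 0 + (\<Sum>n. \<phi> (real (Suc n)) + \<phi> (- real (Suc n))) - (\<integral>t. \<phi> t \<partial>lborel))"
proof -
  let ?p = "\<lambda>n. \<phi> (real (Suc n)) + \<phi> (- real (Suc n))"
  obtain \<phi>' \<phi>'' B where d1: "\<And>t. (\<phi> has_vector_derivative \<phi>' t) (at t)"
    and d2: "\<And>t. (\<phi>' has_vector_derivative \<phi>'' t) (at t)" and c2: "continuous_on UNIV \<phi>''"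
    and b: "\<And>t. norm (\<phi> t) \<le> B / (1 + t\<^sup>2)" "\<And>t. norm (\<phi>' t) \<le> B / (1 + t\<^sup>2)" "\<And>t. norm (\<phi>'' t) \<le> B / (1 + t\<^sup>2)"
    using assms(1) unfolding C2_quadratic_decay_def by blast
  have B: "B \<ge> 0"
    using order_trans[OF norm_ge_zero b(1)[of 0]] by simp
  have c: "continuous_on S \<phi>" for S
    using has_vector_derivative_continuous[OF d1] by (auto intro: continuous_at_imp_continuous_on)
  have c2': "continuous_on S \<phi>''" for S
    using continuous_on_subset[OF c2] by auto
  have cosb: "norm (cos u *\<^sub>R z) \<le> norm z" for u :: real and z :: complex
    using mult_right_mono[OF abs_cos_le_one norm_ge_zero[of z]] by simp
  have int: "integrable lborel \<phi>"
    by (rule quadratic_decay_integrable[OF c b(1)])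
  have intc: "integrable lborel (\<lambda>t. cos (u * t) *\<^sub>R \<phi> t)" for u
    by (rule quadratic_decay_integrable(1)[of _ B, OF _ order_trans[OF cosb b(1)]]) (intro continuous_intros c)
  have Blim: "(\<lambda>N. B / (1 + (real N)\<^sup>2)) \<longlonglongrightarrow> 0"
  proof (rule Lim_null_comparison)
    show "\<forall>\<^sub>F N in sequentially. norm (B / (1 + (real N)\<^sup>2)) \<le> B * inverse (real N)"
      using eventually_gt_at_top[of 0]
    proof eventually_elim
      case (elim N)
      have "real N * 1 \<le> real N * real N"
        using elim by (intro mult_left_mono) auto
      then have "real N \<le> 1 + (real N)\<^sup>2"
        by (simp add: power2_eq_square)
      then show ?case
        using elim B by (simp add: divide_inverse mult_left_mono le_imp_inverse_le)
    qed
    show "(\<lambda>N. B * inverse (real N)) \<longlonglongrightarrow> 0"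
      using tendsto_mult_left[OF lim_inverse_n, of B] by simp
  qed
  have edge: "(\<lambda>N. (\<phi> (real N) + \<phi> (- real N)) / 2) \<longlonglongrightarrow> 0"
  proof -
    have "norm (\<phi> (- real N)) \<le> B / (1 + (real N)\<^sup>2)" for N
      using b(1)[of "- real N"] by simp
    then have "(\<lambda>N. \<phi> (real N)) \<longlonglongrightarrow> 0" "(\<lambda>N. \<phi> (- real N)) \<longlonglongrightarrow> 0"
      by (intro Lim_null_comparison[OF always_eventually Blim] allI b(1); simp)+
    from tendsto_add[OF this] show ?thesis
      by (auto intro!: tendsto_divide_zero)
  qed
  show sm: "summable ?p"
  proof (rule summable_comparison_test'[of "\<lambda>n. 2 * B * (1 / (real (Suc n))\<^sup>2)" 0])
    show "summable (\<lambda>n. 2 * B * (1 / (real (Suc n))\<^sup>2))"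
      by (intro summable_mult summable_inverse_squares_Suc)
    fix n
    have "B / (1 + (real (Suc n))\<^sup>2) \<le> B / (real (Suc n))\<^sup>2"
      using B by (intro divide_left_mono) (auto simp: add_pos_nonneg simp del: of_nat_Suc)
    then show "norm (?p n) \<le> 2 * B * (1 / (real (Suc n))\<^sup>2)"
      using norm_triangle_le[of "\<phi> (real (Suc n))" "\<phi> (- real (Suc n))" "2 * B * (1 / (real (Suc n))\<^sup>2)"]
        b(1)[of "real (Suc n)"] b(1)[of "- real (Suc n)"]
      by (simp del: of_nat_Suc)
  qed
  define s where "s k N = 2 * integral {- real N..real N} (\<lambda>t. cos (2 * pi * real (Suc k) * t) *\<^sub>R \<phi> t)" for k N
  define S where "S k = 2 * (\<integral>t. cos (2 * pi * real (Suc k) * t) *\<^sub>R \<phi> t \<partial>lborel)" for k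
  have s_lim: "(\<lambda>N. s k N) \<longlonglongrightarrow> S k" for k
    unfolding s_def S_def by (intro tendsto_mult tendsto_const integral_symmetric_interval_LIMSEQ intc)
  \<comment> \<open>The 2 stems from the two boundary values of \<open>\<phi>'\<close>, the
    \<open>pi\<close> from the integral of the norm of \<open>\<phi>''\<close>; the common factor
    2/c^2 is at most 1/(k+1)^2.\<close>
  have s_bound: "norm (s k N) \<le> (2 + pi) * B * (1 / (real (Suc k))\<^sup>2)" for k N
  proof -
    define c where "c = 2 * pi * real (Suc k)"
    let ?e = "\<lambda>t. (2 * cos (c * t) / c\<^sup>2) *\<^sub>R \<phi>'' t"
    have c0: "c > 0"
      by (simp add: c_def)
    have "2 \<le> 4 * pi\<^sup>2"
      using one_le_power[of pi 2] pi_gt3 by linarith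
    then have "2 * (real (Suc k))\<^sup>2 \<le> 4 * pi\<^sup>2 * (real (Suc k))\<^sup>2"
      by (rule mult_right_mono) simp
    then have cc: "2 * (real (Suc k))\<^sup>2 \<le> c\<^sup>2"
      by (simp add: c_def power_mult_distrib del: of_nat_Suc)
    have eq: "s k N = (2 / c\<^sup>2) *\<^sub>R (\<phi>' (real N) - \<phi>' (- real N))
        - integral {- real N..real N} ?e"
      using integral_cos_by_parts_twice[OF d1 d2 c2 c_def, of "- int N" "int N"]
      by (simp add: s_def c_def)
    have bB: "norm (\<phi>' t) \<le> B" for t
      by (rule order_trans[OF b(2)]) (use B in \<open>simp add: divide_le_eq add_pos_nonneg mult_le_cancel_left1\<close>)
    have "norm ((2 / c\<^sup>2) *\<^sub>R (\<phi>' (real N) - \<phi>' (- real N))) \<le> (2 / c\<^sup>2) * (2 * B)"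
      using norm_triangle_ineq4[of "\<phi>' (real N)" "\<phi>' (- real N)"] bB[of "real N"] bB[of "- real N"]
      unfolding norm_scaleR by (intro mult_mono) auto
    moreover have "norm (integral {- real N..real N} ?e) \<le> (2 / c\<^sup>2) * (pi * B)"
    proof -
      have i: "integrable lborel (\<lambda>t. (2 / c\<^sup>2) * norm (\<phi>'' t))"
        by (intro integrable_mult_right integrable_norm quadratic_decay_integrable(1)[OF c2 b(3)])
      have "norm (integral {- real N..real N} ?e)
          \<le> integral {- real N..real N} (\<lambda>t. (2 / c\<^sup>2) * norm (\<phi>'' t))"
      proof (rule integral_norm_bound_integral)
        show "?e integrable_on {- real N..real N}"
          "(\<lambda>t. (2 / c\<^sup>2) * norm (\<phi>'' t)) integrable_on {- real N..real N}"
          using c0 by (auto intro!: integrable_continuous_real continuous_intros c2')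
        fix t
        show "norm ((2 * cos (c * t) / c\<^sup>2) *\<^sub>R \<phi>'' t) \<le> (2 / c\<^sup>2) * norm (\<phi>'' t)"
          using mult_left_mono[OF cosb[of "c * t" "\<phi>'' t"], of "2 / c\<^sup>2"] by (simp add: abs_mult mult_ac)
      qed
      also have "\<dots> \<le> integral UNIV (\<lambda>t. (2 / c\<^sup>2) * norm (\<phi>'' t))"
        using has_integral_integral_lborel[OF i] c0
        by (intro integral_subset_le) (auto intro!: integrable_continuous_real continuous_intros c2')
      also have "\<dots> = (2 / c\<^sup>2) * (\<integral>t. norm (\<phi>'' t) \<partial>lborel)"
        using integral_lborel[OF i] by simp
      also have "\<dots> \<le> (2 / c\<^sup>2) * (pi * B)"
        by (intro mult_left_mono quadratic_decay_integrable(3)[OF c2 b(3)]) auto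
      finally show ?thesis .
    qed
    ultimately have "norm (s k N) \<le> (2 / c\<^sup>2) * (2 * B) + (2 / c\<^sup>2) * (pi * B)"
      unfolding eq by (rule order_trans[OF norm_triangle_ineq4 add_mono])
    also have "\<dots> = (2 / c\<^sup>2) * ((2 + pi) * B)"
      by (simp only: distrib_left distrib_right)
    also have "\<dots> \<le> (2 / (2 * (real (Suc k))\<^sup>2)) * ((2 + pi) * B)"
      using cc c0 B by (intro mult_right_mono divide_left_mono) (auto simp del: of_nat_Suc)
    also have "\<dots> = (2 + pi) * B * (1 / (real (Suc k))\<^sup>2)"
      by (simp del: of_nat_Suc)
    finally show ?thesis .
  qed
  have tan: "summable (\<lambda>k. norm (S k)) \<and> (\<lambda>N. \<Sum>k. s k N) \<longlonglongrightarrow> suminf S"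
  proof (rule tannerys_theorem[of s S sequentially, OF s_lim, THEN conjunct2])
    show "\<forall>\<^sub>F (k, N) in at_top \<times>\<^sub>F sequentially. norm (s k N) \<le> (2 + pi) * B * (1 / (real (Suc k))\<^sup>2)"
      using s_bound by (intro always_eventually) blast
    show "summable (\<lambda>k. (2 + pi) * B * (1 / (real (Suc k))\<^sup>2))"
      by (intro summable_mult summable_inverse_squares_Suc)
  qed simp
  have eqN: "(\<Sum>k. s k N) = \<phi> 0 + (\<Sum>n<N. ?p n)
      - (\<phi> N + \<phi> (- real N)) / 2 - integral {- real N..real N} \<phi>" for N
    unfolding s_def by (rule sums_unique[OF cosine_series_symmetric_interval[OF d1 d2 c2, of N], symmetric])
  have "(\<lambda>N. \<Sum>k. s k N) \<longlonglongrightarrow>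
      \<phi> 0 + (\<Sum>n. ?p n) - 0 - (\<integral>t. \<phi> t \<partial>lborel)"
    unfolding eqN
    by (intro tendsto_diff tendsto_add tendsto_const summable_LIMSEQ sm edge integral_symmetric_interval_LIMSEQ int)
  then have "suminf S = \<phi> 0 + (\<Sum>n. ?p n) - (\<integral>t. \<phi> t \<partial>lborel)"
    using LIMSEQ_unique tan by force
  moreover have "summable S"
    using tan summable_norm_cancel by blast
  ultimately show "(\<lambda>k. 2 * (\<integral>t. cos (2 * pi * real (Suc k) * t) *\<^sub>R \<phi> t \<partial>lborel))
      sums (\<phi> 0 + (\<Sum>n. ?p n) - (\<integral>t. \<phi> t \<partial>lborel))"
    unfolding S_def[symmetric] by (simp add: sums_iff)
qed

section \<open>Schwartz functions and the Fourier transform\<close>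

text \<open>A tower of successive derivatives given by explicit functions. Its bottom member
  determines it, so iterated derivatives can be found by guessing a formula for all orders and
  checking one step.\<close>

definition deriv_seq :: "(nat \<Rightarrow> real \<Rightarrow> 'a::real_normed_vector) \<Rightarrow> bool" where
  "deriv_seq F \<longleftrightarrow> (\<forall>m x. (F m has_vector_derivative F (Suc m) x) (at x))"

lemma deriv_seqD: "deriv_seq F \<Longrightarrow> (F m has_vector_derivative F (Suc m) x) (at x)"
  by (simp add: deriv_seq_def)

lemma deriv_seq_vderiv_funpow:
  assumes "deriv_seq F"
  shows "(vderiv ^^ m) (F 0) = F m"
proof (induction m)
  case (Suc m)
  then show ?case
    using vector_derivative_at[OF deriv_seqD[OF assms]] by (auto simp: vderiv_def)
qed simp

lemma deriv_seq_imp_smooth: "deriv_seq F \<Longrightarrow> smooth_on UNIV (F 0)"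
  unfolding smooth_on_def
  by (auto simp: deriv_seq_vderiv_funpow intro: differentiableI_vector deriv_seqD)

lemma smooth_imp_deriv_seq:
  assumes "smooth_on UNIV f"
  shows "deriv_seq (\<lambda>m. (vderiv ^^ m) f)"
  using assms unfolding deriv_seq_def smooth_on_def
  by (simp add: vderiv_def vector_derivative_works[symmetric])

lemma SchwartzI:
  assumes "deriv_seq F" "\<And>k m. \<exists>M. \<forall>x. \<bar>x\<bar> ^ k * norm (F m x) \<le> M"
  shows "F 0 \<in> Schwartz"
  using assms(2)
  by (auto simp: Schwartz_def deriv_seq_imp_smooth[OF assms(1)] deriv_seq_vderiv_funpow[OF assms(1)]
      bounded_iff abs_mult)

lemma Schwartz_deriv_seq: "f \<in> Schwartz \<Longrightarrow> deriv_seq (\<lambda>m. (vderiv ^^ m) f)"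
  by (auto simp: Schwartz_def smooth_imp_deriv_seq)

lemma Schwartz_has_derivative:
  "f \<in> Schwartz \<Longrightarrow> ((vderiv ^^ m) f has_vector_derivative (vderiv ^^ Suc m) f x) (at x)"
  by (rule deriv_seqD[OF Schwartz_deriv_seq])

lemma Schwartz_continuous_on: "f \<in> Schwartz \<Longrightarrow> continuous_on S ((vderiv ^^ m) f)"
  using has_vector_derivative_continuous[OF Schwartz_has_derivative]
  by (auto intro: continuous_at_imp_continuous_on)

lemma Schwartz_seminorm_upper:
  assumes "f \<in> Schwartz"
  shows "\<bar>x\<bar> ^ k * norm ((vderiv ^^ m) f x) \<le> Schwartz_seminorm k m f"
  unfolding Schwartz_seminorm_def
  using assms by (intro cSUP_upper bounded_imp_bdd_above) (auto simp: Schwartz_def)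

lemma Schwartz_seminorm_least:
  assumes "\<And>x. \<bar>x\<bar> ^ k * norm ((vderiv ^^ m) f x) \<le> M"
  shows "Schwartz_seminorm k m f \<le> M"
  unfolding Schwartz_seminorm_def using assms by (intro cSUP_least) auto

lemma Schwartz_seminorm_nonneg: "f \<in> Schwartz \<Longrightarrow> 0 \<le> Schwartz_seminorm k m f"
  by (rule order_trans[OF _ Schwartz_seminorm_upper[of f 0]]) auto

lemma vderiv_funpow_lincomb:
  assumes "smooth_on UNIV f" "smooth_on UNIV g"
  shows "deriv_seq (\<lambda>m x. a * (vderiv ^^ m) f x + b * (vderiv ^^ m) g x :: complex)"
    and "(vderiv ^^ m) (\<lambda>x. a * f x + b * g x) = (\<lambda>x. a * (vderiv ^^ m) f x + b * (vderiv ^^ m) g x)"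
proof -
  show *: "deriv_seq (\<lambda>m x. a * (vderiv ^^ m) f x + b * (vderiv ^^ m) g x)"
    using smooth_imp_deriv_seq[OF assms(1)] smooth_imp_deriv_seq[OF assms(2)] unfolding deriv_seq_def
    by (auto intro!: has_vector_derivative_add has_vector_derivative_mult_right)
  show "(vderiv ^^ m) (\<lambda>x. a * f x + b * g x) = (\<lambda>x. a * (vderiv ^^ m) f x + b * (vderiv ^^ m) g x)"
    using deriv_seq_vderiv_funpow[OF *] by simp
qed

lemma Schwartz_lincomb:
  assumes "f \<in> Schwartz" "g \<in> Schwartz"
  shows "(\<lambda>x. a * f x + b * g x) \<in> Schwartz"
proof -
  have s: "smooth_on UNIV f" "smooth_on UNIV g"
    using assms by (auto simp: Schwartz_def)
  have "(\<lambda>m x. a * (vderiv ^^ m) f x + b * (vderiv ^^ m) g x) 0 \<in> Schwartz"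
  proof (rule SchwartzI[OF vderiv_funpow_lincomb(1)[OF s]], intro exI allI)
    fix k m x
    have "norm (a * (vderiv ^^ m) f x + b * (vderiv ^^ m) g x)
        \<le> norm a * norm ((vderiv ^^ m) f x) + norm b * norm ((vderiv ^^ m) g x)"
      by (metis norm_mult norm_triangle_ineq)
    then have "\<bar>x\<bar> ^ k * norm (a * (vderiv ^^ m) f x + b * (vderiv ^^ m) g x)
        \<le> \<bar>x\<bar> ^ k * (norm a * norm ((vderiv ^^ m) f x) + norm b * norm ((vderiv ^^ m) g x))"
      by (intro mult_left_mono) auto
    also have "\<dots> = norm a * (\<bar>x\<bar> ^ k * norm ((vderiv ^^ m) f x)) + norm b * (\<bar>x\<bar> ^ k * norm ((vderiv ^^ m) g x))"
      by (simp add: algebra_simps)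
    also have "\<dots> \<le> norm a * Schwartz_seminorm k m f + norm b * Schwartz_seminorm k m g"
      by (intro add_mono mult_left_mono Schwartz_seminorm_upper assms) auto
    finally show "\<bar>x\<bar> ^ k * norm (a * (vderiv ^^ m) f x + b * (vderiv ^^ m) g x)
        \<le> norm a * Schwartz_seminorm k m f + norm b * Schwartz_seminorm k m g" .
  qed
  then show ?thesis
    by simp
qed

lemma Schwartz_diff: "f \<in> Schwartz \<Longrightarrow> g \<in> Schwartz \<Longrightarrow> (\<lambda>x. f x - g x) \<in> Schwartz"
  using Schwartz_lincomb[of f g 1 "-1"] by simp

lemma vderiv_funpow_diff:
  "f \<in> Schwartz \<Longrightarrow> g \<in> Schwartz \<Longrightarrow>
    (vderiv ^^ m) (\<lambda>x. f x - g x) = (\<lambda>x. (vderiv ^^ m) f x - (vderiv ^^ m) g x)"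
  using vderiv_funpow_lincomb(2)[of f g m 1 "-1"] by (simp add: Schwartz_def)

lemma Schwartz_seminorm_triangle:
  assumes "f \<in> Schwartz" "g \<in> Schwartz" "h \<in> Schwartz"
  shows "Schwartz_seminorm k m (\<lambda>x. f x - h x)
    \<le> Schwartz_seminorm k m (\<lambda>x. f x - g x) + Schwartz_seminorm k m (\<lambda>x. g x - h x)"
proof (rule Schwartz_seminorm_least)
  fix x
  have "\<bar>x\<bar> ^ k * norm ((vderiv ^^ m) f x - (vderiv ^^ m) h x)
      \<le> \<bar>x\<bar> ^ k * (norm ((vderiv ^^ m) f x - (vderiv ^^ m) g x) + norm ((vderiv ^^ m) g x - (vderiv ^^ m) h x))"
    by (intro mult_left_mono norm_diff_triangle_le[OF order_refl order_refl]) simp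
  also have "\<dots> \<le> Schwartz_seminorm k m (\<lambda>x. f x - g x) + Schwartz_seminorm k m (\<lambda>x. g x - h x)"
    using Schwartz_seminorm_upper[OF Schwartz_diff[OF assms(1,2)], of x k m]
      Schwartz_seminorm_upper[OF Schwartz_diff[OF assms(2,3)], of x k m]
    by (simp add: vderiv_funpow_diff assms distrib_left)
  finally show "\<bar>x\<bar> ^ k * norm ((vderiv ^^ m) (\<lambda>x. f x - h x) x)
      \<le> Schwartz_seminorm k m (\<lambda>x. f x - g x) + Schwartz_seminorm k m (\<lambda>x. g x - h x)"
    by (simp add: vderiv_funpow_diff assms)
qed

lemma Hplus_imp_Schwartz: "f \<in> Hplus \<Longrightarrow> f \<in> Schwartz"
  by (simp add: Hplus_def)

lemma Hplus_even: "f \<in> Hplus \<Longrightarrow> f (- x) = f x"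
  by (simp add: Hplus_def)

lemma Hplus_diff: "f \<in> Hplus \<Longrightarrow> g \<in> Hplus \<Longrightarrow> (\<lambda>x. f x - g x) \<in> Hplus"
  by (simp add: Hplus_def Schwartz_diff)

text \<open>The functions (-1)^m f^(m)(-x) form another derivative tower over \<open>f\<close>, and
  such a tower is unique.\<close>

lemma vderiv_funpow_even:
  assumes "f \<in> Hplus"
  shows "(vderiv ^^ m) f (- x) = ((-1) ^ m) *\<^sub>R (vderiv ^^ m) f x"
proof -
  define F where "F m x = ((-1) ^ m) *\<^sub>R (vderiv ^^ m) f (- x)" for m x
  have "deriv_seq F"
    unfolding deriv_seq_def
  proof (intro allI)
    fix m x
    have "((\<lambda>x. (vderiv ^^ m) f (0 + (-1) * x)) has_vector_derivative (-1) *\<^sub>R (vderiv ^^ Suc m) f (0 + (-1) * x)) (at x)"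
      by (rule has_vector_derivative_affine[OF Schwartz_has_derivative[OF Hplus_imp_Schwartz[OF assms]]])
    from has_vector_derivative_scaleR[OF DERIV_const this, of "(-1) ^ m"]
    show "(F m has_vector_derivative F (Suc m) x) (at x)"
      by (simp add: F_def[abs_def])
  qed
  moreover have "F 0 = f"
    using Hplus_even[OF assms] by (simp add: F_def[abs_def])
  ultimately have "(vderiv ^^ m) f x = F m x"
    using deriv_seq_vderiv_funpow by metis
  then show ?thesis
    by (simp add: F_def flip: power_mult_distrib)
qed

lemma norm_vderiv_funpow_even:
  "f \<in> Hplus \<Longrightarrow> norm ((vderiv ^^ m) f (- x)) = norm ((vderiv ^^ m) f x)"
  by (simp add: vderiv_funpow_even)

lemma Schwartz_quadratic_bound:
  assumes "f \<in> Schwartz"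
  shows "norm ((vderiv ^^ m) f x) \<le> (Schwartz_seminorm 0 m f + Schwartz_seminorm 2 m f) / (1 + x\<^sup>2)"
proof -
  have "norm ((vderiv ^^ m) f x) * (1 + x\<^sup>2) \<le> Schwartz_seminorm 0 m f + Schwartz_seminorm 2 m f"
    using Schwartz_seminorm_upper[OF assms, of x 0 m] Schwartz_seminorm_upper[OF assms, of x 2 m]
    by (simp add: algebra_simps)
  then show ?thesis
    by (simp add: pos_le_divide_eq add_pos_nonneg)
qed

lemma Schwartz_imp_C2_quadratic_decay:
  assumes "f \<in> Schwartz"
  shows "C2_quadratic_decay ((vderiv ^^ m) f)"
  unfolding C2_quadratic_decay_def
proof (intro exI conjI allI)
  let ?b = "\<lambda>j. Schwartz_seminorm 0 j f + Schwartz_seminorm 2 j f"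
  fix t
  have le: "norm ((vderiv ^^ j) f t) \<le> (?b m + ?b (Suc m) + ?b (Suc (Suc m))) / (1 + t\<^sup>2)"
    if "?b j \<le> ?b m + ?b (Suc m) + ?b (Suc (Suc m))" for j
    using that by (intro order_trans[OF Schwartz_quadratic_bound[OF assms] divide_right_mono]) auto
  note nn = Schwartz_seminorm_nonneg[OF assms, of 0 m] Schwartz_seminorm_nonneg[OF assms, of 2 m]
    Schwartz_seminorm_nonneg[OF assms, of 0 "Suc m"] Schwartz_seminorm_nonneg[OF assms, of 2 "Suc m"]
    Schwartz_seminorm_nonneg[OF assms, of 0 "Suc (Suc m)"] Schwartz_seminorm_nonneg[OF assms, of 2 "Suc (Suc m)"]
  show "((vderiv ^^ m) f has_vector_derivative (vderiv ^^ Suc m) f t) (at t)"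
    and "((vderiv ^^ Suc m) f has_vector_derivative (vderiv ^^ Suc (Suc m)) f t) (at t)"
    by (rule Schwartz_has_derivative[OF assms])+
  show "continuous_on UNIV ((vderiv ^^ Suc (Suc m)) f)"
    by (rule Schwartz_continuous_on[OF assms])
  show "norm ((vderiv ^^ m) f t) \<le> (?b m + ?b (Suc m) + ?b (Suc (Suc m))) / (1 + t\<^sup>2)"
    and "norm ((vderiv ^^ Suc m) f t) \<le> (?b m + ?b (Suc m) + ?b (Suc (Suc m))) / (1 + t\<^sup>2)"
    and "norm ((vderiv ^^ Suc (Suc m)) f t) \<le> (?b m + ?b (Suc m) + ?b (Suc (Suc m))) / (1 + t\<^sup>2)"
    using nn by (intro le; linarith)+
qed

lemma Schwartz_integrable: "f \<in> Schwartz \<Longrightarrow> integrable lborel ((vderiv ^^ m) f)"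
  by (rule quadratic_decay_integrable(1)[OF Schwartz_continuous_on Schwartz_quadratic_bound])

section \<open>Fourier transform of Schwartz functions\<close>

lemma Fourier_cis: "Fourier f y = (\<integral>x. f x * cis (2 * pi * y * x) \<partial>lborel)"
  unfolding Fourier_def cis_conv_exp by (simp add: mult_ac)

lemma integrable_mult_cis:
  assumes "f \<in> Schwartz"
  shows "integrable lborel (\<lambda>x. (vderiv ^^ m) f x * cis (u * x))"
  by (rule quadratic_decay_integrable(1)[of _ "Schwartz_seminorm 0 m f + Schwartz_seminorm 2 m f"])
    (auto intro!: continuous_intros Schwartz_continuous_on assms Schwartz_quadratic_bound simp: norm_mult)

lemma norm_Fourier_le:
  assumes "f \<in> Schwartz"
  shows "norm (Fourier ((vderiv ^^ m) f) y) \<le> pi * (Schwartz_seminorm 0 m f + Schwartz_seminorm 2 m f)"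
  unfolding Fourier_cis
  by (rule quadratic_decay_integrable(2))
    (auto intro!: continuous_intros Schwartz_continuous_on assms Schwartz_quadratic_bound simp: norm_mult)

lemma integral_derivative_eq_0:
  fixes g g' :: "real \<Rightarrow> complex"
  assumes d: "\<And>x. (g has_vector_derivative g' x) (at x)" and i: "integrable lborel g'"
    and l: "(\<lambda>N. g (real N)) \<longlonglongrightarrow> 0" "(\<lambda>N. g (- real N)) \<longlonglongrightarrow> 0"
  shows "(\<integral>x. g' x \<partial>lborel) = 0"
proof -
  have "integral {- real N..real N} g' = g (real N) - g (- real N)" for N
    by (intro integral_unique fundamental_theorem_of_calculus has_vector_derivative_at_within[OF d]) simp
  then have lim: "(\<lambda>N. g (real N) - g (- real N)) \<longlonglongrightarrow> (\<integral>x. g' x \<partial>lborel)"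
    using integral_symmetric_interval_LIMSEQ[OF i] by simp
  show ?thesis
    using LIMSEQ_unique[OF lim tendsto_diff[OF l]] by simp
qed

lemma Schwartz_pow_LIMSEQ_0:
  assumes "f \<in> Schwartz" and "\<And>N. \<bar>c N\<bar> = real N"
  shows "(\<lambda>N. complex_of_real (c N) ^ k * f (c N)) \<longlonglongrightarrow> 0"
proof (rule Lim_null_comparison)
  show "\<forall>\<^sub>F N in sequentially. norm (complex_of_real (c N) ^ k * f (c N))
      \<le> Schwartz_seminorm (Suc k) 0 f * inverse (real N)"
    using eventually_gt_at_top[of 0]
  proof eventually_elim
    case (elim N)
    have "norm (complex_of_real (c N) ^ k * f (c N)) * real N \<le> Schwartz_seminorm (Suc k) 0 f"
      using Schwartz_seminorm_upper[OF assms(1), of "c N" "Suc k" 0] assms(2)[of N]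
      by (simp add: norm_mult norm_power mult.commute mult.left_commute)
    then show ?case
      using elim by (simp only: divide_inverse[symmetric] pos_le_divide_eq of_nat_0_less_iff)
  qed
  show "(\<lambda>N. Schwartz_seminorm (Suc k) 0 f * inverse (real N)) \<longlonglongrightarrow> 0"
    using tendsto_mult_left[OF lim_inverse_n, of "Schwartz_seminorm (Suc k) 0 f"] by simp
qed

lemma vderiv_Schwartz:
  assumes "f \<in> Schwartz"
  shows "vderiv f \<in> Schwartz"
proof -
  have e: "(vderiv ^^ m) (vderiv f) = (vderiv ^^ Suc m) f" for m
    by (simp add: funpow_swap1)
  show ?thesis
    using assms unfolding Schwartz_def smooth_on_def mem_Collect_eq e by blast
qed

text \<open>The derivative of f(x) exp(2 pi i x y) has integral 0. The minus sign reflects the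
  positive sign in the exponent of \<open>Fourier\<close>.\<close>

lemma Fourier_vderiv:
  assumes "f \<in> Schwartz"
  shows "Fourier (vderiv f) y = - (2 * of_real pi * \<i> * of_real y) * Fourier f y"
proof -
  let ?w = "2 * of_real pi * \<i> * of_real y"
  let ?g = "\<lambda>x. f x * cis (2 * pi * y * x)"
  let ?g' = "\<lambda>x. vderiv f x * cis (2 * pi * y * x) + ?w * ?g x"
  have d: "(?g has_vector_derivative ?g' x) (at x)" for x
  proof -
    have "(cis has_vector_derivative \<i> * cis (0 + 2 * pi * y * x)) (at (0 + 2 * pi * y * x))"
      unfolding cis_conv_exp
      by (rule has_vector_derivative_eq_rhs, rule field_vector_diff_chain_at[unfolded o_def])
        (auto intro!: derivative_eq_intros has_vector_derivative_of_real)
    from has_vector_derivative_affine[OF this]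
    have "((\<lambda>x. cis (2 * pi * y * x)) has_vector_derivative (2 * pi * y) *\<^sub>R (\<i> * cis (2 * pi * y * x))) (at x)"
      by simp
    from has_vector_derivative_mult[OF _ this, of f "vderiv f x"] show ?thesis
      using Schwartz_has_derivative[OF assms, of 0 x]
      by (auto simp: scaleR_conv_of_real algebra_simps)
  qed
  have i: "integrable lborel ?g" "integrable lborel (\<lambda>x. vderiv f x * cis (2 * pi * y * x))"
    using integrable_mult_cis[OF assms, of 0] integrable_mult_cis[OF assms, of 1] by auto
  have "(\<lambda>N. ?g (c N)) \<longlonglongrightarrow> 0" if "\<And>N. \<bar>c N\<bar> = real N" for c :: "nat \<Rightarrow> real"
  proof (rule Lim_null_comparison[OF always_eventually])
    show "\<forall>N. norm (?g (c N)) \<le> norm (f (c N))"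
      by (simp add: norm_mult)
    show "(\<lambda>N. norm (f (c N))) \<longlonglongrightarrow> 0"
      using tendsto_norm_zero[OF Schwartz_pow_LIMSEQ_0[OF assms that, of 0]] by simp
  qed
  from this[of real] this[of "\<lambda>N. - real N"]
  have "(\<integral>x. ?g' x \<partial>lborel) = 0"
    using i by (intro integral_derivative_eq_0[OF d]) auto
  also have "(\<integral>x. ?g' x \<partial>lborel) = Fourier (vderiv f) y + ?w * Fourier f y"
    unfolding Fourier_cis using i by (subst Bochner_Integration.integral_add) auto
  finally show ?thesis
    by (simp add: eq_neg_iff_add_eq_0)
qed

lemma norm_Fourier_vderiv_funpow:
  assumes "f \<in> Schwartz"
  shows "norm (Fourier ((vderiv ^^ m) f) y) = \<bar>2 * pi * y\<bar> ^ m * norm (Fourier f y)"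
  using assms
proof (induction m arbitrary: f)
  case (Suc m)
  have "(vderiv ^^ Suc m) f = (vderiv ^^ m) (vderiv f)"
    by (simp add: funpow_swap1)
  then show ?case
    using Suc.IH[OF vderiv_Schwartz[OF Suc.prems]] Fourier_vderiv[OF Suc.prems, of y]
    by (simp add: norm_mult abs_mult mult_ac)
qed simp

lemma Fourier_even:
  assumes "f \<in> Hplus"
  shows "Fourier f (- y) = Fourier f y"
  unfolding Fourier_cis
  by (subst lborel_integral_real_affine[of "-1" _ 0]) (simp_all add: Hplus_even[OF assms])

text \<open>The cosine is split into exponentials, so that the terms of the shifted Poisson formula,
  which pair the frequencies y and -y, become values of \<open>Fourier\<close> with phases of
  modulus 1.\<close>

lemma integral_cos_eq_Fourier:
  assumes "f \<in> Schwartz"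
  shows "(\<integral>s. cos (2 * pi * y * (s - x)) *\<^sub>R (vderiv ^^ m) f s \<partial>lborel)
    = (cis (- (2 * pi * y * x)) * Fourier ((vderiv ^^ m) f) y + cis (2 * pi * y * x) * Fourier ((vderiv ^^ m) f) (- y)) / 2"
proof -
  let ?g = "(vderiv ^^ m) f"
  have e: "cos (2 * pi * y * (s - x)) *\<^sub>R ?g s
      = (cis (- (2 * pi * y * x)) * (?g s * cis (2 * pi * y * s)) + cis (2 * pi * y * x) * (?g s * cis (2 * pi * (- y) * s))) / 2" for s
  proof -
    have "of_real (cos (a - b)) = (cis (- b) * cis a + cis b * cis (- a)) / 2" for a b
      by (simp add: complex_eq_iff cos_diff)
    from this[of "2 * pi * y * s" "2 * pi * y * x"]
    have *: "of_real (cos (2 * pi * y * (s - x)))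
        = (cis (- (2 * pi * y * x)) * cis (2 * pi * y * s) + cis (2 * pi * y * x) * cis (2 * pi * (- y) * s)) / 2"
      by (simp add: right_diff_distrib)
    show ?thesis
      unfolding scaleR_conv_of_real * by (simp add: algebra_simps)
  qed
  show ?thesis
    unfolding e Fourier_cis integral_divide_zero
    by (subst Bochner_Integration.integral_add)
      (intro integrable_mult_right integrable_mult_cis assms | simp only: integral_mult_right_zero)+
qed

section \<open>The functional equation of the Zeta operator\<close>

text \<open>The unit formula for the function \<open>\<phi> (x + L * t)\<close>. It is used at two
  extremes: centre 0 with the dilation parameter as period gives the functional equation, and L
  tending to infinity isolates the value \<open>\<phi> x\<close>.\<close>

lemma Poisson_summation_Schwartz:
  fixes f :: "real \<Rightarrow> complex" and m :: nat
  assumes f: "f \<in> Schwartz" and L: "L > 0"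
  defines "\<phi> \<equiv> (vderiv ^^ m) f"
  shows "summable (\<lambda>n. \<phi> (x + L * real (Suc n)) + \<phi> (x - L * real (Suc n)))"
    and "(\<lambda>k. 2 / L * (\<integral>s. cos (2 * pi * (real (Suc k) / L) * (s - x)) *\<^sub>R \<phi> s \<partial>lborel))
      sums (\<phi> x + (\<Sum>n. \<phi> (x + L * real (Suc n)) + \<phi> (x - L * real (Suc n))) - (\<integral>s. \<phi> s \<partial>lborel) / L)"
proof -
  have C2: "C2_quadratic_decay (\<lambda>t. \<phi> (x + L * t))"
    unfolding \<phi>_def using L by (intro C2_quadratic_decay_affine Schwartz_imp_C2_quadratic_decay f) simp
  note P = Poisson_summation_unit[OF C2, unfolded mult_minus_right add_uminus_conv_diff mult_zero_right add_0_right]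
  have aff: "(\<integral>s. g s \<partial>lborel) / L = (\<integral>t. g (x + L * t) \<partial>lborel)" for g :: "real \<Rightarrow> complex"
    using L by (subst lborel_integral_real_affine[of L g x]) (simp_all add: scaleR_conv_of_real)
  show "summable (\<lambda>n. \<phi> (x + L * real (Suc n)) + \<phi> (x - L * real (Suc n)))"
    by (rule P)
  have "2 / L * (\<integral>s. cos (2 * pi * (real (Suc k) / L) * (s - x)) *\<^sub>R \<phi> s \<partial>lborel)
      = 2 * (\<integral>t. cos (2 * pi * real (Suc k) * t) *\<^sub>R \<phi> (x + L * t) \<partial>lborel)" for k
  proof -
    have arg: "2 * pi * (real (Suc k) / L) * (x + L * t - x) = 2 * pi * real (Suc k) * t" for t
      using L by (simp del: of_nat_Suc)
    have "of_real (2 / L) * I = 2 * (I / of_real L)" for I :: complex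
      by simp
    then show ?thesis
      by (simp only: aff arg)
  qed
  then show "(\<lambda>k. 2 / L * (\<integral>s. cos (2 * pi * (real (Suc k) / L) * (s - x)) *\<^sub>R \<phi> s \<partial>lborel))
      sums (\<phi> x + (\<Sum>n. \<phi> (x + L * real (Suc n)) + \<phi> (x - L * real (Suc n))) - (\<integral>s. \<phi> s \<partial>lborel) / L)"
    using P(2) unfolding aff by simp
qed

section \<open>Domination of sums over dilates\<close>

text \<open>The term 1/4 is kept and the rest telescopes through 1/n^2 <= 1/(n-1) - 1/n, giving 1/4
  + 1/2. This number is behind the constants of the bounds for \<open>Zeta\<close>: 1 + 3/4 <= 2 and
  1/(1 - 3/4) = 4.\<close>

lemma suminf_inverse_squares_tail_le: "(\<Sum>n. 1 / (real (Suc (Suc n)))\<^sup>2) \<le> 3 / 4"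
proof (rule suminf_le_const)
  show "summable (\<lambda>n. 1 / (real (Suc (Suc n)))\<^sup>2)"
    using summable_inverse_squares_Suc by (subst summable_Suc_iff)
  have *: "(\<Sum>n<Suc m. 1 / (real (Suc (Suc n)))\<^sup>2) \<le> 3 / 4 - 1 / real (m + 2)" for m
  proof (induction m)
    case (Suc m)
    have "1 / (real (m + 3))\<^sup>2 \<le> 1 / (real (m + 2) * real (m + 3))"
      by (intro divide_left_mono) (auto simp: power2_eq_square)
    also have "\<dots> = 1 / real (m + 2) - 1 / real (m + 3)"
      by (simp add: divide_simps)
    finally have "1 / (real (Suc (Suc (Suc m))))\<^sup>2 \<le> 1 / real (m + 2) - 1 / real (Suc m + 2)"
      by (simp add: numeral_3_eq_3 numeral_2_eq_2 add_ac)
    then show ?case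
      using Suc.IH by (subst sum.lessThan_Suc) linarith
  qed simp
  show "(\<Sum>n<m. 1 / (real (Suc (Suc n)))\<^sup>2) \<le> 3 / 4" for m
  proof (cases m)
    case (Suc j)
    have "0 \<le> 1 / real (j + 2)"
      by simp
    then show ?thesis
      using *[of j] unfolding Suc by linarith
  qed simp
qed

lemma suminf_inverse_squares_le: "(\<Sum>n. 1 / (real (Suc n))\<^sup>2) \<le> 2"
  using suminf_split_head[OF summable_inverse_squares_Suc] suminf_inverse_squares_tail_le by simp

text \<open>Evaluating \<open>b\<close> at (n+1) x gains a factor (n+1)^N, which is at least
  (n+1)^2; thus one majorant serves all weights.\<close>

lemma dilation_bound:
  fixes \<phi> :: "real \<Rightarrow> complex"
  assumes b: "\<And>x. x > 0 \<Longrightarrow> x ^ N * norm (\<phi> x) \<le> A" and N: "N \<ge> 2" and x: "x > 0"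
  shows "x ^ N * norm (\<phi> (real (Suc n) * x)) \<le> A * (1 / (real (Suc n))\<^sup>2)"
proof -
  have A: "A \<ge> 0"
    using order_trans[OF _ b[of 1]] by simp
  have "(real (Suc n) * x) ^ N * norm (\<phi> (real (Suc n) * x)) \<le> A"
    using x by (intro b) simp
  then have "x ^ N * norm (\<phi> (real (Suc n) * x)) \<le> A / real (Suc n) ^ N"
    by (simp add: pos_le_divide_eq power_mult_distrib mult_ac del: of_nat_Suc)
  also have "\<dots> \<le> A / (real (Suc n))\<^sup>2"
    using A N by (intro divide_left_mono power_increasing) (auto simp del: of_nat_Suc)
  finally show ?thesis
    by simp
qed

lemma dilation_summable:
  fixes \<phi> :: "real \<Rightarrow> complex"
  assumes b: "\<And>x. x > 0 \<Longrightarrow> x ^ N * norm (\<phi> x) \<le> A" and N: "N \<ge> 2" and x: "x > 0"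
  shows "summable (\<lambda>n. norm (\<phi> (real (Suc n) * x)))"
proof -
  have "summable (\<lambda>n. x ^ N * norm (\<phi> (real (Suc n) * x)))"
    using dilation_bound[OF assms] x
    by (intro summable_comparison_test'[OF summable_mult[OF summable_inverse_squares_Suc, of A], of 0]) simp
  then show ?thesis
    using x by (simp add: summable_cmult_iff)
qed

lemma Zeta_pos: "x > 0 \<Longrightarrow> Zeta f x = (\<Sum>n. f (real (Suc n) * x))"
  by (simp add: Zeta_def ext0_def)

lemma Zeta_nonpos: "x \<le> 0 \<Longrightarrow> Zeta f x = 0"
  by (simp add: Zeta_def ext0_def)

lemma Zeta_bound:
  fixes \<phi> :: "real \<Rightarrow> complex"
  assumes b: "\<And>x. x > 0 \<Longrightarrow> x ^ N * norm (\<phi> x) \<le> A" and N: "N \<ge> 2" and x: "x > 0"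
  shows "x ^ N * norm (Zeta \<phi> x) \<le> 2 * A"
proof -
  have A: "A \<ge> 0"
    using order_trans[OF _ b[of 1]] by simp
  have sm: "summable (\<lambda>n. norm (\<phi> (real (Suc n) * x)))"
    by (rule dilation_summable[OF assms])
  have "x ^ N * norm (Zeta \<phi> x) \<le> x ^ N * (\<Sum>n. norm (\<phi> (real (Suc n) * x)))"
    unfolding Zeta_pos[OF x] using x by (intro mult_left_mono summable_norm sm) simp
  also have "\<dots> = (\<Sum>n. x ^ N * norm (\<phi> (real (Suc n) * x)))"
    by (rule suminf_mult[OF sm, symmetric])
  also have "\<dots> \<le> (\<Sum>n. A * (1 / (real (Suc n))\<^sup>2))"
    by (intro suminf_le dilation_bound[OF assms] summable_mult sm summable_inverse_squares_Suc)
  also have "\<dots> = A * (\<Sum>n. 1 / (real (Suc n))\<^sup>2)"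
    by (rule suminf_mult[OF summable_inverse_squares_Suc])
  also have "\<dots> \<le> A * 2"
    by (intro mult_left_mono suminf_inverse_squares_le A)
  finally show ?thesis
    by simp
qed

text \<open>The first term dominates the sum defining \<open>Zeta\<close>: \<open>1/2\<^sup>2 + 1/3\<^sup>2 + \<dots> \<le> 3/4 < 1\<close>.
  This replaces Moebius inversion.\<close>

lemma Zeta_inverse_bound:
  fixes \<phi> :: "real \<Rightarrow> complex"
  assumes b: "\<And>x. x > 0 \<Longrightarrow> x ^ N * norm (\<phi> x) \<le> A" and N: "N \<ge> 2"
    and Z: "\<And>x. x > 0 \<Longrightarrow> x ^ N * norm (Zeta \<phi> x) \<le> M" and x: "x > 0"
  shows "x ^ N * norm (\<phi> x) \<le> 4 * M"
proof -
  \<comment> \<open>Hypothesis \<open>b\<close> makes this supremum finite. The estimate S <= M +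
    (3/4) S can therefore be solved for \<open>S\<close>, and the answer 4 M is independent of
    \<open>A\<close>.\<close>
  define S where "S = (SUP x\<in>{0<..}. x ^ N * norm (\<phi> x))"
  have bdd: "bdd_above ((\<lambda>x. x ^ N * norm (\<phi> x)) ` {0<..})"
    by (intro bdd_aboveI2[of _ _ A]) (auto intro: b)
  have up: "x ^ N * norm (\<phi> x) \<le> S" if "x > 0" for x
    unfolding S_def using that by (intro cSUP_upper bdd) simp
  have "(SUP x\<in>{0<..}. x ^ N * norm (\<phi> x)) \<le> M + 3 / 4 * S"
  proof (rule cSUP_least)
    fix x :: real assume "x \<in> {0<..}"
    then have x: "x > 0" by simp
    have S0: "S \<ge> 0"
      using order_trans[OF _ up[OF x]] x by simp
    have sm: "summable (\<lambda>n. norm (\<phi> (real (Suc n) * x)))"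
      by (rule dilation_summable[OF b N x])
    then have sm': "summable (\<lambda>n. norm (\<phi> (real (Suc (Suc n)) * x)))"
      by (subst summable_Suc_iff[of "\<lambda>n. norm (\<phi> (real (Suc n) * x))"])
    have "Zeta \<phi> x = \<phi> x + (\<Sum>n. \<phi> (real (Suc (Suc n)) * x))"
      using suminf_split_head[OF summable_norm_cancel[OF sm]] by (simp add: Zeta_pos[OF x])
    then have "norm (\<phi> x) \<le> norm (Zeta \<phi> x) + norm (\<Sum>n. \<phi> (real (Suc (Suc n)) * x))"
      by (metis add_diff_cancel_right' norm_triangle_ineq4)
    also have "\<dots> \<le> norm (Zeta \<phi> x) + (\<Sum>n. norm (\<phi> (real (Suc (Suc n)) * x)))"
      by (intro add_left_mono summable_norm sm')
    finally have "x ^ N * norm (\<phi> x) \<le> x ^ N * norm (Zeta \<phi> x) + x ^ N * (\<Sum>n. norm (\<phi> (real (Suc (Suc n)) * x)))"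
      using x by (metis distrib_left less_imp_le mult_left_mono zero_le_power)
    also have "x ^ N * (\<Sum>n. norm (\<phi> (real (Suc (Suc n)) * x))) = (\<Sum>n. x ^ N * norm (\<phi> (real (Suc (Suc n)) * x)))"
      by (rule suminf_mult[OF sm', symmetric])
    also have "\<dots> \<le> (\<Sum>n. S * (1 / (real (Suc (Suc n)))\<^sup>2))"
      using summable_inverse_squares_Suc
      by (intro suminf_le dilation_bound[OF up N x] summable_mult sm')
        (auto simp: summable_Suc_iff[of "\<lambda>n. 1 / (real (Suc n))\<^sup>2"] simp del: of_nat_Suc)
    also have "\<dots> = S * (\<Sum>n. 1 / (real (Suc (Suc n)))\<^sup>2)"
      using summable_inverse_squares_Suc
      by (intro suminf_mult) (simp add: summable_Suc_iff[of "\<lambda>n. 1 / (real (Suc n))\<^sup>2"] del: of_nat_Suc)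
    also have "\<dots> \<le> S * (3 / 4)"
      by (intro mult_left_mono suminf_inverse_squares_tail_le S0)
    finally show "x ^ N * norm (\<phi> x) \<le> M + 3 / 4 * S"
      using Z[OF x] by simp
  qed simp
  then have "S \<le> 4 * M"
    unfolding S_def[symmetric] by simp
  then show ?thesis
    using up[OF x] by simp
qed

lemma Hplus_pow_bound:
  assumes "f \<in> Hplus" "x > 0"
  shows "x ^ N * norm (f x) \<le> Schwartz_seminorm N 0 f"
  using Schwartz_seminorm_upper[OF Hplus_imp_Schwartz[OF assms(1)], of x N 0] assms(2) by simp

lemma Hplus_summable:
  assumes "f \<in> Hplus" "x > 0"
  shows "summable (\<lambda>n. f (real (Suc n) * x))"
  by (rule summable_norm_cancel[OF dilation_summable[OF Hplus_pow_bound[OF assms(1)] order_refl assms(2)]])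

text \<open>Powers of y are traded for derivatives of \<open>f\<close>; a factor (2 pi)^m >= 1 is
  dropped. From m = 2 on this makes the series \<open>Zeta (Fourier f)\<close> converge.\<close>

lemma Fourier_pow_bound:
  assumes "f \<in> Schwartz" "y > 0"
  shows "y ^ m * norm (Fourier f y) \<le> pi * (Schwartz_seminorm 0 m f + Schwartz_seminorm 2 m f)"
proof -
  have "y \<le> 2 * pi * y"
    using assms(2) pi_gt3 by simp
  then have "y ^ m * norm (Fourier f y) \<le> \<bar>2 * pi * y\<bar> ^ m * norm (Fourier f y)"
    using assms(2) by (intro mult_right_mono power_mono) auto
  also have "\<dots> \<le> pi * (Schwartz_seminorm 0 m f + Schwartz_seminorm 2 m f)"
    using norm_Fourier_le[OF assms(1)] by (simp add: norm_Fourier_vderiv_funpow[OF assms(1)])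
  finally show ?thesis .
qed

text \<open>Poisson summation at the origin with period x. Evenness merges the values at n x and -n
  x into twice \<open>Zeta f x\<close>, and each pair of frequencies into 2/x times
  \<open>Fourier f\<close> at k/x. Forming \<open>Zeta (Fourier f)\<close> requires only the decay
  of \<open>Fourier f\<close>.\<close>

lemma Zeta_functional_equation:
  assumes f: "f \<in> Hplus" and x: "x > 0"
  shows "Zeta f x = - f 0 / 2 + Fourier f 0 / 2 * of_real (inverse x) + Zeta (Fourier f) (inverse x) * of_real (inverse x)"
proof -
  note fS = Hplus_imp_Schwartz[OF f]
  have ix: "inverse x > 0"
    using x by simp
  have e: "of_real (2 / x) * (\<integral>s. cos (2 * pi * (real (Suc k) / x) * (s - 0)) *\<^sub>R (vderiv ^^ 0) f s \<partial>lborel)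
      = 2 * of_real (inverse x) * Fourier f (real (Suc k) * inverse x)" for k
    unfolding integral_cos_eq_Fourier[OF fS] unfolding funpow_0 Fourier_even[OF f]
    by (simp add: inverse_eq_divide del: of_nat_Suc)
  have s: "(\<lambda>n. f (0 + x * real (Suc n)) + f (0 - x * real (Suc n))) = (\<lambda>n. 2 * f (real (Suc n) * x))"
    using Hplus_even[OF f] by (auto simp: mult.commute simp del: of_nat_Suc)
  have F0: "(\<integral>s. f s \<partial>lborel) = Fourier f 0"
    by (simp add: Fourier_cis)
  have "(\<lambda>k. 2 * of_real (inverse x) * Fourier f (real (Suc k) * inverse x))
      sums (f 0 + 2 * Zeta f x - Fourier f 0 / x)"
    using Poisson_summation_Schwartz(2)[OF fS x, where m=0 and x=0]
    unfolding e unfolding funpow_0 s F0 suminf_mult[OF Hplus_summable[OF f x]] Zeta_pos[OF x, of f, symmetric] .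
  moreover have sm: "summable (\<lambda>k. Fourier f (real (Suc k) * inverse x))"
    by (rule summable_norm_cancel[OF dilation_summable[of 2 "Fourier f", OF Fourier_pow_bound[OF fS] order_refl ix]])
  then have "(\<lambda>k. 2 * of_real (inverse x) * Fourier f (real (Suc k) * inverse x))
      sums (2 * of_real (inverse x) * Zeta (Fourier f) (inverse x))"
    unfolding Zeta_pos[OF ix] by (intro sums_mult summable_sums)
  ultimately have "f 0 + 2 * Zeta f x - Fourier f 0 / x = 2 * of_real (inverse x) * Zeta (Fourier f) (inverse x)"
    by (rule sums_unique2)
  then show ?thesis
    by (simp add: field_simps)
qed

text \<open>The rapid decay of \<open>Zeta (Fourier f)\<close> at infinity, read at 1/x in the
  functional equation. The extra factor 1/x uses up one power, hence the order \<open>Suc j\<close>,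
  and j >= 1 makes this order at least 2.\<close>

lemma Zeta_near_0:
  assumes f: "f \<in> Hplus" and x: "x > 0" and j: "j \<ge> 1"
  shows "norm (Zeta f x - (- f 0 / 2 + Fourier f 0 / 2 * of_real (inverse x)))
    \<le> 2 * pi * (Schwartz_seminorm 0 (Suc j) f + Schwartz_seminorm 2 (Suc j) f) * x ^ j"
proof -
  let ?C = "2 * pi * (Schwartz_seminorm 0 (Suc j) f + Schwartz_seminorm 2 (Suc j) f)"
  have ix: "inverse x > 0"
    using x by simp
  have "inverse x ^ Suc j * norm (Zeta (Fourier f) (inverse x)) \<le> ?C"
    using Zeta_bound[OF Fourier_pow_bound[OF Hplus_imp_Schwartz[OF f]] _ ix, of "Suc j"] j by simp
  then have "norm (Zeta (Fourier f) (inverse x)) * inverse x \<le> ?C * x ^ j"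
    using x by (simp add: field_simps)
  then show ?thesis
    using x by (simp add: Zeta_functional_equation[OF f x] norm_mult norm_inverse)
qed

lemma Zeta_decay:
  assumes "f \<in> Hplus" "x > 0" "N \<ge> 2"
  shows "x ^ N * norm (Zeta f x) \<le> 2 * Schwartz_seminorm N 0 f"
  by (rule Zeta_bound[OF Hplus_pow_bound]) (use assms in auto)

lemma Zeta_lincomb:
  assumes f: "f \<in> Hplus" and g: "g \<in> Hplus"
  shows "Zeta (\<lambda>x. a * f x + b * g x) = (\<lambda>x. a * Zeta f x + b * Zeta g x)"
proof
  fix x
  show "Zeta (\<lambda>x. a * f x + b * g x) x = a * Zeta f x + b * Zeta g x"
  proof (cases "x > 0")
    case True
    have "(\<lambda>n. a * f (real (Suc n) * x) + b * g (real (Suc n) * x)) sums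
        (a * (\<Sum>n. f (real (Suc n) * x)) + b * (\<Sum>n. g (real (Suc n) * x)))"
      by (intro sums_add sums_mult summable_sums Hplus_summable f g True)
    then show ?thesis
      by (simp add: Zeta_pos[OF True] sums_iff)
  qed (simp add: Zeta_nonpos)
qed

lemma Zeta_diff:
  "f \<in> Hplus \<Longrightarrow> g \<in> Hplus \<Longrightarrow> Zeta (\<lambda>x. f x - g x) = (\<lambda>x. Zeta f x - Zeta g x)"
  using Zeta_lincomb[of f g 1 "-1"] by simp

section \<open>The Euler operator x d/dx\<close>

text \<open>The invariant vector field of the multiplicative group: it commutes with dilations,
  hence with \<open>Zeta\<close>, and is d/dt for x = exp t. The value type is general because it
  acts on the complex \<open>f\<close> and on the real cutoff.\<close>

definition theta :: "(real \<Rightarrow> 'a::real_normed_vector) \<Rightarrow> real \<Rightarrow> 'a" where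
  "theta f = (\<lambda>x. x *\<^sub>R vderiv f x)"

text \<open>Leibniz: the m-th derivative of x f' is x f^(m+1) + m f^(m). The pointwise form fits
  both the whole line and the half-line on which the cutoff is smooth.\<close>

lemma theta_formula_has_derivative:
  fixes f :: "real \<Rightarrow> 'a::real_normed_vector"
  assumes "\<And>j. ((vderiv ^^ j) f has_vector_derivative (vderiv ^^ Suc j) f x) (at x)"
  shows "((\<lambda>x. x *\<^sub>R (vderiv ^^ Suc m) f x + real m *\<^sub>R (vderiv ^^ m) f x) has_vector_derivative
      x *\<^sub>R (vderiv ^^ Suc (Suc m)) f x + real (Suc m) *\<^sub>R (vderiv ^^ Suc m) f x) (at x)"
proof -
  have "((\<lambda>x. x *\<^sub>R (vderiv ^^ Suc m) f x + real m *\<^sub>R (vderiv ^^ m) f x) has_vector_derivative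
      (x *\<^sub>R (vderiv ^^ Suc (Suc m)) f x + 1 *\<^sub>R (vderiv ^^ Suc m) f x)
      + (real m *\<^sub>R (vderiv ^^ Suc m) f x + 0 *\<^sub>R (vderiv ^^ m) f x)) (at x)"
    by (intro has_vector_derivative_add has_vector_derivative_scaleR assms DERIV_ident DERIV_const)
  then show ?thesis
    by (rule has_vector_derivative_eq_rhs) (simp add: algebra_simps)
qed

lemma theta_deriv_seq:
  assumes "f \<in> Schwartz"
  shows "deriv_seq (\<lambda>m x. x *\<^sub>R (vderiv ^^ Suc m) f x + real m *\<^sub>R (vderiv ^^ m) f x)"
  unfolding deriv_seq_def by (intro allI theta_formula_has_derivative Schwartz_has_derivative assms)

lemma theta_seminorm_bound:
  assumes "f \<in> Schwartz"
  shows "\<bar>x\<bar> ^ k * norm (x *\<^sub>R (vderiv ^^ Suc m) f x + real m *\<^sub>R (vderiv ^^ m) f x)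
    \<le> Schwartz_seminorm (Suc k) (Suc m) f + real m * Schwartz_seminorm k m f"
proof -
  have "norm (x *\<^sub>R (vderiv ^^ Suc m) f x + real m *\<^sub>R (vderiv ^^ m) f x)
      \<le> \<bar>x\<bar> * norm ((vderiv ^^ Suc m) f x) + real m * norm ((vderiv ^^ m) f x)"
    using norm_triangle_ineq[of "x *\<^sub>R (vderiv ^^ Suc m) f x" "real m *\<^sub>R (vderiv ^^ m) f x"] by simp
  then have "\<bar>x\<bar> ^ k * norm (x *\<^sub>R (vderiv ^^ Suc m) f x + real m *\<^sub>R (vderiv ^^ m) f x)
      \<le> \<bar>x\<bar> ^ k * (\<bar>x\<bar> * norm ((vderiv ^^ Suc m) f x) + real m * norm ((vderiv ^^ m) f x))"
    by (intro mult_left_mono) auto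
  also have "\<dots> = \<bar>x\<bar> ^ Suc k * norm ((vderiv ^^ Suc m) f x) + real m * (\<bar>x\<bar> ^ k * norm ((vderiv ^^ m) f x))"
    by (simp add: algebra_simps)
  also have "\<dots> \<le> Schwartz_seminorm (Suc k) (Suc m) f + real m * Schwartz_seminorm k m f"
    by (intro add_mono mult_left_mono Schwartz_seminorm_upper assms) auto
  finally show ?thesis .
qed

lemma vderiv_funpow_theta:
  assumes "f \<in> Schwartz"
  shows "(vderiv ^^ m) (theta f) = (\<lambda>x. x *\<^sub>R (vderiv ^^ Suc m) f x + real m *\<^sub>R (vderiv ^^ m) f x)"
  using deriv_seq_vderiv_funpow[OF theta_deriv_seq[OF assms], of m] by (simp add: theta_def)

lemma theta_Schwartz: "f \<in> Schwartz \<Longrightarrow> theta f \<in> Schwartz"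
  using SchwartzI[OF theta_deriv_seq] theta_seminorm_bound by (fastforce simp: theta_def)

lemma theta_seminorm_le:
  assumes "f \<in> Schwartz"
  shows "Schwartz_seminorm k m (theta f) \<le> Schwartz_seminorm (Suc k) (Suc m) f + real m * Schwartz_seminorm k m f"
  using theta_seminorm_bound[OF assms]
  by (intro Schwartz_seminorm_least) (simp only: vderiv_funpow_theta[OF assms])

lemma theta_Hplus:
  assumes "f \<in> Hplus"
  shows "theta f \<in> Hplus"
proof -
  have "theta f (- x) = theta f x" for x
    using vderiv_funpow_even[OF assms, of 1 x] by (simp add: theta_def)
  then show ?thesis
    by (simp add: Hplus_def theta_Schwartz[OF Hplus_imp_Schwartz[OF assms]])
qed

lemma theta_0 [simp]: "theta f 0 = 0"
  by (simp add: theta_def)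

text \<open>The integral of (x f)' vanishes. The sign agrees with x d/dx sending 1/x to -1/x, the
  shape of the singular term that carries this coefficient.\<close>

lemma Fourier_theta_0:
  assumes f: "f \<in> Schwartz"
  shows "Fourier (theta f) 0 = - Fourier f 0"
proof -
  have d: "((\<lambda>x. x *\<^sub>R f x) has_vector_derivative theta f x + f x) (at x)" for x
    using has_vector_derivative_scaleR[OF DERIV_ident Schwartz_has_derivative[OF f, of 0 x]]
    by (simp add: theta_def)
  have i: "integrable lborel (theta f)" "integrable lborel f"
    using Schwartz_integrable[OF theta_Schwartz[OF f], of 0] Schwartz_integrable[OF f, of 0] by auto
  have "(\<lambda>N. c N *\<^sub>R f (c N)) \<longlonglongrightarrow> 0" if "\<And>N. \<bar>c N\<bar> = real N" for c :: "nat \<Rightarrow> real"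
    using Schwartz_pow_LIMSEQ_0[OF f that, of 1] by (simp add: scaleR_conv_of_real)
  from this[of real] this[of "\<lambda>N. - real N"] have "(\<integral>x. theta f x + f x \<partial>lborel) = 0"
    using i by (intro integral_derivative_eq_0[OF d]) auto
  then show ?thesis
    using i by (simp add: Fourier_cis add_eq_0_iff2)
qed

text \<open>Termwise differentiation, as each dilate satisfies d/ds f(n exp s) = (theta f)(n exp s).
  Near \<open>t\<close> the variable stays above exp(t - 1), so the derivatives have a majorant
  const/n^2.\<close>

lemma Zeta_exp_has_derivative:
  assumes f: "f \<in> Hplus"
  shows "((\<lambda>t. Zeta f (exp t)) has_vector_derivative Zeta (theta f) (exp t)) (at t)"
proof -
  define S where "S = {t - 1<..<t + 1}"
  let ?f = "\<lambda>n s. f (real (Suc n) * exp s)" and ?g = "\<lambda>n s. theta f (real (Suc n) * exp s)"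
  let ?p = "Schwartz_seminorm 2 0 (theta f)"
  have th: "theta f \<in> Hplus"
    by (rule theta_Hplus[OF f])
  have d: "(?f n has_vector_derivative ?g n s) (at s within S)" for n s
  proof -
    have "((\<lambda>s. real (Suc n) * exp s) has_vector_derivative real (Suc n) * exp s) (at s)"
      unfolding has_real_derivative_iff_has_vector_derivative[symmetric]
      by (auto intro!: derivative_eq_intros)
    from vector_diff_chain_at[OF this Schwartz_has_derivative[OF Hplus_imp_Schwartz[OF f], of 0]]
    show ?thesis
      by (simp add: o_def theta_def has_vector_derivative_at_within)
  qed
  have bound: "norm (?g n s) \<le> ?p / (exp (t - 1))\<^sup>2 * (1 / (real (Suc n))\<^sup>2)" if "s \<in> S" for n s
  proof -
    have "exp (t - 1) \<le> exp s"
      using that by (simp add: S_def)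
    then have "(exp (t - 1))\<^sup>2 * norm (?g n s) \<le> (exp s)\<^sup>2 * norm (?g n s)"
      by (intro mult_right_mono power_mono) auto
    also have "\<dots> \<le> ?p * (1 / (real (Suc n))\<^sup>2)"
      by (rule dilation_bound[OF Hplus_pow_bound[OF th]]) auto
    finally show ?thesis
      by (simp add: field_simps del: of_nat_Suc)
  qed
  have ul: "uniform_limit S (\<lambda>n s. \<Sum>i<n. ?g i s) (\<lambda>s. \<Sum>i. ?g i s) sequentially"
    by (rule Weierstrass_m_test[OF bound summable_mult[OF summable_inverse_squares_Suc]])
  have "\<exists>G. \<forall>s\<in>S. (\<lambda>n. ?f n s) sums G s \<and> (G has_derivative (\<lambda>h. h *\<^sub>R (\<Sum>i. ?g i s))) (at s within S)"
  proof (rule has_derivative_series[where f'="\<lambda>n s h. h *\<^sub>R ?g n s" and x=t])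
    show "convex S"
      by (simp add: S_def)
    show "(?f n has_derivative (\<lambda>h. h *\<^sub>R ?g n s)) (at s within S)" for n s
      using d by (simp add: has_vector_derivative_def)
    show "t \<in> S"
      by (simp add: S_def)
    show "(\<lambda>n. ?f n t) sums (\<Sum>n. ?f n t)"
      by (intro summable_sums Hplus_summable[OF f]) simp
    fix e :: real assume "e > 0"
    from uniform_limitD[OF ul this]
    show "\<forall>\<^sub>F n in sequentially. \<forall>s\<in>S. \<forall>h. norm ((\<Sum>i<n. h *\<^sub>R ?g i s) - h *\<^sub>R (\<Sum>i. ?g i s)) \<le> e * norm h"
    proof eventually_elim
      case (elim n)
      show ?case
      proof (intro ballI allI)
        fix s h assume "s \<in> S"
        then have "norm ((\<Sum>i<n. ?g i s) - (\<Sum>i. ?g i s)) \<le> e"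
          using elim by (auto simp: dist_norm intro: less_imp_le)
        then have "\<bar>h\<bar> * norm ((\<Sum>i<n. ?g i s) - (\<Sum>i. ?g i s)) \<le> \<bar>h\<bar> * e"
          by (intro mult_left_mono) auto
        then show "norm ((\<Sum>i<n. h *\<^sub>R ?g i s) - h *\<^sub>R (\<Sum>i. ?g i s)) \<le> e * norm h"
          unfolding scaleR_sum_right[symmetric] scaleR_diff_right[symmetric] norm_scaleR
          by (simp add: mult.commute)
      qed
    qed
  qed
  then obtain G where G: "\<And>s. s \<in> S \<Longrightarrow> (\<lambda>n. ?f n s) sums G s"
    "\<And>s. s \<in> S \<Longrightarrow> (G has_vector_derivative (\<Sum>i. ?g i s)) (at s within S)"
    unfolding has_vector_derivative_def by blast
  have tS: "t \<in> S" "open S"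
    by (auto simp: S_def)
  have "(G has_vector_derivative (\<Sum>i. ?g i t)) (at t)"
    using G(2)[OF tS(1)] at_within_open[OF tS] by simp
  then have "((\<lambda>t. Zeta f (exp t)) has_vector_derivative (\<Sum>i. ?g i t)) (at t)"
    by (rule has_vector_derivative_transform_within_open[OF _ tS(2,1)])
      (use G(1) in \<open>simp add: Zeta_pos sums_iff del: of_nat_Suc\<close>)
  then show ?thesis
    by (simp add: Zeta_pos del: of_nat_Suc)
qed

section \<open>The remainder of the Zeta operator\<close>

text \<open>On the sequence of derivatives of \<open>G\<close>, \<open>shift_add s\<close> is the operator \<open>d/dt + s\<close>, which is
  \<open>d/dt\<close> conjugated by multiplication with \<open>exp (s * t)\<close>.\<close>

definition shift_add :: "real \<Rightarrow> (nat \<Rightarrow> real \<Rightarrow> complex) \<Rightarrow> nat \<Rightarrow> real \<Rightarrow> complex" where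
  "shift_add s G = (\<lambda>m t. G (Suc m) t + s *\<^sub>R G m t)"

text \<open>The derivatives of exp(s t) \<open>G 0 t\<close>. If \<open>G 0 t\<close> is g (exp t),
  the bottom member is \<open>twist s g \<circ> exp\<close>, whose Schwartz seminorms define the
  topology of \<open>Hminus\<close>.\<close>

definition exp_twist_seq :: "real \<Rightarrow> (nat \<Rightarrow> real \<Rightarrow> complex) \<Rightarrow> nat \<Rightarrow> real \<Rightarrow> complex" where
  "exp_twist_seq s G = (\<lambda>m t. exp (s * t) *\<^sub>R (shift_add s ^^ m) G 0 t)"

lemma deriv_seq_shift_add: "deriv_seq G \<Longrightarrow> deriv_seq (shift_add s G)"
  unfolding deriv_seq_def shift_add_def
proof (intro allI)
  fix m x assume G: "\<forall>m x. (G m has_vector_derivative G (Suc m) x) (at x)"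
  have "((\<lambda>t. G (Suc m) t + s *\<^sub>R G m t) has_vector_derivative
      G (Suc (Suc m)) x + (s *\<^sub>R G (Suc m) x + 0 *\<^sub>R G m x)) (at x)"
    using G by (intro has_vector_derivative_add has_vector_derivative_scaleR DERIV_const) auto
  then show "((\<lambda>t. G (Suc m) t + s *\<^sub>R G m t) has_vector_derivative G (Suc (Suc m)) x + s *\<^sub>R G (Suc m) x) (at x)"
    by simp
qed

lemma deriv_seq_exp_twist:
  assumes "deriv_seq G"
  shows "deriv_seq (exp_twist_seq s G)"
  unfolding deriv_seq_def exp_twist_seq_def
proof (intro allI)
  fix m x
  have "deriv_seq ((shift_add s ^^ m) G)"
    by (induction m) (simp_all add: assms deriv_seq_shift_add)
  then have d: "((shift_add s ^^ m) G 0 has_vector_derivative (shift_add s ^^ m) G (Suc 0) x) (at x)"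
    by (rule deriv_seqD)
  have e: "((\<lambda>t. exp (s * t)) has_real_derivative exp (s * x) * s) (at x)"
    by (auto intro!: derivative_eq_intros)
  show "((\<lambda>t. exp (s * t) *\<^sub>R (shift_add s ^^ m) G 0 t) has_vector_derivative
      exp (s * x) *\<^sub>R (shift_add s ^^ Suc m) G 0 x) (at x)"
    using has_vector_derivative_scaleR[OF e d]
    by (rule has_vector_derivative_eq_rhs) (simp add: shift_add_def scaleR_add_right)
qed

lemma norm_shift_add_funpow_le:
  assumes "\<And>j. j \<le> n + m \<Longrightarrow> norm (G j t) \<le> b"
  shows "j \<le> n \<Longrightarrow> norm ((shift_add s ^^ m) G j t) \<le> (1 + \<bar>s\<bar>) ^ m * b"
  using assms
proof (induction m arbitrary: j n)
  case (Suc m)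
  have *: "norm ((shift_add s ^^ m) G i t) \<le> (1 + \<bar>s\<bar>) ^ m * b" if "i \<le> Suc n" for i
    using that Suc.prems(2) by (intro Suc.IH[of i "Suc n"]) auto
  have "norm ((shift_add s ^^ Suc m) G j t)
      \<le> norm ((shift_add s ^^ m) G (Suc j) t) + \<bar>s\<bar> * norm ((shift_add s ^^ m) G j t)"
    using norm_triangle_ineq[of "(shift_add s ^^ m) G (Suc j) t" "s *\<^sub>R (shift_add s ^^ m) G j t"]
    by (simp add: shift_add_def)
  also have "\<dots> \<le> (1 + \<bar>s\<bar>) ^ m * b + \<bar>s\<bar> * ((1 + \<bar>s\<bar>) ^ m * b)"
    using Suc.prems(1) by (intro add_mono mult_left_mono *) auto
  also have "\<dots> = (1 + \<bar>s\<bar>) ^ Suc m * b"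
    by (simp add: algebra_simps)
  finally show ?case .
qed simp

lemma power_le_fact_exp:
  fixes x :: real
  assumes "x \<ge> 0"
  shows "x ^ k \<le> fact k * exp x"
proof -
  have "(\<Sum>n\<in>{k}. x ^ n /\<^sub>R fact n) \<le> (\<Sum>n. x ^ n /\<^sub>R fact n)"
    using assms by (intro sum_le_suminf summable_exp_generic) auto
  then have "x ^ k / fact k \<le> exp x"
    by (simp add: exp_def divide_inverse mult.commute)
  then show ?thesis
    by (simp add: divide_le_eq mult.commute)
qed

text \<open>The weight |t|^k is absorbed by exp |t| <= exp t + exp(-t), at the price of the factor
  k! and of moving the rate from s to s + 1 and s - 1. Where all rates are available, polynomial
  weights are thus free.\<close>

lemma exp_twist_seq_bound:
  assumes b: "\<And>j. j \<le> m \<Longrightarrow> exp ((s + 1) * t) * norm (G j t) \<le> b"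
    "\<And>j. j \<le> m \<Longrightarrow> exp ((s - 1) * t) * norm (G j t) \<le> b"
  shows "\<bar>t\<bar> ^ k * norm (exp_twist_seq s G m t) \<le> 2 * fact k * (1 + \<bar>s\<bar>) ^ m * b"
proof -
  have eb: "exp \<bar>t\<bar> * (exp (s * t) * norm (G j t)) \<le> 2 * b" if "j \<le> m" for j
  proof -
    have "exp \<bar>t\<bar> * (exp (s * t) * norm (G j t)) \<le> (exp t + exp (- t)) * (exp (s * t) * norm (G j t))"
      by (intro mult_right_mono) (auto simp: abs_if)
    also have "\<dots> = exp ((s + 1) * t) * norm (G j t) + exp ((s - 1) * t) * norm (G j t)"
    proof -
      have "exp ((s + 1) * t) = exp t * exp (s * t)" "exp ((s - 1) * t) = exp (- t) * exp (s * t)"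
        by (simp_all add: exp_add[symmetric] algebra_simps)
      then show ?thesis
        by (simp add: algebra_simps)
    qed
    also have "\<dots> \<le> 2 * b"
      using b[OF that] by simp
    finally show ?thesis .
  qed
  define c where "c = 2 * b / (exp \<bar>t\<bar> * exp (s * t))"
  have "norm (G j t) \<le> c" if "j \<le> m" for j
    using eb[OF that] by (simp add: c_def pos_le_divide_eq mult_ac)
  then have "norm ((shift_add s ^^ m) G 0 t) \<le> (1 + \<bar>s\<bar>) ^ m * c"
    by (intro norm_shift_add_funpow_le[of 0]) auto
  then have "\<bar>t\<bar> ^ k * norm (exp_twist_seq s G m t) \<le> (fact k * exp \<bar>t\<bar>) * (exp (s * t) * ((1 + \<bar>s\<bar>) ^ m * c))"
    unfolding exp_twist_seq_def norm_scaleR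
    by (intro mult_mono power_le_fact_exp) auto
  also have "\<dots> = 2 * fact k * (1 + \<bar>s\<bar>) ^ m * b"
    by (simp add: c_def)
  finally show ?thesis .
qed

lemma twist_exp: "(twist s g \<circ> exp) = (\<lambda>t. exp (s * t) *\<^sub>R g (exp t))"
  by (auto simp: twist_def exp_powr_real scaleR_conv_of_real mult.commute)

abbreviation Hminus_seminorm :: "real \<Rightarrow> nat \<Rightarrow> nat \<Rightarrow> (real \<Rightarrow> complex) \<Rightarrow> real" where
  "Hminus_seminorm s k m g \<equiv> Schwartz_seminorm k m (twist s g \<circ> exp)"

lemma Hminus_twist_Schwartz: "g \<in> Hminus \<Longrightarrow> twist s g \<circ> exp \<in> Schwartz"
  by (auto simp: Hminus_def Schwartz_pos_s_def Schwartz_pos_def)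

lemma HminusI:
  assumes "\<And>x. x \<le> 0 \<Longrightarrow> g x = 0" "\<And>s. twist s g \<circ> exp \<in> Schwartz"
  shows "g \<in> Hminus"
  using assms by (auto simp: Hminus_def Schwartz_pos_s_def Schwartz_pos_def twist_def)

lemma Hminus_nonpos: "g \<in> Hminus \<Longrightarrow> x \<le> 0 \<Longrightarrow> g x = 0"
  by (auto simp: Hminus_def Schwartz_pos_s_def)

lemma Hminus_diff:
  assumes "g \<in> Hminus" "h \<in> Hminus"
  shows "(\<lambda>x. g x - h x) \<in> Hminus"
proof (rule HminusI)
  fix s
  have "twist s (\<lambda>x. g x - h x) \<circ> exp = (\<lambda>t. (twist s g \<circ> exp) t - (twist s h \<circ> exp) t)"
    unfolding twist_exp by (simp add: scaleR_diff_right)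
  then show "twist s (\<lambda>x. g x - h x) \<circ> exp \<in> Schwartz"
    using Schwartz_diff[OF assms[THEN Hminus_twist_Schwartz]] by simp
qed (simp add: assms Hminus_nonpos)

lemma Hminus_seminorm_triangle:
  assumes "f \<in> Hminus" "g \<in> Hminus" "h \<in> Hminus"
  shows "Hminus_seminorm s k m (\<lambda>x. f x - h x)
    \<le> Hminus_seminorm s k m (\<lambda>x. f x - g x) + Hminus_seminorm s k m (\<lambda>x. g x - h x)"
proof -
  have *: "twist s (\<lambda>x. g x - h x) \<circ> exp = (\<lambda>t. (twist s g \<circ> exp) t - (twist s h \<circ> exp) t)" for g h
    unfolding twist_exp by (simp add: scaleR_diff_right)
  show ?thesis
    unfolding * by (intro Schwartz_seminorm_triangle Hminus_twist_Schwartz assms)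
qed

lemma Hminus_pointwise_bound:
  assumes "g \<in> Hminus" "x > 0"
  shows "x powr s * norm (g x) \<le> Hminus_seminorm s 0 0 g"
  using Schwartz_seminorm_upper[OF Hminus_twist_Schwartz[OF assms(1)], of "ln x" 0 0 s] assms(2)
  by (simp add: twist_def norm_mult mult.commute)

text \<open>A criterion for \<open>Hminus\<close> by exponential bounds of every real rate for every
  t-derivative. The sum over j <= m stands in for a maximum and keeps the bound linear in the values
  of \<open>b\<close>.\<close>

lemma exp_bounded_seq_Hminus:
  assumes G: "deriv_seq G" and g: "\<And>t. G 0 t = g (exp t)" "\<And>x. x \<le> 0 \<Longrightarrow> g x = 0"
    and b: "\<And>\<sigma> j t. exp (\<sigma> * t) * norm (G j t) \<le> b \<sigma> j"
  shows "g \<in> Hminus"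
    and "Hminus_seminorm s k m g
      \<le> 2 * fact k * (1 + \<bar>s\<bar>) ^ m * (\<Sum>j\<le>m. b (s + 1) j + b (s - 1) j)"
proof -
  have b0: "0 \<le> b \<sigma> j" for \<sigma> j
    by (rule order_trans[OF _ b[of \<sigma> 0 j]]) simp
  have bs: "b (s + 1) j \<le> (\<Sum>j\<le>m. b (s + 1) j + b (s - 1) j)" "b (s - 1) j \<le> (\<Sum>j\<le>m. b (s + 1) j + b (s - 1) j)"
    if "j \<le> m" for s j m
  proof -
    have "b (s + 1) j + b (s - 1) j \<le> (\<Sum>j\<le>m. b (s + 1) j + b (s - 1) j)"
      using that b0 by (intro member_le_sum) auto
    then show "b (s + 1) j \<le> (\<Sum>j\<le>m. b (s + 1) j + b (s - 1) j)" "b (s - 1) j \<le> (\<Sum>j\<le>m. b (s + 1) j + b (s - 1) j)"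
      using b0[of "s + 1" j] b0[of "s - 1" j] by linarith+
  qed
  have bound: "\<bar>t\<bar> ^ k * norm (exp_twist_seq s G m t)
      \<le> 2 * fact k * (1 + \<bar>s\<bar>) ^ m * (\<Sum>j\<le>m. b (s + 1) j + b (s - 1) j)" for s k m t
    by (rule exp_twist_seq_bound) (blast intro: order_trans[OF b] bs)+
  have e0: "exp_twist_seq s G 0 = twist s g \<circ> exp" for s
    unfolding twist_exp exp_twist_seq_def by (simp add: g)
  show "g \<in> Hminus"
  proof (rule HminusI[OF g(2)])
    show "twist s g \<circ> exp \<in> Schwartz" for s
      unfolding e0[symmetric] using bound by (intro SchwartzI deriv_seq_exp_twist G) blast
  qed
  show "Hminus_seminorm s k m g
      \<le> 2 * fact k * (1 + \<bar>s\<bar>) ^ m * (\<Sum>j\<le>m. b (s + 1) j + b (s - 1) j)"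
    using bound unfolding e0[symmetric]
    by (intro Schwartz_seminorm_least) (simp only: deriv_seq_vderiv_funpow[OF deriv_seq_exp_twist[OF G]])
qed

text \<open>A functional \<open>q\<close> on \<open>Hplus\<close> is controlled by a family of smallness conditions that get
  stronger with the index if \<open>q\<close> is dominated by a multiple of one of them.  For a linear map this
  is continuity with respect to the topology given by the family.\<close>

definition controlled :: "(nat \<Rightarrow> real \<Rightarrow> (real \<Rightarrow> complex) \<Rightarrow> bool) \<Rightarrow> ((real \<Rightarrow> complex) \<Rightarrow> real) \<Rightarrow> bool" where
  "controlled P q \<longleftrightarrow> (\<exists>C K. \<forall>f\<in>Hplus. \<forall>\<delta>\<ge>0. P K \<delta> f \<longrightarrow> q f \<le> C * \<delta>)"

definition filtration :: "(nat \<Rightarrow> real \<Rightarrow> (real \<Rightarrow> complex) \<Rightarrow> bool) \<Rightarrow> bool" where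
  "filtration P \<longleftrightarrow> (\<forall>K L \<delta> f. K \<le> L \<longrightarrow> P L \<delta> f \<longrightarrow> P K \<delta> f)"

lemma controlledI:
  assumes "\<And>f \<delta>. f \<in> Hplus \<Longrightarrow> \<delta> \<ge> 0 \<Longrightarrow> P K \<delta> f \<Longrightarrow> q f \<le> C * \<delta>"
  shows "controlled P q"
  using assms unfolding controlled_def by blast

lemma controlledE:
  assumes "controlled P q"
  obtains C K where "\<And>f \<delta>. f \<in> Hplus \<Longrightarrow> \<delta> \<ge> 0 \<Longrightarrow> P K \<delta> f \<Longrightarrow> q f \<le> C * \<delta>"
  using assms unfolding controlled_def by blast

lemma controlled_mono:
  assumes "controlled P q" "\<And>f. f \<in> Hplus \<Longrightarrow> r f \<le> q f"
  shows "controlled P r"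
  using assms unfolding controlled_def by (meson order_trans)

lemma controlled_add:
  assumes P: "filtration P" and "controlled P q" "controlled P r"
  shows "controlled P (\<lambda>f. q f + r f)"
proof -
  obtain C K where 1: "\<And>f \<delta>. f \<in> Hplus \<Longrightarrow> \<delta> \<ge> 0 \<Longrightarrow> P K \<delta> f \<Longrightarrow> q f \<le> C * \<delta>"
    using assms(2) unfolding controlled_def by blast
  obtain D L where 2: "\<And>f \<delta>. f \<in> Hplus \<Longrightarrow> \<delta> \<ge> 0 \<Longrightarrow> P L \<delta> f \<Longrightarrow> r f \<le> D * \<delta>"
    using assms(3) unfolding controlled_def by blast
  show ?thesis
  proof (rule controlledI)
    fix f \<delta> assume *: "f \<in> Hplus" "0 \<le> \<delta>" "P (max K L) \<delta> f"
    then have "P K \<delta> f" "P L \<delta> f"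
      using P unfolding filtration_def by (meson max.cobounded1 max.cobounded2)+
    then show "q f + r f \<le> (C + D) * \<delta>"
      using 1[OF *(1,2)] 2[OF *(1,2)] by (simp add: distrib_right add_mono)
  qed
qed

lemma controlled_cmult:
  assumes "controlled P q" "c \<ge> 0"
  shows "controlled P (\<lambda>f. c * q f)"
proof -
  obtain C K where 1: "\<And>f \<delta>. f \<in> Hplus \<Longrightarrow> \<delta> \<ge> 0 \<Longrightarrow> P K \<delta> f \<Longrightarrow> q f \<le> C * \<delta>"
    using assms(1) unfolding controlled_def by blast
  show ?thesis
    using assms(2) 1 by (intro controlledI[of P K _ "c * C"]) (simp add: mult.assoc mult_left_mono)
qed

lemma controlled_sum:
  assumes P: "filtration P" and "\<And>i. i \<in> A \<Longrightarrow> controlled P (q i)" "finite A"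
  shows "controlled P (\<lambda>f. \<Sum>i\<in>A. q i f)"
  using assms(3,2)
proof (induction A rule: finite_induct)
  case empty
  show ?case
    by (rule controlledI[where C=0]) simp
next
  case (insert a A)
  then have "controlled P (\<lambda>f. q a f + (\<Sum>i\<in>A. q i f))"
    by (intro controlled_add P) auto
  then show ?case
    using insert.hyps by simp
qed

definition Schwartz_small :: "nat \<Rightarrow> real \<Rightarrow> (real \<Rightarrow> complex) \<Rightarrow> bool" where
  "Schwartz_small K \<delta> f \<longleftrightarrow> (\<forall>i\<le>K. \<forall>j\<le>K. Schwartz_seminorm i j f \<le> \<delta>)"

abbreviation Hplus_controlled :: "((real \<Rightarrow> complex) \<Rightarrow> real) \<Rightarrow> bool" where
  "Hplus_controlled \<equiv> controlled Schwartz_small"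

lemma filtration_Schwartz_small: "filtration Schwartz_small"
  by (auto simp: filtration_def Schwartz_small_def)

lemmas Hplus_controlled_add = controlled_add[OF filtration_Schwartz_small]
lemmas Hplus_controlled_sum = controlled_sum[OF filtration_Schwartz_small]

lemma Hplus_controlled_seminorm: "Hplus_controlled (Schwartz_seminorm k m)"
  by (rule controlledI[of _ "max k m" _ 1]) (simp add: Schwartz_small_def)

lemma theta_funpow_Hplus: "f \<in> Hplus \<Longrightarrow> (theta ^^ n) f \<in> Hplus"
  by (induction n) (simp_all add: theta_Hplus)

text \<open>One application of \<open>theta\<close> raises each index of a seminorm by at most one,
  so finitely many seminorms of \<open>f\<close> suffice.\<close>

lemma Hplus_controlled_theta_funpow: "Hplus_controlled (\<lambda>f. Schwartz_seminorm k m ((theta ^^ n) f))"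
proof (induction n arbitrary: k m)
  case 0
  show ?case
    by (simp add: Hplus_controlled_seminorm)
next
  case (Suc n)
  have "Hplus_controlled (\<lambda>f. Schwartz_seminorm (Suc k) (Suc m) ((theta ^^ n) f) + real m * Schwartz_seminorm k m ((theta ^^ n) f))"
    by (intro Hplus_controlled_add controlled_cmult Suc.IH) simp
  then show ?case
    by (rule controlled_mono)
      (simp add: theta_seminorm_le[OF Hplus_imp_Schwartz[OF theta_funpow_Hplus]])
qed

section \<open>Cutoff functions in the logarithmic coordinate\<close>

text \<open>Differentiability is known only on \<open>S\<close>, so the Leibniz formula for the
  iterated derivatives is an equality on \<open>S\<close>; openness allows it to be differentiated
  again.\<close>

lemma theta_smooth_on:
  fixes u :: "real \<Rightarrow> 'a::real_normed_vector"
  assumes u: "smooth_on S u" and S: "open S"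
  shows "smooth_on S (theta u)"
proof -
  have d: "((vderiv ^^ m) u has_vector_derivative (vderiv ^^ Suc m) u x) (at x)" if "x \<in> S" for m x
    using u that by (simp add: smooth_on_def vderiv_def vector_derivative_works[symmetric])
  let ?F = "\<lambda>m x. x *\<^sub>R (vderiv ^^ Suc m) u x + real m *\<^sub>R (vderiv ^^ m) u x"
  have F: "(?F m has_vector_derivative ?F (Suc m) x) (at x)" if "x \<in> S" for m x
    by (intro theta_formula_has_derivative d that)
  have "\<forall>x\<in>S. (vderiv ^^ m) (theta u) x = ?F m x" for m
  proof (induction m)
    case (Suc m)
    show ?case
    proof
      fix x assume x: "x \<in> S"
      have "((vderiv ^^ m) (theta u) has_vector_derivative ?F (Suc m) x) (at x)"
        by (rule has_vector_derivative_transform_within_open[OF F[OF x] S x]) (use Suc.IH in simp)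
      then show "(vderiv ^^ Suc m) (theta u) x = ?F (Suc m) x"
        using vector_derivative_at by (auto simp: vderiv_def)
    qed
  qed (simp add: theta_def)
  then have "((vderiv ^^ m) (theta u) has_vector_derivative ?F (Suc m) x) (at x)" if "x \<in> S" for m x
    by (intro has_vector_derivative_transform_within_open[OF F[OF that] S that]) simp
  then show ?thesis
    unfolding smooth_on_def using differentiableI_vector by blast
qed

lemma theta_funpow_exp_deriv_seq:
  fixes u :: "real \<Rightarrow> real"
  assumes "smooth_on {0<..} u"
  shows "deriv_seq (\<lambda>m t. complex_of_real ((theta ^^ m) u (exp t)))"
  unfolding deriv_seq_def
proof (intro allI)
  fix m t
  have "smooth_on {0<..} ((theta ^^ m) u)"
    by (induction m) (simp_all add: assms theta_smooth_on)
  then have "(theta ^^ m) u differentiable (at (exp t))"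
    unfolding smooth_on_def by (metis exp_gt_zero funpow_0 greaterThan_iff)
  then have "((theta ^^ m) u has_vector_derivative vderiv ((theta ^^ m) u) (exp t)) (at (exp t))"
    by (simp add: vderiv_def vector_derivative_works)
  moreover have "(exp has_vector_derivative exp t) (at t)"
    unfolding has_real_derivative_iff_has_vector_derivative[symmetric] by (rule DERIV_exp)
  ultimately have "((\<lambda>t. (theta ^^ m) u (exp t)) has_vector_derivative (theta ^^ Suc m) u (exp t)) (at t)"
    using vector_diff_chain_at[of exp "exp t" t "(theta ^^ m) u"] by (simp add: o_def theta_def)
  then show "((\<lambda>t. complex_of_real ((theta ^^ m) u (exp t))) has_vector_derivative complex_of_real ((theta ^^ Suc m) u (exp t))) (at t)"
    by (rule bounded_linear.has_vector_derivative[OF bounded_linear_of_real])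
qed

lemma deriv_seq_const_open:
  assumes A: "deriv_seq A" and U: "open U" and c: "\<And>t. t \<in> U \<Longrightarrow> A 0 t = c" and t: "t \<in> U"
  shows "A (Suc m) t = 0"
  using t
proof (induction m arbitrary: t)
  case 0
  have "((\<lambda>_. c) has_vector_derivative A (Suc 0) t) (at t)"
    by (rule has_vector_derivative_transform_within_open[OF deriv_seqD[OF A] U 0]) (simp add: c)
  then show ?case
    using vector_derivative_at vector_derivative_const_at by metis
next
  case (Suc m)
  have "((\<lambda>_. 0) has_vector_derivative A (Suc (Suc m)) t) (at t)"
    by (rule has_vector_derivative_transform_within_open[OF deriv_seqD[OF A] U Suc.prems]) (simp add: Suc.IH)
  then show ?case
    using vector_derivative_at vector_derivative_const_at by metis
qed

definition cutoff_seq :: "(real \<Rightarrow> real) \<Rightarrow> nat \<Rightarrow> real \<Rightarrow> complex" where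
  "cutoff_seq h0 = (\<lambda>m t. complex_of_real ((theta ^^ m) h0 (exp t)))"

text \<open>The t-derivatives of exp(-t) h0 (exp t), that is of \<open>inverse x * h0 x\<close> at x
  = exp t.\<close>

definition cutoff_div_seq :: "(real \<Rightarrow> real) \<Rightarrow> nat \<Rightarrow> real \<Rightarrow> complex" where
  "cutoff_div_seq h0 = exp_twist_seq (-1) (cutoff_seq h0)"

lemma cutoff_thresholds:
  assumes "cutoff h0"
  obtains T where "T \<ge> 0" "\<And>t. t < - T \<Longrightarrow> h0 (exp t) = 1" "\<And>t. t > T \<Longrightarrow> h0 (exp t) = 0"
proof -
  obtain e where e: "e > 0" "\<And>x. 0 < x \<Longrightarrow> x < e \<Longrightarrow> h0 x = 1"
    using assms unfolding cutoff_def eventually_at_right_field by (metis field_lbound_gt_zero)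
  obtain R where R: "\<And>x. x \<ge> R \<Longrightarrow> h0 x = 0"
    using assms unfolding cutoff_def eventually_at_top_linorder by blast
  \<comment> \<open>\<open>max R 1\<close> keeps the argument of \<open>ln\<close> positive, and the
    outer maximum lets one nonnegative \<open>T\<close> serve both ends.\<close>
  define T where "T = max 0 (max (- ln e) (ln (max R 1)))"
  show ?thesis
  proof
    show "T \<ge> 0"
      by (simp add: T_def)
    show "h0 (exp t) = 1" if "t < - T" for t
    proof (rule e(2))
      have "t < ln e"
        using that unfolding T_def by linarith
      then show "exp t < e"
        using e(1) by (metis exp_less_mono exp_ln)
    qed simp
    show "h0 (exp t) = 0" if "t > T" for t
    proof (rule R)
      have "ln (max R 1) < t"
        using that unfolding T_def by linarith
      then have "exp (ln (max R 1)) < exp t"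
        by (rule exp_less_mono)
      moreover have "exp (ln (max R 1)) = max R 1"
        by (rule exp_ln) simp
      ultimately show "exp t \<ge> R"
        by linarith
    qed
  qed
qed

lemma cutoff_deriv_seq:
  assumes "cutoff h0"
  shows "deriv_seq (cutoff_seq h0)" "deriv_seq (cutoff_div_seq h0)"
proof -
  show *: "deriv_seq (cutoff_seq h0)"
    unfolding cutoff_seq_def using assms by (intro theta_funpow_exp_deriv_seq) (simp add: cutoff_def)
  show "deriv_seq (cutoff_div_seq h0)"
    unfolding cutoff_div_seq_def by (rule deriv_seq_exp_twist[OF *])
qed

text \<open>On this half-line the two cutoff functions coincide with 1 and exp(-t), the singular
  terms of the functional equation, so that these can be cancelled exactly at every order.\<close>

lemma cutoff_seq_left:
  assumes "cutoff h0" "\<And>t. t < - T \<Longrightarrow> h0 (exp t) = 1" "t < - T"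
  shows "cutoff_seq h0 m t = (if m = 0 then 1 else 0)"
    and "cutoff_div_seq h0 m t = exp (- t) *\<^sub>R (-1) ^ m"
proof -
  have A: "cutoff_seq h0 m t = (if m = 0 then 1 else 0)" for m
  proof (cases m)
    case (Suc n)
    then show ?thesis
      using deriv_seq_const_open[OF cutoff_deriv_seq(1)[OF assms(1)], of "{..<- T}" 1 t n] assms(2,3)
      by (simp add: cutoff_seq_def)
  qed (use assms(2,3) in \<open>simp add: cutoff_seq_def\<close>)
  have "(shift_add (-1) ^^ n) (cutoff_seq h0) j t = (if j = 0 then (-1) ^ n else 0)" for n j
    by (induction n arbitrary: j) (simp_all add: A shift_add_def)
  then show "cutoff_div_seq h0 m t = exp (- t) *\<^sub>R (-1) ^ m"
    by (simp add: cutoff_div_seq_def exp_twist_seq_def)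
  show "cutoff_seq h0 m t = (if m = 0 then 1 else 0)"
    by (rule A)
qed

lemma cutoff_seq_right:
  assumes "cutoff h0" "\<And>t. t > T \<Longrightarrow> h0 (exp t) = 0" "t > T"
  shows "cutoff_seq h0 m t = 0" and "cutoff_div_seq h0 m t = 0"
proof -
  have A: "cutoff_seq h0 m t = 0" for m
  proof (cases m)
    case (Suc n)
    then show ?thesis
      using deriv_seq_const_open[OF cutoff_deriv_seq(1)[OF assms(1)], of "{T<..}" 0 t n] assms(2,3)
      by (simp add: cutoff_seq_def)
  qed (use assms(2,3) in \<open>simp add: cutoff_seq_def\<close>)
  have "(shift_add (-1) ^^ n) (cutoff_seq h0) j t = 0" for n j
    by (induction n arbitrary: j) (simp_all add: A shift_add_def)
  then show "cutoff_div_seq h0 m t = 0"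
    by (simp add: cutoff_div_seq_def exp_twist_seq_def)
  show "cutoff_seq h0 m t = 0"
    by (rule A)
qed

lemma eventually_zero_exp_bound:
  fixes A :: "nat \<Rightarrow> real \<Rightarrow> complex"
  assumes A: "deriv_seq A" and z: "\<And>t. t > T \<Longrightarrow> A m t = 0"
  obtains M where "M \<ge> 0" "\<And>t. t \<ge> - T \<Longrightarrow> exp (\<sigma> * t) * norm (A m t) \<le> M"
proof -
  have "continuous_on {- T..T} (\<lambda>t. exp (\<sigma> * t) * norm (A m t))"
    using has_vector_derivative_continuous[OF deriv_seqD[OF A]]
    by (intro continuous_intros continuous_at_imp_continuous_on) auto
  then have "bounded ((\<lambda>t. exp (\<sigma> * t) * norm (A m t)) ` {- T..T})"
    by (intro compact_imp_bounded compact_continuous_image) auto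
  then obtain M where M: "M > 0" "\<And>t. t \<in> {- T..T} \<Longrightarrow> norm (exp (\<sigma> * t) * norm (A m t)) \<le> M"
    unfolding bounded_pos by blast
  show ?thesis
  proof (rule that[of M])
    show "exp (\<sigma> * t) * norm (A m t) \<le> M" if "t \<ge> - T" for t
    proof (cases "t \<le> T")
      case True
      then show ?thesis
        using M(2)[of t] that by simp
    qed (use z M(1) in simp)
  qed (use M(1) in simp)
qed

section \<open>Rapid decay of the remainder at both ends\<close>

text \<open>The t-derivatives of \<open>Zeta_rem\<close> at x = exp t: the coefficients remain those
  of \<open>f\<close>, while differentiation acts inside \<open>Zeta\<close> as \<open>theta\<close>
  and on the cutoffs.\<close>

definition Zeta_rem_seq :: "(real \<Rightarrow> real) \<Rightarrow> (real \<Rightarrow> complex) \<Rightarrow> nat \<Rightarrow> real \<Rightarrow> complex" where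
  "Zeta_rem_seq h0 f = (\<lambda>m t. Zeta ((theta ^^ m) f) (exp t)
     - (- f 0 / 2) * cutoff_seq h0 m t - (Fourier f 0 / 2) * cutoff_div_seq h0 m t)"

definition Zeta_rem :: "(real \<Rightarrow> real) \<Rightarrow> (real \<Rightarrow> complex) \<Rightarrow> real \<Rightarrow> complex" where
  "Zeta_rem h0 f = (\<lambda>x. Zeta f x - (- f 0 / 2) * ext0 (\<lambda>x. of_real (h0 x)) x
     - (Fourier f 0 / 2) * ext0 (\<lambda>x. of_real (inverse x * h0 x)) x)"

lemma Zeta_rem_deriv_seq:
  assumes "cutoff h0" "f \<in> Hplus"
  shows "deriv_seq (Zeta_rem_seq h0 f)"
  unfolding deriv_seq_def Zeta_rem_seq_def
proof (intro allI)
  fix m x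
  have Z: "((\<lambda>t. Zeta ((theta ^^ m) f) (exp t)) has_vector_derivative Zeta ((theta ^^ Suc m) f) (exp x)) (at x)"
    using Zeta_exp_has_derivative[OF theta_funpow_Hplus[OF assms(2)]] by simp
  show "((\<lambda>t. Zeta ((theta ^^ m) f) (exp t) - (- f 0 / 2) * cutoff_seq h0 m t - (Fourier f 0 / 2) * cutoff_div_seq h0 m t)
      has_vector_derivative Zeta ((theta ^^ Suc m) f) (exp x) - (- f 0 / 2) * cutoff_seq h0 (Suc m) x
        - (Fourier f 0 / 2) * cutoff_div_seq h0 (Suc m) x) (at x)"
    by (intro has_vector_derivative_diff has_vector_derivative_mult_right Z
        cutoff_deriv_seq[OF assms(1), THEN deriv_seqD])
qed

lemma Zeta_rem_exp: "Zeta_rem h0 f (exp t) = Zeta_rem_seq h0 f 0 t"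
  by (simp add: Zeta_rem_def Zeta_rem_seq_def ext0_def cutoff_seq_def cutoff_div_seq_def exp_twist_seq_def
      scaleR_conv_of_real exp_minus)

lemma theta_funpow_0: "(theta ^^ m) f 0 = (if m = 0 then f 0 else 0)"
  by (cases m) simp_all

lemma Fourier_theta_funpow_0:
  assumes "f \<in> Hplus"
  shows "Fourier ((theta ^^ m) f) 0 = (-1) ^ m * Fourier f 0"
  by (induction m) (simp_all add: Fourier_theta_0[OF Hplus_imp_Schwartz[OF theta_funpow_Hplus[OF assms]]])

lemma norm_Fourier_0_le:
  "f \<in> Hplus \<Longrightarrow> norm (Fourier f 0) \<le> pi * (Schwartz_seminorm 0 0 f + Schwartz_seminorm 2 0 f)"
  using norm_Fourier_le[OF Hplus_imp_Schwartz, of f 0 0] by simp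

text \<open>Two regimes. Left of -T the singular terms cancel and \<open>Zeta_near_0\<close>
  provides any power of x; right of -T the decay of \<open>Zeta\<close> beats
  exp(\<open>\<sigma>\<close> t), and the cutoff terms are bounded because they vanish beyond
  T.\<close>

lemma Zeta_rem_seq_bound:
  assumes cut: "cutoff h0"
  shows "\<exists>Q. Hplus_controlled Q \<and> (\<forall>f\<in>Hplus. \<forall>t. exp (\<sigma> * t) * norm (Zeta_rem_seq h0 f m t) \<le> Q f)"
proof -
  obtain T where T: "T \<ge> 0" "\<And>t. t < - T \<Longrightarrow> h0 (exp t) = 1" "\<And>t. t > T \<Longrightarrow> h0 (exp t) = 0"
    by (rule cutoff_thresholds[OF cut], rule that)
  obtain M1 where M1: "M1 \<ge> 0" "\<And>t. t \<ge> - T \<Longrightarrow> exp (\<sigma> * t) * norm (cutoff_seq h0 m t) \<le> M1"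
    using eventually_zero_exp_bound[where T=T, OF cutoff_deriv_seq(1)[OF cut] cutoff_seq_right(1)[where T=T, OF cut T(3)]] by blast
  obtain M2 where M2: "M2 \<ge> 0" "\<And>t. t \<ge> - T \<Longrightarrow> exp (\<sigma> * t) * norm (cutoff_div_seq h0 m t) \<le> M2"
    using eventually_zero_exp_bound[where T=T, OF cutoff_deriv_seq(2)[OF cut] cutoff_seq_right(2)[where T=T, OF cut T(3)]] by blast
  \<comment> \<open>One exponent for both regimes: \<open>\<sigma>\<close> + N >= 0 makes
    exp((\<open>\<sigma>\<close> + N) t) at most 1 for t < 0, and N - \<open>\<sigma>\<close> >= 0
    bounds exp((\<open>\<sigma>\<close> - N) t) for t >= -T. The added 2 meets the requirement of
    \<open>Zeta_decay\<close>.\<close>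
  define N where "N = nat \<lceil>\<bar>\<sigma>\<bar>\<rceil> + 2"
  have N: "N \<ge> 2" "real N \<ge> \<bar>\<sigma>\<bar>"
    unfolding N_def by linarith+
  let ?p = "\<lambda>i j f. Schwartz_seminorm i j ((theta ^^ m) f)"
  define Q1 where "Q1 f = 2 * pi * (?p 0 (Suc N) f + ?p 2 (Suc N) f)" for f
  define Q2 where "Q2 f = exp ((real N - \<sigma>) * T) * (2 * ?p N 0 f) + (M1 / 2 * Schwartz_seminorm 0 0 f
    + M2 / 2 * (pi * (Schwartz_seminorm 0 0 f + Schwartz_seminorm 2 0 f)))" for f
  have p0: "?p i j f \<ge> 0" if "f \<in> Hplus" for i j f
    by (rule Schwartz_seminorm_nonneg[OF Hplus_imp_Schwartz[OF theta_funpow_Hplus[OF that]]])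
  have s0: "Schwartz_seminorm i j f \<ge> 0" if "f \<in> Hplus" for i j f
    by (rule Schwartz_seminorm_nonneg[OF Hplus_imp_Schwartz[OF that]])
  have Q0: "Q1 f \<ge> 0" "Q2 f \<ge> 0" if "f \<in> Hplus" for f
    using p0[OF that] s0[OF that] M1 M2 by (simp_all add: Q1_def Q2_def)
  have "Hplus_controlled (\<lambda>f. Q1 f + Q2 f)"
    unfolding Q1_def Q2_def using M1 M2
    by (intro Hplus_controlled_add controlled_cmult Hplus_controlled_theta_funpow Hplus_controlled_seminorm) auto
  moreover have "exp (\<sigma> * t) * norm (Zeta_rem_seq h0 f m t) \<le> Q1 f + Q2 f" if f: "f \<in> Hplus" for f t
  proof (cases "t < - T")
    case True
    note th = theta_funpow_Hplus[OF f, of m]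
    have L: "cutoff_seq h0 m t = (if m = 0 then 1 else 0)" "cutoff_div_seq h0 m t = exp (- t) *\<^sub>R (-1) ^ m"
      by (rule cutoff_seq_left[where T=T, OF cut _ True], erule T(2))+
    \<comment> \<open>The coefficients match: for m > 0 both the value of theta^m f at 0 and the
      m-th derivative of 1 vanish, and both the integral of theta^m f and the m-th derivative of
      exp(-t) acquire the factor (-1)^m.\<close>
    have eq: "Zeta_rem_seq h0 f m t = Zeta ((theta ^^ m) f) (exp t)
        - (- (theta ^^ m) f 0 / 2 + Fourier ((theta ^^ m) f) 0 / 2 * of_real (inverse (exp t)))"
      unfolding Zeta_rem_seq_def L theta_funpow_0 Fourier_theta_funpow_0[OF f]
      by (simp add: scaleR_conv_of_real exp_minus)
    have "norm (Zeta_rem_seq h0 f m t) \<le> Q1 f * exp t ^ N"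
      unfolding eq Q1_def using N(1) by (intro Zeta_near_0[OF th]) auto
    then have "exp (\<sigma> * t) * norm (Zeta_rem_seq h0 f m t) \<le> exp (\<sigma> * t) * (Q1 f * exp t ^ N)"
      by (intro mult_left_mono) auto
    also have "\<dots> = Q1 f * exp ((\<sigma> + real N) * t)"
      by (simp add: exp_of_nat_mult[symmetric] exp_add distrib_right)
    also have "\<dots> \<le> Q1 f * 1"
      using True T(1) N(2) Q0[OF f] by (intro mult_left_mono) (auto simp: mult_le_0_iff)
    finally show ?thesis
      using Q0[OF f] by simp
  next
    case False
    then have t: "t \<ge> - T"
      by simp
    let ?Z = "Zeta ((theta ^^ m) f) (exp t)"
    have Zd: "exp t ^ N * norm ?Z \<le> 2 * ?p N 0 f"
      using N(1) by (intro Zeta_decay theta_funpow_Hplus f) auto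
    have "exp ((\<sigma> - real N) * t) * (exp t ^ N * norm ?Z) \<le> exp ((real N - \<sigma>) * T) * (2 * ?p N 0 f)"
    proof (rule mult_mono[OF _ Zd])
      have "(real N - \<sigma>) * (- t) \<le> (real N - \<sigma>) * T"
        using t N(2) by (intro mult_left_mono) auto
      then show "exp ((\<sigma> - real N) * t) \<le> exp ((real N - \<sigma>) * T)"
        by (simp add: algebra_simps)
    qed auto
    moreover have "exp ((\<sigma> - real N) * t) * exp t ^ N = exp (\<sigma> * t)"
      by (simp add: exp_of_nat_mult[symmetric] exp_add[symmetric] algebra_simps)
    ultimately have 1: "exp (\<sigma> * t) * norm ?Z \<le> exp ((real N - \<sigma>) * T) * (2 * ?p N 0 f)"
      by (simp add: mult.assoc[symmetric])
    have "norm (f 0) * (exp (\<sigma> * t) * norm (cutoff_seq h0 m t)) \<le> Schwartz_seminorm 0 0 f * M1"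
      using Schwartz_seminorm_upper[OF Hplus_imp_Schwartz[OF f], of 0 0 0] s0[OF f] M1(2)[OF t]
      by (intro mult_mono) auto
    then have 2: "exp (\<sigma> * t) * norm ((- f 0 / 2) * cutoff_seq h0 m t) \<le> M1 / 2 * Schwartz_seminorm 0 0 f"
      by (simp add: norm_mult norm_divide mult_ac)
    have "norm (Fourier f 0) * (exp (\<sigma> * t) * norm (cutoff_div_seq h0 m t))
        \<le> (pi * (Schwartz_seminorm 0 0 f + Schwartz_seminorm 2 0 f)) * M2"
      using norm_Fourier_0_le[OF f] s0[OF f] M2(2)[OF t] by (intro mult_mono) auto
    then have 3: "exp (\<sigma> * t) * norm ((Fourier f 0 / 2) * cutoff_div_seq h0 m t)
        \<le> M2 / 2 * (pi * (Schwartz_seminorm 0 0 f + Schwartz_seminorm 2 0 f))"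
      by (simp add: norm_mult norm_divide mult_ac)
    have "norm (Zeta_rem_seq h0 f m t)
        \<le> norm ?Z + norm ((- f 0 / 2) * cutoff_seq h0 m t) + norm ((Fourier f 0 / 2) * cutoff_div_seq h0 m t)"
      unfolding Zeta_rem_seq_def by (intro order_trans[OF norm_triangle_ineq4] add_right_mono norm_triangle_ineq4)
    then have "exp (\<sigma> * t) * norm (Zeta_rem_seq h0 f m t)
        \<le> exp (\<sigma> * t) * (norm ?Z + norm ((- f 0 / 2) * cutoff_seq h0 m t) + norm ((Fourier f 0 / 2) * cutoff_div_seq h0 m t))"
      by (intro mult_left_mono) auto
    also have "\<dots> \<le> Q2 f"
      unfolding Q2_def distrib_left[of "exp (\<sigma> * t)"] add.assoc by (intro add_mono 1 2 3)
    finally show ?thesis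
      using Q0[OF f] by simp
  qed
  ultimately show ?thesis
    by blast
qed

lemma Zeta_rem_Hminus:
  assumes cut: "cutoff h0"
  shows "f \<in> Hplus \<Longrightarrow> Zeta_rem h0 f \<in> Hminus"
    and "Hplus_controlled (\<lambda>f. Hminus_seminorm s k m (Zeta_rem h0 f))"
proof -
  obtain Q where Q: "\<And>\<sigma> m. Hplus_controlled (Q \<sigma> m)"
    "\<And>\<sigma> m f t. f \<in> Hplus \<Longrightarrow> exp (\<sigma> * t) * norm (Zeta_rem_seq h0 f m t) \<le> Q \<sigma> m f"
    using Zeta_rem_seq_bound[OF cut] by metis
  have z: "Zeta_rem h0 f x = 0" if "x \<le> 0" for f x
    using that by (simp add: Zeta_rem_def ext0_def Zeta_nonpos)
  note * = exp_bounded_seq_Hminus[OF Zeta_rem_deriv_seq[OF cut] Zeta_rem_exp[symmetric] z, where b="\<lambda>\<sigma> j. Q \<sigma> j f" for f]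
  show "Zeta_rem h0 f \<in> Hminus" if "f \<in> Hplus"
    by (rule *(1)[OF that _ Q(2)[OF that]])
  have "Hplus_controlled (\<lambda>f. 2 * fact k * (1 + \<bar>s\<bar>) ^ m * (\<Sum>j\<le>m. Q (s + 1) j f + Q (s - 1) j f))"
    by (intro controlled_cmult Hplus_controlled_sum Hplus_controlled_add Q(1)) auto
  then show "Hplus_controlled (\<lambda>f. Hminus_seminorm s k m (Zeta_rem h0 f))"
    by (rule controlled_mono) (rule *(2)[OF _ _ Q(2)])
qed

lemma Zeta_eq_Hcup_sum: "Zeta f = Hcup_sum h0 (Zeta_rem h0 f, - f 0 / 2, Fourier f 0 / 2)"
  by (simp add: Hcup_sum_def Zeta_rem_def)

section \<open>Recovering a function from its image\<close>

lemma vector_derivative_norm_diff_le: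
  fixes u u' :: "real \<Rightarrow> complex"
  assumes d: "\<And>t. (u has_vector_derivative u' t) (at t)" and M: "\<And>t. a \<le> t \<Longrightarrow> t \<le> b \<Longrightarrow> norm (u' t) \<le> M"
    and ab: "a \<le> b"
  shows "norm (u b - u a) \<le> M * (b - a)"
proof (cases "a = b")
  case False
  then have "a < b"
    using ab by simp
  moreover have "continuous_on {a..b} u"
    using has_vector_derivative_continuous[OF d] by (auto intro: continuous_at_imp_continuous_on)
  ultimately obtain t where t: "t \<in> {a<..<b}" "norm (u b - u a) \<le> norm ((b - a) *\<^sub>R u' t)"
    using mvt_general[of a b u "\<lambda>t h. h *\<^sub>R u' t"] d unfolding has_vector_derivative_def by blast
  have "norm ((b - a) *\<^sub>R u' t) \<le> (b - a) * M"
    using M[of t] t(1) ab unfolding norm_scaleR by (intro mult_mono) auto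
  then show ?thesis
    using t(2) by (simp add: mult.commute)
qed simp

text \<open>Taylor expansion at x with step h, solved for h u'(x). The step stays free, to be
  balanced against the decay of \<open>u\<close>, and goes to the right, so that x + h remains where
  \<open>u\<close> is known to be small.\<close>

lemma Landau_interpolation:
  fixes u u' u'' :: "real \<Rightarrow> complex"
  assumes d: "\<And>t. (u has_vector_derivative u' t) (at t)" "\<And>t. (u' has_vector_derivative u'' t) (at t)"
    and M: "\<And>t. norm (u'' t) \<le> M" and h: "h > 0"
  shows "h * norm (u' x) \<le> norm (u x) + norm (u (x + h)) + h\<^sup>2 * M"
proof -
  have M0: "M \<ge> 0"
    using order_trans[OF norm_ge_zero M] .
  have "norm (u (x + h) - u x - (x + h - x) *\<^sub>R u' x) \<le> norm (x + h - x) * (M * h)"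
  proof (rule vector_differentiable_bound_linearization[where S="{x..x + h}"])
    show "(u has_vector_derivative u' t) (at t within {x..x + h})" for t
      by (rule has_vector_derivative_at_within[OF d(1)])
    show "norm (u' t - u' x) \<le> M * h" if "t \<in> {x..x + h}" for t
    proof -
      have "norm (u' t - u' x) \<le> M * (t - x)"
        using that by (intro vector_derivative_norm_diff_le[OF d(2)] M) auto
      also have "\<dots> \<le> M * h"
        using that M0 by (intro mult_left_mono) auto
      finally show ?thesis .
    qed
  qed (use h in \<open>auto simp: closed_segment_eq_real_ivl\<close>)
  then have "norm (h *\<^sub>R u' x) \<le> norm (u (x + h) - u x) + h * (M * h)"
    using h norm_triangle_ineq2[of "h *\<^sub>R u' x" "u (x + h) - u x"] by (simp add: norm_minus_commute)
  also have "\<dots> \<le> norm (u x) + norm (u (x + h)) + h\<^sup>2 * M"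
    using norm_triangle_ineq4[of "u (x + h)" "u x"] by (simp add: power2_eq_square mult_ac)
  finally show ?thesis
    using h by simp
qed

text \<open>Right-endpoint Riemann sums of the decreasing function 1/(1 + y^2), compared with
  increments of \<open>arctan\<close>; the bound is uniform in the mesh 1/L.\<close>

lemma Riemann_sum_arctan_le:
  assumes "L > 0"
  shows "(\<Sum>k<n. 1 / L * (1 / (1 + (real (Suc k) / L)\<^sup>2))) \<le> pi / 2"
proof -
  have step: "1 / L * (1 / (1 + (real (Suc k) / L)\<^sup>2)) \<le> arctan (real (Suc k) / L) - arctan (real k / L)" for k
  proof -
    have lt: "real k / L < real (Suc k) / L"
      using assms by (simp add: divide_strict_right_mono)
    obtain z where z: "real k / L < z" "z < real (Suc k) / L"
      "arctan (real (Suc k) / L) - arctan (real k / L) = (real (Suc k) / L - real k / L) * inverse (1 + z\<^sup>2)"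
      using MVT2[OF lt, of arctan "\<lambda>z. inverse (1 + z\<^sup>2)"] by (auto intro: DERIV_arctan)
    have "0 \<le> real k / L"
      using assms by simp
    then have "0 \<le> z"
      using z(1) by linarith
    then have "z\<^sup>2 \<le> (real (Suc k) / L)\<^sup>2"
      using z(2) by (intro power_mono) auto
    then have "1 / (1 + (real (Suc k) / L)\<^sup>2) \<le> inverse (1 + z\<^sup>2)"
      unfolding inverse_eq_divide by (intro divide_left_mono) (auto simp: add_pos_nonneg)
    then have "1 / L * (1 / (1 + (real (Suc k) / L)\<^sup>2)) \<le> 1 / L * inverse (1 + z\<^sup>2)"
      using assms by (intro mult_left_mono) auto
    then show ?thesis
      unfolding z(3) by (simp add: diff_divide_distrib[symmetric])
  qed
  have "(\<Sum>k<n. 1 / L * (1 / (1 + (real (Suc k) / L)\<^sup>2))) \<le> (\<Sum>k<n. arctan (real (Suc k) / L) - arctan (real k / L))"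
    by (intro sum_mono step)
  also have "\<dots> = arctan (real n / L) - arctan (real 0 / L)"
    by (rule sum_lessThan_telescope)
  also have "\<dots> \<le> pi / 2"
    using arctan_ubound[of "real n / L"] by simp
  finally show ?thesis .
qed

text \<open>As |x| <= L/2, the points x + L n and x - L n with n >= 1 have modulus at least L n/2.
  Each value is then at most 4 B/(L n)^2, the pair doubles this, and the sum of 1/n^2 is at most
  2.\<close>

lemma dilation_tail_bound:
  fixes \<phi> :: "real \<Rightarrow> complex"
  assumes b: "\<And>t. norm (\<phi> t) \<le> B / (1 + t\<^sup>2)" and L: "L > 0" "2 * \<bar>x\<bar> \<le> L"
  shows "norm (\<Sum>n. \<phi> (x + L * real (Suc n)) + \<phi> (x - L * real (Suc n))) \<le> 16 * B / L\<^sup>2"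
proof -
  let ?p = "\<lambda>n. \<phi> (x + L * real (Suc n)) + \<phi> (x - L * real (Suc n))"
  have B: "B \<ge> 0"
    using order_trans[OF norm_ge_zero b[of 0]] by simp
  have one: "norm (\<phi> s) \<le> 4 * B / L\<^sup>2 * (1 / (real (Suc n))\<^sup>2)" if "\<bar>s\<bar> \<ge> L * real (Suc n) - \<bar>x\<bar>" for s n
  proof -
    have "L * 1 \<le> L * real (Suc n)"
      using L(1) by (intro mult_left_mono) auto
    then have "L * real (Suc n) / 2 \<le> \<bar>s\<bar>"
      using that L(2) by linarith
    then have "(L * real (Suc n) / 2)\<^sup>2 \<le> \<bar>s\<bar>\<^sup>2"
      using L(1) by (intro power_mono) auto
    then have "(L * real (Suc n) / 2)\<^sup>2 \<le> 1 + s\<^sup>2"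
      by simp
    then have "B / (1 + s\<^sup>2) \<le> B / (L * real (Suc n) / 2)\<^sup>2"
      using B L(1) by (intro divide_left_mono mult_pos_pos) (auto simp: add_pos_nonneg)
    also have "\<dots> = 4 * B / L\<^sup>2 * (1 / (real (Suc n))\<^sup>2)"
      by (simp add: power_mult_distrib power_divide del: of_nat_Suc)
    finally show ?thesis
      by (rule order_trans[OF b])
  qed
  have bound: "norm (?p n) \<le> 8 * B / L\<^sup>2 * (1 / (real (Suc n))\<^sup>2)" for n
  proof -
    have "norm (\<phi> (x + L * real (Suc n))) \<le> 4 * B / L\<^sup>2 * (1 / (real (Suc n))\<^sup>2)"
      "norm (\<phi> (x - L * real (Suc n))) \<le> 4 * B / L\<^sup>2 * (1 / (real (Suc n))\<^sup>2)"
      by (rule one, linarith)+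
    then show ?thesis
      using norm_triangle_ineq[of "\<phi> (x + L * real (Suc n))" "\<phi> (x - L * real (Suc n))"] by linarith
  qed
  have sm: "summable (\<lambda>n. 8 * B / L\<^sup>2 * (1 / (real (Suc n))\<^sup>2))"
    by (intro summable_mult summable_inverse_squares_Suc)
  have sn: "summable (\<lambda>n. norm (?p n))"
    using bound by (intro summable_comparison_test'[OF sm, of 0]) simp
  have "norm (\<Sum>n. ?p n)
      \<le> (\<Sum>n. norm (?p n))"
    by (rule summable_norm[OF sn])
  also have "\<dots> \<le> (\<Sum>n. 8 * B / L\<^sup>2 * (1 / (real (Suc n))\<^sup>2))"
    by (intro suminf_le bound sn sm)
  also have "\<dots> = 8 * B / L\<^sup>2 * (\<Sum>n. 1 / (real (Suc n))\<^sup>2)"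
    by (rule suminf_mult[OF summable_inverse_squares_Suc])
  also have "\<dots> \<le> 8 * B / L\<^sup>2 * 2"
    using B by (intro mult_left_mono suminf_inverse_squares_le) auto
  finally show ?thesis
    by simp
qed

text \<open>The Poisson formula with period \<open>L \<rightarrow> \<infinity>\<close> plays the role of Fourier inversion.\<close>

lemma vderiv_funpow_bound_Fourier:
  assumes f: "f \<in> Schwartz" and m: "m \<ge> 1"
    and F: "\<And>y. (1 + y\<^sup>2) * norm (Fourier ((vderiv ^^ m) f) y) \<le> M"
  shows "norm ((vderiv ^^ m) f x) \<le> pi * M"
proof -
  let ?\<phi> = "(vderiv ^^ m) f"
  have F': "norm (Fourier ?\<phi> y) \<le> M * (1 / (1 + y\<^sup>2))" for y
    using F[of y] by (simp add: pos_le_divide_eq add_pos_nonneg mult.commute)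
  have M0: "M \<ge> 0"
    by (rule order_trans[OF _ F[of 0]]) simp
  \<comment> \<open>A derivative of order at least 1 has integral 0, so the integral term drops out
    of the Poisson formula.\<close>
  have I0: "(\<integral>s. ?\<phi> s \<partial>lborel) = 0"
  proof -
    have "norm (Fourier ?\<phi> 0) = 0"
      using m by (simp add: norm_Fourier_vderiv_funpow[OF f])
    then show ?thesis
      by (simp add: Fourier_cis)
  qed
  define B where "B = Schwartz_seminorm 0 m f + Schwartz_seminorm 2 m f"
  have b: "norm (?\<phi> t) \<le> B / (1 + t\<^sup>2)" for t
    unfolding B_def by (rule Schwartz_quadratic_bound[OF f])
  \<comment> \<open>The frequency side is a Riemann sum for the integral of M/(1 + y^2) over the
    line, hence at most pi M for every \<open>L\<close>; the lattice points other than x contribute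
    O(1/L^2).\<close>
  have main: "norm (?\<phi> x) \<le> pi * M + 16 * B / L\<^sup>2" if L: "L > 0" "2 * \<bar>x\<bar> \<le> L" for L
  proof -
    let ?c = "\<lambda>k. of_real (2 / L) * (\<integral>s. cos (2 * pi * (real (Suc k) / L) * (s - x)) *\<^sub>R ?\<phi> s \<partial>lborel)"
    note P = Poisson_summation_Schwartz(2)[OF f L(1), where m=m and x=x]
    have cb: "norm (?c k) \<le> 2 * M * (1 / L * (1 / (1 + (real (Suc k) / L)\<^sup>2)))" for k
    proof -
      define y where "y = real (Suc k) / L"
      have "norm (\<integral>s. cos (2 * pi * y * (s - x)) *\<^sub>R ?\<phi> s \<partial>lborel) \<le> (norm (Fourier ?\<phi> y) + norm (Fourier ?\<phi> (- y))) / 2"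
        unfolding integral_cos_eq_Fourier[OF f]
        using norm_triangle_ineq[of "cis (- (2 * pi * y * x)) * Fourier ?\<phi> y" "cis (2 * pi * y * x) * Fourier ?\<phi> (- y)"]
        by (simp add: norm_divide norm_mult)
      also have "\<dots> \<le> M * (1 / (1 + y\<^sup>2))"
      proof -
        have "(a + b) / 2 \<le> c" if "a \<le> c" "b \<le> c" for a b c :: real
          using that by simp
        from this[OF F'[of y] F'[of "- y", unfolded power2_minus]] show ?thesis .
      qed
      finally have "2 / L * norm (\<integral>s. cos (2 * pi * y * (s - x)) *\<^sub>R ?\<phi> s \<partial>lborel) \<le> 2 / L * (M * (1 / (1 + y\<^sup>2)))"
        using L(1) by (intro mult_left_mono) auto
      then show ?thesis
        unfolding y_def norm_mult norm_of_real using L(1) by (simp del: of_nat_Suc)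
    qed
    let ?q = "\<lambda>k. 2 * M * (1 / L * (1 / (1 + (real (Suc k) / L)\<^sup>2)))"
    have sums: "(\<Sum>k<n. ?q k) \<le> pi * M" for n
    proof -
      have "(\<Sum>k<n. ?q k)
          = 2 * M * (\<Sum>k<n. 1 / L * (1 / (1 + (real (Suc k) / L)\<^sup>2)))"
        by (rule sum_distrib_left[symmetric])
      also have "\<dots> \<le> 2 * M * (pi / 2)"
        using M0 by (intro mult_left_mono Riemann_sum_arctan_le L(1)) simp
      also have "\<dots> = pi * M"
        by simp
      finally show ?thesis .
    qed
    have sm: "summable ?q"
    proof (rule bounded_imp_summable)
      show "0 \<le> ?q k" for k
        using L(1) M0 by simp
      show "(\<Sum>k\<le>n. ?q k) \<le> pi * M" for n
        using sums[of "Suc n"] unfolding lessThan_Suc_atMost .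
    qed
    have sn: "summable (\<lambda>k. norm (?c k))"
      using cb by (intro summable_comparison_test'[OF sm, of 0]) simp
    have "norm (\<Sum>k. ?c k) \<le> (\<Sum>k. norm (?c k))"
      by (rule summable_norm[OF sn])
    also have "\<dots> \<le> (\<Sum>k. ?q k)"
      by (intro suminf_le cb sn sm)
    also have "\<dots> \<le> pi * M"
      by (intro suminf_le_const sm sums)
    finally have 1: "norm (\<Sum>k. ?c k) \<le> pi * M" .
    define S where "S = (\<Sum>n. ?\<phi> (x + L * real (Suc n)) + ?\<phi> (x - L * real (Suc n)))"
    have "(\<Sum>k. ?c k) = ?\<phi> x + S"
      using sums_unique[OF P] unfolding I0 S_def by (simp only: div_0 diff_0_right)
    then have "?\<phi> x = (\<Sum>k. ?c k) - S"
      by (simp only: add_diff_cancel_right')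
    then have "norm (?\<phi> x) \<le> norm (\<Sum>k. ?c k) + norm S"
      using norm_triangle_ineq4[of "\<Sum>k. ?c k" S] by (simp only:)
    then show ?thesis
      using 1 dilation_tail_bound[OF b L] unfolding S_def[symmetric] by linarith
  qed
  have "(\<lambda>N. pi * M + 16 * B * inverse ((real (Suc N))\<^sup>2)) \<longlonglongrightarrow> pi * M + 16 * B * 0"
    using summable_LIMSEQ_zero[OF summable_inverse_squares_Suc] unfolding inverse_eq_divide
    by (intro tendsto_add tendsto_mult tendsto_const)
  then have lim: "(\<lambda>N. pi * M + 16 * B * inverse ((real (Suc N))\<^sup>2)) \<longlonglongrightarrow> pi * M"
    by simp
  show ?thesis
  proof (rule LIMSEQ_le_const[OF lim], intro exI[of _ "nat \<lceil>2 * \<bar>x\<bar>\<rceil>"] allI impI)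
    fix N assume "nat \<lceil>2 * \<bar>x\<bar>\<rceil> \<le> N"
    then have "2 * \<bar>x\<bar> \<le> real (Suc N)"
      by linarith
    then show "norm (?\<phi> x) \<le> pi * M + 16 * B * inverse ((real (Suc N))\<^sup>2)"
      using main[of "real (Suc N)"] by (simp add: divide_inverse del: of_nat_Suc)
  qed
qed

text \<open>The weight x^2 sees nothing near 0. So the estimate starts on [1, infinity), where it
  bounds \<open>f\<close> itself and, by \<open>Landau_interpolation\<close> with step 1, also f'.
  The mean value theorem carries the bounds back to [0, 1], for f' before \<open>f\<close>; evenness
  covers negative x.\<close>

lemma Hplus_derivative_bounds:
  assumes f: "f \<in> Hplus" and A: "\<And>x. x > 0 \<Longrightarrow> x\<^sup>2 * norm (f x) \<le> A"
    and M: "\<And>x. norm ((vderiv ^^ 2) f x) \<le> M"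
  shows "norm (vderiv f x) \<le> 2 * A + 2 * M" and "norm (f x) \<le> 3 * A + 2 * M"
proof -
  note fS = Hplus_imp_Schwartz[OF f]
  have d: "(f has_vector_derivative vderiv f t) (at t)" "(vderiv f has_vector_derivative (vderiv ^^ 2) f t) (at t)" for t
    using Schwartz_has_derivative[OF fS, of 0 t] Schwartz_has_derivative[OF fS, of 1 t]
    by (simp_all add: numeral_2_eq_2)
  have A1: "norm (f x) \<le> A" if "x \<ge> 1" for x
  proof -
    have "1 * norm (f x) \<le> x\<^sup>2 * norm (f x)"
      using that by (intro mult_right_mono) auto
    then show ?thesis
      using A[of x] that by simp
  qed
  have A0: "A \<ge> 0"
    using order_trans[OF norm_ge_zero A1[of 1]] by simp
  have M0: "M \<ge> 0"
    by (rule order_trans[OF norm_ge_zero M])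
  have far: "norm (vderiv f x) \<le> 2 * A + M" if "x \<ge> 1" for x
    using Landau_interpolation[OF d M, of 1 x] A1[of x] A1[of "x + 1"] that by simp
  have near: "norm (vderiv f x) \<le> 2 * A + 2 * M" if "x \<ge> 0" for x
  proof (cases "x \<ge> 1")
    case True
    then show ?thesis
      using far[of x] M0 by simp
  next
    case False
    have "norm (vderiv f 1 - vderiv f x) \<le> M * (1 - x)"
      using False by (intro vector_derivative_norm_diff_le[OF d(2) M]) auto
    also have "\<dots> \<le> M * 1"
      using M0 that by (intro mult_left_mono) auto
    finally have "norm (vderiv f 1 - vderiv f x) \<le> M"
      by simp
    then show ?thesis
      using far[of 1] norm_triangle_sub[of "vderiv f x" "vderiv f 1"] by (simp add: norm_minus_commute)
  qed
  have near0: "norm (f x) \<le> 3 * A + 2 * M" if "x \<ge> 0" for x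
  proof (cases "x \<ge> 1")
    case True
    then show ?thesis
      using A1[of x] M0 A0 by simp
  next
    case False
    have "norm (f 1 - f x) \<le> (2 * A + 2 * M) * (1 - x)"
      using False that by (intro vector_derivative_norm_diff_le[OF d(1)] near) auto
    also have "\<dots> \<le> (2 * A + 2 * M) * 1"
      using M0 A0 that by (intro mult_left_mono) auto
    finally have "norm (f 1 - f x) \<le> 2 * A + 2 * M"
      by simp
    then show ?thesis
      using A1[of 1] norm_triangle_sub[of "f x" "f 1"] by (simp add: norm_minus_commute)
  qed
  have "norm (vderiv f x) = norm (vderiv f \<bar>x\<bar>)" "f x = f \<bar>x\<bar>"
    using norm_vderiv_funpow_even[OF f, of 1 x] Hplus_even[OF f, of x] by (auto simp: abs_if)
  then show "norm (vderiv f x) \<le> 2 * A + 2 * M" "norm (f x) \<le> 3 * A + 2 * M"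
    using near[of "\<bar>x\<bar>"] near0[of "\<bar>x\<bar>"] by simp_all
qed

section \<open>Control of f by the coordinates of Zf\<close>

text \<open>Smallness of the three coordinates of \<open>Zeta f\<close> in \<open>Hcup\<close>. Only
  seminorms with k = m = 0 and integer weights enter: powers of x at infinity and of 1/x at 0 are
  all that the recovery of \<open>f\<close> consumes.\<close>

definition Zeta_small :: "(real \<Rightarrow> real) \<Rightarrow> nat \<Rightarrow> real \<Rightarrow> (real \<Rightarrow> complex) \<Rightarrow> bool" where
  "Zeta_small h0 J \<delta> f \<longleftrightarrow>
     (\<forall>s::int. \<bar>s\<bar> \<le> int J \<longrightarrow> Hminus_seminorm (of_int s) 0 0 (Zeta_rem h0 f) \<le> \<delta>) \<and>
     norm (- f 0 / 2) \<le> \<delta> \<and> norm (Fourier f 0 / 2) \<le> \<delta>"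

abbreviation Zeta_controlled :: "(real \<Rightarrow> real) \<Rightarrow> ((real \<Rightarrow> complex) \<Rightarrow> real) \<Rightarrow> bool" where
  "Zeta_controlled h0 \<equiv> controlled (Zeta_small h0)"

lemma filtration_Zeta_small: "filtration (Zeta_small h0)"
  by (auto simp: filtration_def Zeta_small_def)

lemmas Zeta_controlled_add = controlled_add[OF filtration_Zeta_small]

lemma Zeta_controlled_basic:
  "Zeta_controlled h0 (\<lambda>f. Hminus_seminorm (of_int s) 0 0 (Zeta_rem h0 f))"
  "Zeta_controlled h0 (\<lambda>f. norm (- f 0 / 2))"
  "Zeta_controlled h0 (\<lambda>f. norm (Fourier f 0 / 2))"
proof -
  show "Zeta_controlled h0 (\<lambda>f. Hminus_seminorm (of_int s) 0 0 (Zeta_rem h0 f))"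
    by (rule controlledI[of _ "nat \<bar>s\<bar>" _ 1]) (simp add: Zeta_small_def)
  show "Zeta_controlled h0 (\<lambda>f. norm (- f 0 / 2))" "Zeta_controlled h0 (\<lambda>f. norm (Fourier f 0 / 2))"
    by (rule controlledI[of _ 0 _ 1], simp only: Zeta_small_def mult_1)+
qed

lemma Zeta_rem_bound:
  assumes "cutoff h0" "f \<in> Hplus" "x > 0"
  shows "x powi s * norm (Zeta_rem h0 f x) \<le> Hminus_seminorm (of_int s) 0 0 (Zeta_rem h0 f)"
  using Hminus_pointwise_bound[OF Zeta_rem_Hminus(1)[OF assms(1,2)] assms(3), of "of_int s"] assms(3)
  by (simp add: powr_real_of_int')

text \<open>Both h0(x) and h0(1/x) - 1 vanish for x > exp T and are at most 1 in absolute value, so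
  (exp T)^k bounds them with every weight up to k. The second function is the cutoff as seen from
  the Fourier side.\<close>

lemma cutoff_power_bounds:
  assumes cut: "cutoff h0"
  obtains c where "c \<ge> 0" "\<And>x j. x > 0 \<Longrightarrow> j \<le> k \<Longrightarrow> x ^ j * \<bar>h0 x\<bar> \<le> c"
    "\<And>x j. x > 0 \<Longrightarrow> j \<le> k \<Longrightarrow> x ^ j * \<bar>h0 (inverse x) - 1\<bar> \<le> c"
proof -
  obtain T where T: "T \<ge> 0" "\<And>t. t < - T \<Longrightarrow> h0 (exp t) = 1" "\<And>t. t > T \<Longrightarrow> h0 (exp t) = 0"
    by (rule cutoff_thresholds[OF cut], rule that)
  define c where "c = exp T ^ k"
  have c0: "c \<ge> 0"
    by (simp add: c_def)
  have le: "x ^ j * b \<le> c" if "x > 0" "j \<le> k" "0 \<le> b" "b \<le> 1" "ln x > T \<Longrightarrow> b = 0" for x b j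
  proof (cases "ln x > T")
    case True
    then show ?thesis
      using that(5) c0 by simp
  next
    case False
    then have "x \<le> exp T"
      using that(1) by (metis exp_le_cancel_iff exp_ln not_le)
    then have "x ^ j \<le> exp T ^ j"
      using that(1) by (intro power_mono) auto
    also have "\<dots> \<le> c"
      unfolding c_def using T(1) that(2) by (intro power_increasing) auto
    finally have "x ^ j * b \<le> c * 1"
      using that c0 by (intro mult_mono) auto
    then show ?thesis
      by simp
  qed
  have h01: "0 \<le> h0 x" "h0 x \<le> 1" if "x > 0" for x
    using cut that by (auto simp: cutoff_def)
  show ?thesis
  proof (rule that[OF c0])
    fix x :: real and j assume xj: "x > 0" "j \<le> k"
    show "x ^ j * \<bar>h0 x\<bar> \<le> c"
      using T(3)[of "ln x"] xj h01[of x] by (intro le) auto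
    show "x ^ j * \<bar>h0 (inverse x) - 1\<bar> \<le> c"
      using T(2)[of "- ln x"] xj h01[of "inverse x"] by (intro le) (auto simp: exp_minus)
  qed
qed

text \<open>Since \<open>h0\<close> vanishes for large x, the singular terms can be added back with
  weight x^k at the cost of a constant. Thus Zf itself is bounded with this weight, and
  \<open>Zeta_inverse_bound\<close> recovers \<open>f\<close>.\<close>

lemma Zeta_controlled_decay:
  assumes cut: "cutoff h0" and k: "k \<ge> 2"
  shows "\<exists>Q. Zeta_controlled h0 Q \<and> (\<forall>f\<in>Hplus. \<forall>x>0. x ^ k * norm (f x) \<le> Q f)"
proof -
  obtain c where c: "c \<ge> 0" "\<And>x j. x > 0 \<Longrightarrow> j \<le> k \<Longrightarrow> x ^ j * \<bar>h0 x\<bar> \<le> c"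
    by (rule cutoff_power_bounds[OF cut, of k], rule that)
  define Q where "Q f = Hminus_seminorm (of_int (int k)) 0 0 (Zeta_rem h0 f)
    + (c * norm (- f 0 / 2) + c * norm (Fourier f 0 / 2))" for f
  have "x ^ k * norm (f x) \<le> 4 * Q f" if f: "f \<in> Hplus" and x: "x > 0" for f x
  proof (rule Zeta_inverse_bound[OF Hplus_pow_bound[OF f] k _ x])
    fix x :: real assume x: "x > 0"
    let ?a = "- f 0 / 2" and ?b = "Fourier f 0 / 2"
    have Z: "Zeta f x = Zeta_rem h0 f x + ?a * of_real (h0 x) + ?b * of_real (inverse x * h0 x)"
      using x by (simp add: Zeta_rem_def ext0_def)
    have "norm (Zeta f x) \<le> norm (Zeta_rem h0 f x) + norm (?a * of_real (h0 x)) + norm (?b * of_real (inverse x * h0 x))"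
      unfolding Z by (intro order_trans[OF norm_triangle_ineq] add_right_mono norm_triangle_ineq)
    also have "\<dots> = norm (Zeta_rem h0 f x) + norm ?a * \<bar>h0 x\<bar> + norm ?b * (inverse x * \<bar>h0 x\<bar>)"
      unfolding norm_mult norm_of_real abs_mult using x by simp
    finally have "x ^ k * norm (Zeta f x) \<le> x ^ k * (norm (Zeta_rem h0 f x) + norm ?a * \<bar>h0 x\<bar> + norm ?b * (inverse x * \<bar>h0 x\<bar>))"
      using x by (intro mult_left_mono) auto
    also have "\<dots> = x ^ k * norm (Zeta_rem h0 f x) + ((x ^ k * \<bar>h0 x\<bar>) * norm ?a + (x ^ k * inverse x * \<bar>h0 x\<bar>) * norm ?b)"
      by (simp only: distrib_left mult_ac add_ac)
    also have "\<dots> \<le> Q f"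
      unfolding Q_def
    proof (intro add_mono mult_right_mono)
      show "x ^ k * norm (Zeta_rem h0 f x) \<le> Hminus_seminorm (of_int (int k)) 0 0 (Zeta_rem h0 f)"
        using Zeta_rem_bound[OF cut f x, of "int k"] by simp
      show "x ^ k * \<bar>h0 x\<bar> \<le> c"
        by (rule c(2)[OF x order_refl])
      have "x ^ k * inverse x = x ^ (k - 1)"
        using k x by (cases k) auto
      then show "x ^ k * inverse x * \<bar>h0 x\<bar> \<le> c"
        using c(2)[OF x, of "k - 1"] by simp
    qed auto
    finally show "x ^ k * norm (Zeta f x) \<le> Q f" .
  qed
  moreover have "Zeta_controlled h0 (\<lambda>f. 4 * Q f)"
    unfolding Q_def
    by (intro controlled_cmult Zeta_controlled_add Zeta_controlled_basic c(1)) simp_all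
  ultimately show ?thesis
    by blast
qed

text \<open>At x = 1/y the functional equation leaves the coefficients multiplied by h0(1/y) - 1,
  which vanishes for large y, so \<open>Zeta_inverse_bound\<close> can be applied to
  \<open>Fourier f\<close>. The equation supplies \<open>Zeta (Fourier f) y\<close> already times y,
  hence the weight 1 - k instead of -k in x.\<close>

lemma Zeta_controlled_Fourier_decay:
  assumes cut: "cutoff h0" and k: "k \<ge> 2"
  shows "\<exists>Q. Zeta_controlled h0 Q \<and> (\<forall>f\<in>Hplus. \<forall>y>0. y ^ k * norm (Fourier f y) \<le> Q f)"
proof -
  obtain c where c: "c \<ge> 0" "\<And>y j. y > 0 \<Longrightarrow> j \<le> k \<Longrightarrow> y ^ j * \<bar>h0 (inverse y) - 1\<bar> \<le> c"
    by (rule cutoff_power_bounds[OF cut, of k], rule that)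
  define Q where "Q f = Hminus_seminorm (of_int (1 - int k)) 0 0 (Zeta_rem h0 f)
    + (c * norm (- f 0 / 2) + c * norm (Fourier f 0 / 2))" for f
  have "y ^ k * norm (Fourier f y) \<le> 4 * Q f" if f: "f \<in> Hplus" and y: "y > 0" for f y
  proof (rule Zeta_inverse_bound[OF Fourier_pow_bound[OF Hplus_imp_Schwartz[OF f]] k _ y])
    fix y :: real assume y: "y > 0"
    define x where "x = inverse y"
    have x: "x > 0" "inverse x = y"
      using y by (simp_all add: x_def)
    let ?a = "- f 0 / 2" and ?b = "Fourier f 0 / 2"
    have "Zeta f x = ?a + ?b * of_real y + Zeta (Fourier f) y * of_real y"
      using Zeta_functional_equation[OF f x(1)] by (simp add: x(2))
    moreover have "Zeta f x = Zeta_rem h0 f x + ?a * of_real (h0 x) + ?b * of_real (y * h0 x)"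
      using x(1) by (simp add: Zeta_rem_def ext0_def flip: x(2))
    ultimately have Z: "Zeta (Fourier f) y * of_real y
        = Zeta_rem h0 f x + ?a * of_real (h0 x - 1) + ?b * of_real (y * (h0 x - 1))"
    proof -
      assume "Zeta f x = ?a + ?b * of_real y + Zeta (Fourier f) y * of_real y"
        and "Zeta f x = Zeta_rem h0 f x + ?a * of_real (h0 x) + ?b * of_real (y * h0 x)"
      moreover have "w = r + a * of_real (h0 x - 1) + b * of_real (y * (h0 x - 1))"
        if "z = a + b * of_real y + w" "z = r + a * of_real (h0 x) + b * of_real (y * h0 x)" for z w r a b :: complex
        using that by (simp add: algebra_simps)
      ultimately show ?thesis
        by blast
    qed
    have "norm (Zeta (Fourier f) y) * y = norm (Zeta (Fourier f) y * of_real y)"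
      using y by (simp add: norm_mult)
    also have "\<dots> \<le> norm (Zeta_rem h0 f x) + norm (?a * of_real (h0 x - 1)) + norm (?b * of_real (y * (h0 x - 1)))"
      unfolding Z by (intro order_trans[OF norm_triangle_ineq] add_right_mono norm_triangle_ineq)
    also have "\<dots> = norm (Zeta_rem h0 f x) + norm ?a * \<bar>h0 x - 1\<bar> + norm ?b * (y * \<bar>h0 x - 1\<bar>)"
      unfolding norm_mult norm_of_real abs_mult using y by simp
    finally have "y ^ (k - 1) * (norm (Zeta (Fourier f) y) * y)
        \<le> y ^ (k - 1) * (norm (Zeta_rem h0 f x) + norm ?a * \<bar>h0 x - 1\<bar> + norm ?b * (y * \<bar>h0 x - 1\<bar>))"
      using y by (intro mult_left_mono) auto
    also have "\<dots> = y ^ (k - 1) * norm (Zeta_rem h0 f x)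
        + ((y ^ (k - 1) * \<bar>h0 x - 1\<bar>) * norm ?a + (y * y ^ (k - 1) * \<bar>h0 x - 1\<bar>) * norm ?b)"
      by (simp only: distrib_left mult_ac add_ac)
    also have "\<dots> \<le> Q f"
      unfolding Q_def
    proof (intro add_mono mult_right_mono)
      have "x powi (1 - int k) = y ^ (k - 1)"
      proof -
        have "1 - int k = - int (k - 1)"
          using k by simp
        then show ?thesis
          by (simp only: power_int_minus power_int_of_nat x_def power_inverse inverse_inverse_eq)
      qed
      then show "y ^ (k - 1) * norm (Zeta_rem h0 f x)
          \<le> Hminus_seminorm (of_int (1 - int k)) 0 0 (Zeta_rem h0 f)"
        using Zeta_rem_bound[OF cut f x(1), of "1 - int k"] by simp
      show "y ^ (k - 1) * \<bar>h0 x - 1\<bar> \<le> c"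
        unfolding x_def by (rule c(2)[OF y]) simp
      show "y * y ^ (k - 1) * \<bar>h0 x - 1\<bar> \<le> c"
        using c(2)[OF y, of k] k unfolding x_def by (simp add: power_eq_if)
    qed auto
    finally show "y ^ k * norm (Zeta (Fourier f) y) \<le> Q f"
      using k by (simp add: power_eq_if mult_ac)
  qed
  moreover have "Zeta_controlled h0 (\<lambda>f. 4 * Q f)"
    unfolding Q_def
    by (intro controlled_cmult Zeta_controlled_add Zeta_controlled_basic c(1)) simp_all
  ultimately show ?thesis
    by blast
qed

text \<open>The Fourier criterion asks for 1 + y^2 times |y|^m |Ff(y)|, that is for decay of orders
  m and m + 2, and decay is under control from order 2 on.\<close>

lemma Zeta_controlled_derivatives_ge_2:
  assumes cut: "cutoff h0" and m: "m \<ge> 2"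
  shows "\<exists>Q. Zeta_controlled h0 Q \<and> (\<forall>f\<in>Hplus. \<forall>x. norm ((vderiv ^^ m) f x) \<le> Q f)"
proof -
  obtain Q1 where Q1: "Zeta_controlled h0 Q1" "\<And>f y. f \<in> Hplus \<Longrightarrow> y > 0 \<Longrightarrow> y ^ m * norm (Fourier f y) \<le> Q1 f"
    using Zeta_controlled_Fourier_decay[OF cut m] by blast
  obtain Q2 where Q2: "Zeta_controlled h0 Q2" "\<And>f y. f \<in> Hplus \<Longrightarrow> y > 0 \<Longrightarrow> y ^ (m + 2) * norm (Fourier f y) \<le> Q2 f"
    using Zeta_controlled_Fourier_decay[OF cut, of "m + 2"] by auto
  have "norm ((vderiv ^^ m) f x) \<le> pi * ((2 * pi) ^ m * (Q1 f + Q2 f))" if f: "f \<in> Hplus" for f x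
  proof (rule vderiv_funpow_bound_Fourier[OF Hplus_imp_Schwartz[OF f]])
    have nn: "0 \<le> Q1 f" "0 \<le> Q2 f"
      by (rule order_trans[OF _ Q1(2)[OF f zero_less_one]], simp) (rule order_trans[OF _ Q2(2)[OF f zero_less_one]], simp)
    fix y :: real
    have e: "norm (Fourier ((vderiv ^^ m) f) y) = (2 * pi) ^ m * (\<bar>y\<bar> ^ m * norm (Fourier f \<bar>y\<bar>))"
    proof -
      have "\<bar>2 * pi * y\<bar> ^ m = (2 * pi) ^ m * \<bar>y\<bar> ^ m"
        by (simp add: abs_mult power_mult_distrib)
      moreover have "Fourier f y = Fourier f \<bar>y\<bar>"
        using Fourier_even[OF f, of y] by (auto simp: abs_if)
      ultimately show ?thesis
        by (simp add: norm_Fourier_vderiv_funpow[OF Hplus_imp_Schwartz[OF f]])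
    qed
    show "(1 + y\<^sup>2) * norm (Fourier ((vderiv ^^ m) f) y) \<le> (2 * pi) ^ m * (Q1 f + Q2 f)"
    \<comment> \<open>\<open>Q1\<close> and \<open>Q2\<close> speak of y > 0; at y = 0 the factor
      |y|^m is 0.\<close>
    proof (cases "y = 0")
      case True
      then show ?thesis
        unfolding e using m nn by (simp add: zero_power[where 'a=real])
    next
      case False
      then have y: "\<bar>y\<bar> > 0"
        by simp
      have "(1 + y\<^sup>2) * (\<bar>y\<bar> ^ m * norm (Fourier f \<bar>y\<bar>))
          = \<bar>y\<bar> ^ m * norm (Fourier f \<bar>y\<bar>) + \<bar>y\<bar> ^ (m + 2) * norm (Fourier f \<bar>y\<bar>)"
        by (simp add: algebra_simps power_add power2_eq_square)
      also have "\<dots> \<le> Q1 f + Q2 f"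
        by (intro add_mono Q1(2)[OF f y] Q2(2)[OF f y])
      finally have "(2 * pi) ^ m * ((1 + y\<^sup>2) * (\<bar>y\<bar> ^ m * norm (Fourier f \<bar>y\<bar>))) \<le> (2 * pi) ^ m * (Q1 f + Q2 f)"
        by (intro mult_left_mono) auto
      then show ?thesis
        unfolding e by (simp only: mult.left_commute)
    qed
  qed (use m in simp)
  moreover have "Zeta_controlled h0 (\<lambda>f. pi * ((2 * pi) ^ m * (Q1 f + Q2 f)))"
    by (intro controlled_cmult Zeta_controlled_add Q1(1) Q2(1)) auto
  ultimately show ?thesis
    by blast
qed

lemma Zeta_controlled_derivatives:
  assumes cut: "cutoff h0"
  shows "\<exists>Q. Zeta_controlled h0 Q \<and> (\<forall>f\<in>Hplus. \<forall>x. norm ((vderiv ^^ m) f x) \<le> Q f)"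
proof (cases "m \<ge> 2")
  case True
  then show ?thesis
    by (rule Zeta_controlled_derivatives_ge_2[OF cut])
next
  case False
  obtain M where M: "Zeta_controlled h0 M" "\<And>f x. f \<in> Hplus \<Longrightarrow> norm ((vderiv ^^ 2) f x) \<le> M f"
    using Zeta_controlled_derivatives_ge_2[OF cut order_refl] by blast
  obtain A where A: "Zeta_controlled h0 A" "\<And>f x. f \<in> Hplus \<Longrightarrow> x > 0 \<Longrightarrow> x\<^sup>2 * norm (f x) \<le> A f"
    using Zeta_controlled_decay[OF cut order_refl] by blast
  note b = Hplus_derivative_bounds[OF _ A(2) M(2)]
  consider "m = 0" | "m = 1"
    using False by linarith
  then show ?thesis
  proof cases
    case 1
    have "Zeta_controlled h0 (\<lambda>f. 3 * A f + 2 * M f)"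
      by (intro Zeta_controlled_add controlled_cmult A M) auto
    then show ?thesis
      using b(2) by (auto simp: 1)
  next
    case 2
    have "Zeta_controlled h0 (\<lambda>f. 2 * A f + 2 * M f)"
      by (intro Zeta_controlled_add controlled_cmult A M) auto
    then show ?thesis
      using b(1) by (auto simp: 2)
  qed
qed

text \<open>All derivatives are bounded and \<open>f\<close> itself decays rapidly. Interpolation
  passes decay up one order at a time while halving the exponent, so the induction is over m with
  all k at once. Evenness and the unweighted bounds take care of x < 1.\<close>

lemma Zeta_controlled_weighted:
  assumes cut: "cutoff h0"
  shows "\<exists>Q. Zeta_controlled h0 Q \<and> (\<forall>f\<in>Hplus. \<forall>x. \<bar>x\<bar> ^ k * norm ((vderiv ^^ m) f x) \<le> Q f)"
proof -
  have "\<exists>Q. Zeta_controlled h0 Q \<and> (\<forall>f\<in>Hplus. \<forall>x\<ge>1. x ^ k * norm ((vderiv ^^ m) f x) \<le> Q f)" for k m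
  proof (induction m arbitrary: k)
    case 0
    \<comment> \<open>The two spare powers meet the condition of the decay estimate, and for x >= 1
      they only enlarge the weight.\<close>
    obtain Q where Q: "Zeta_controlled h0 Q" "\<And>f x. f \<in> Hplus \<Longrightarrow> x > 0 \<Longrightarrow> x ^ (k + 2) * norm (f x) \<le> Q f"
      using Zeta_controlled_decay[OF cut, of "k + 2"] by auto
    have "x ^ k * norm (f x) \<le> Q f" if "f \<in> Hplus" "x \<ge> 1" for f x
    proof -
      have "x ^ k * norm (f x) \<le> x ^ (k + 2) * norm (f x)"
        using that by (intro mult_right_mono power_increasing) auto
      also have "\<dots> \<le> Q f"
        using that by (intro Q(2)) auto
      finally show ?thesis .
    qed
    then show ?case
      using Q(1) by auto
  next
    case (Suc m)
    obtain Q where Q: "Zeta_controlled h0 Q"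
      "\<And>f x. f \<in> Hplus \<Longrightarrow> x \<ge> 1 \<Longrightarrow> x ^ (2 * k) * norm ((vderiv ^^ m) f x) \<le> Q f"
      using Suc.IH[of "2 * k"] by blast
    obtain M where M: "Zeta_controlled h0 M" "\<And>f x. f \<in> Hplus \<Longrightarrow> norm ((vderiv ^^ Suc (Suc m)) f x) \<le> M f"
      using Zeta_controlled_derivatives[OF cut, of "Suc (Suc m)"] by blast
    have "x ^ k * norm ((vderiv ^^ Suc m) f x) \<le> 2 * Q f + M f" if f: "f \<in> Hplus" and x: "x \<ge> 1" for f x
    proof -
      note d = Schwartz_has_derivative[OF Hplus_imp_Schwartz[OF f]]
      (* The step h = x^(-k) turns the decay x^(-2k) of the m-th derivative into the decay x^(-k)
         of the next one. *)
      define h where "h = inverse (x ^ k)"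
      have h: "h > 0" "x ^ k * h = 1"
        using x by (simp_all add: h_def)
      have "h * norm ((vderiv ^^ Suc m) f x)
          \<le> norm ((vderiv ^^ m) f x) + norm ((vderiv ^^ m) f (x + h)) + h\<^sup>2 * M f"
        by (rule Landau_interpolation[OF d d M(2)[OF f] h(1)])
      then have "x ^ (2 * k) * (h * norm ((vderiv ^^ Suc m) f x))
          \<le> x ^ (2 * k) * (norm ((vderiv ^^ m) f x) + norm ((vderiv ^^ m) f (x + h)) + h\<^sup>2 * M f)"
        using x by (intro mult_left_mono) auto
      moreover have "x ^ (2 * k) * (h * norm ((vderiv ^^ Suc m) f x)) = (x ^ k * h) * (x ^ k * norm ((vderiv ^^ Suc m) f x))"
        by (simp add: power_add mult_2)
      moreover have "x ^ (2 * k) * (norm ((vderiv ^^ m) f x) + norm ((vderiv ^^ m) f (x + h)) + h\<^sup>2 * M f)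
          = x ^ (2 * k) * norm ((vderiv ^^ m) f x) + x ^ (2 * k) * norm ((vderiv ^^ m) f (x + h)) + (x ^ k * h)\<^sup>2 * M f"
        by (simp add: algebra_simps power_mult_distrib flip: power_mult)
      moreover have "x ^ (2 * k) * norm ((vderiv ^^ m) f (x + h)) \<le> Q f"
      proof -
        have "x ^ (2 * k) * norm ((vderiv ^^ m) f (x + h)) \<le> (x + h) ^ (2 * k) * norm ((vderiv ^^ m) f (x + h))"
          using x h(1) by (intro mult_right_mono power_mono) auto
        also have "\<dots> \<le> Q f"
          using x h(1) by (intro Q(2)[OF f]) simp
        finally show ?thesis .
      qed
      ultimately show ?thesis
        using Q(2)[OF f x] unfolding h(2) mult_1 power_one by linarith
    qed
    moreover have "Zeta_controlled h0 (\<lambda>f. 2 * Q f + M f)"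
      by (intro Zeta_controlled_add controlled_cmult Q M) auto
    ultimately show ?case
      by blast
  qed
  then obtain Q where Q: "Zeta_controlled h0 Q"
    "\<And>f x. f \<in> Hplus \<Longrightarrow> x \<ge> 1 \<Longrightarrow> x ^ k * norm ((vderiv ^^ m) f x) \<le> Q f"
    by metis
  obtain M where M: "Zeta_controlled h0 M" "\<And>f x. f \<in> Hplus \<Longrightarrow> norm ((vderiv ^^ m) f x) \<le> M f"
    using Zeta_controlled_derivatives[OF cut, of m] by blast
  have "\<bar>x\<bar> ^ k * norm ((vderiv ^^ m) f x) \<le> Q f + M f" if f: "f \<in> Hplus" for f x
  proof -
    have Q0: "0 \<le> Q f" and M0: "0 \<le> M f"
      using order_trans[OF _ Q(2)[OF f order_refl]] order_trans[OF norm_ge_zero M(2)[OF f]] by auto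
    have e: "norm ((vderiv ^^ m) f x) = norm ((vderiv ^^ m) f \<bar>x\<bar>)"
      using norm_vderiv_funpow_even[OF f, of m x] by (auto simp: abs_if)
    show ?thesis
    proof (cases "\<bar>x\<bar> \<ge> 1")
      case True
      then show ?thesis
        unfolding e using Q(2)[OF f True] M0 by simp
    next
      case False
      then have "\<bar>x\<bar> ^ k * norm ((vderiv ^^ m) f x) \<le> 1 * norm ((vderiv ^^ m) f x)"
        by (intro mult_right_mono power_le_one) auto
      then show ?thesis
        using M(2)[OF f, of x] Q0 by simp
    qed
  qed
  moreover have "Zeta_controlled h0 (\<lambda>f. Q f + M f)"
    by (intro Zeta_controlled_add Q M)
  ultimately show ?thesis
    by blast
qed

lemma Zeta_controlled_seminorm:
  assumes "cutoff h0"
  shows "Zeta_controlled h0 (Schwartz_seminorm k m)"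
proof -
  obtain Q where "Zeta_controlled h0 Q" "\<And>f x. f \<in> Hplus \<Longrightarrow> \<bar>x\<bar> ^ k * norm ((vderiv ^^ m) f x) \<le> Q f"
    using Zeta_controlled_weighted[OF assms] by blast
  then show ?thesis
    by (auto intro: controlled_mono Schwartz_seminorm_least)
qed

section \<open>Continuity, injectivity and closed range\<close>

text \<open>With weight k = 0 every derivative converges uniformly, so the pointwise limits form a
  derivative tower; the weighted estimates pass to the limit at each point.\<close>

lemma Hplus_complete:
  assumes F: "\<And>N. F N \<in> Hplus"
    and C: "\<And>k m e. e > 0 \<Longrightarrow> \<exists>n. \<forall>M\<ge>n. \<forall>N\<ge>n. Schwartz_seminorm k m (\<lambda>x. F M x - F N x) \<le> e"
  obtains f where "f \<in> Hplus"
    "\<And>k m. (\<lambda>N. Schwartz_seminorm k m (\<lambda>x. F N x - f x)) \<longlonglongrightarrow> 0"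
proof -
  note FS = Hplus_imp_Schwartz[OF F]
  have upper: "\<bar>x\<bar> ^ k * norm ((vderiv ^^ m) (F M) x - (vderiv ^^ m) (F N) x)
      \<le> Schwartz_seminorm k m (\<lambda>x. F M x - F N x)" for k m M N x
    using Schwartz_seminorm_upper[OF Schwartz_diff[OF FS FS], of x k m M N]
    by (simp add: vderiv_funpow_diff[OF FS FS])
  define G where "G m x = lim (\<lambda>N. (vderiv ^^ m) (F N) x)" for m x
  have G: "(\<lambda>N. (vderiv ^^ m) (F N) x) \<longlonglongrightarrow> G m x" for m x
  proof -
    have "Cauchy (\<lambda>N. (vderiv ^^ m) (F N) x)"
    proof (rule metric_CauchyI)
      fix e :: real assume "e > 0"
      then obtain n where n: "\<And>M N. M \<ge> n \<Longrightarrow> N \<ge> n \<Longrightarrow> Schwartz_seminorm 0 m (\<lambda>x. F M x - F N x) \<le> e / 2"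
        using C[of "e / 2" 0 m] by auto
      have "dist ((vderiv ^^ m) (F M) x) ((vderiv ^^ m) (F N) x) < e" if "M \<ge> n" "N \<ge> n" for M N
        using upper[of x 0 m M N] n[OF that] \<open>e > 0\<close> by (simp add: dist_norm)
      then show "\<exists>n. \<forall>M\<ge>n. \<forall>N\<ge>n. dist ((vderiv ^^ m) (F M) x) ((vderiv ^^ m) (F N) x) < e"
        by blast
    qed
    then show ?thesis
      unfolding G_def by (simp add: Cauchy_convergent_iff convergent_LIMSEQ_iff)
  qed
  have close: "\<exists>n. \<forall>N\<ge>n. \<forall>x. \<bar>x\<bar> ^ k * norm ((vderiv ^^ m) (F N) x - G m x) \<le> e" if e: "e > 0" for k m and e :: real
  proof -
    obtain n where n: "\<And>M N. M \<ge> n \<Longrightarrow> N \<ge> n \<Longrightarrow> Schwartz_seminorm k m (\<lambda>x. F M x - F N x) \<le> e"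
      using C[OF e, of k m] by blast
    have "\<bar>x\<bar> ^ k * norm ((vderiv ^^ m) (F N) x - G m x) \<le> e" if "N \<ge> n" for N x
    proof (rule LIMSEQ_le_const2)
      show "(\<lambda>M. \<bar>x\<bar> ^ k * norm ((vderiv ^^ m) (F N) x - (vderiv ^^ m) (F M) x))
          \<longlonglongrightarrow> \<bar>x\<bar> ^ k * norm ((vderiv ^^ m) (F N) x - G m x)"
        by (intro tendsto_mult tendsto_const tendsto_norm tendsto_diff G)
      show "\<exists>n0. \<forall>M\<ge>n0. \<bar>x\<bar> ^ k * norm ((vderiv ^^ m) (F N) x - (vderiv ^^ m) (F M) x) \<le> e"
        using order_trans[OF upper n[OF that]] by blast
    qed
    then show ?thesis
      by blast
  qed
  have seq: "deriv_seq G"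
    unfolding deriv_seq_def
  proof (intro allI)
    fix m x
    have "\<exists>g. \<forall>x\<in>UNIV. (\<lambda>N. (vderiv ^^ m) (F N) x) \<longlonglongrightarrow> g x \<and> (g has_derivative (\<lambda>h. h *\<^sub>R G (Suc m) x)) (at x within UNIV)"
    proof (rule has_derivative_sequence[where f'="\<lambda>N x h. h *\<^sub>R (vderiv ^^ Suc m) (F N) x"])
      show "((vderiv ^^ m) (F N) has_derivative (\<lambda>h. h *\<^sub>R (vderiv ^^ Suc m) (F N) x)) (at x within UNIV)" for N x
        using Schwartz_has_derivative[OF FS] unfolding has_vector_derivative_def by blast
      show "(\<lambda>N. (vderiv ^^ m) (F N) 0) \<longlonglongrightarrow> G m 0"
        by (rule G)
      fix e :: real assume "e > 0"
      then obtain n where n: "\<And>N x. N \<ge> n \<Longrightarrow> norm ((vderiv ^^ Suc m) (F N) x - G (Suc m) x) \<le> e"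
        using close[of e 0 "Suc m"] by auto
      have "norm (h *\<^sub>R (vderiv ^^ Suc m) (F N) x - h *\<^sub>R G (Suc m) x) \<le> e * norm h" if "N \<ge> n" for N x and h :: real
        using mult_left_mono[OF n[OF that, of x], of "\<bar>h\<bar>"]
        unfolding scaleR_diff_right[symmetric] norm_scaleR by (simp add: mult.commute)
      then show "\<forall>\<^sub>F N in sequentially. \<forall>x\<in>UNIV. \<forall>h. norm (h *\<^sub>R (vderiv ^^ Suc m) (F N) x - h *\<^sub>R G (Suc m) x) \<le> e * norm h"
        using eventually_sequentially by auto
    qed auto
    then obtain g where g: "\<And>x. (\<lambda>N. (vderiv ^^ m) (F N) x) \<longlonglongrightarrow> g x"
      "\<And>x. (g has_derivative (\<lambda>h. h *\<^sub>R G (Suc m) x)) (at x)"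
      by auto
    have "g = G m"
      using LIMSEQ_unique[OF g(1) G] by blast
    then show "(G m has_vector_derivative G (Suc m) x) (at x)"
      using g(2) by (simp add: has_vector_derivative_def)
  qed
  have "G 0 \<in> Schwartz"
  proof (rule SchwartzI[OF seq])
    fix k m
    obtain n where n: "\<And>x. \<bar>x\<bar> ^ k * norm ((vderiv ^^ m) (F n) x - G m x) \<le> 1"
      using close[of 1 k m] by auto
    have "\<bar>x\<bar> ^ k * norm (G m x) \<le> Schwartz_seminorm k m (F n) + 1" for x
    proof -
      have "norm (G m x) \<le> norm ((vderiv ^^ m) (F n) x) + norm ((vderiv ^^ m) (F n) x - G m x)"
        by (metis norm_minus_commute norm_triangle_sub)
      then have "\<bar>x\<bar> ^ k * norm (G m x) \<le> \<bar>x\<bar> ^ k * (norm ((vderiv ^^ m) (F n) x) + norm ((vderiv ^^ m) (F n) x - G m x))"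
        by (intro mult_left_mono) auto
      then show ?thesis
        using Schwartz_seminorm_upper[OF FS, of x k m n] n[of x] by (simp add: distrib_left)
    qed
    then show "\<exists>M. \<forall>x. \<bar>x\<bar> ^ k * norm (G m x) \<le> M"
      by blast
  qed
  moreover have "G 0 (- x) = G 0 x" for x
    unfolding G_def using Hplus_even[OF F] by simp
  ultimately have G0: "G 0 \<in> Hplus"
    by (simp add: Hplus_def)
  show ?thesis
  proof (rule that[OF G0])
    fix k m
    have nn: "0 \<le> Schwartz_seminorm k m (\<lambda>x. F N x - G 0 x)" for N
      by (rule Schwartz_seminorm_nonneg[OF Hplus_imp_Schwartz[OF Hplus_diff[OF F G0]]])
    show "(\<lambda>N. Schwartz_seminorm k m (\<lambda>x. F N x - G 0 x)) \<longlonglongrightarrow> 0"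
    proof (rule LIMSEQ_I)
      fix r :: real assume "r > 0"
      then obtain n where n: "\<And>N x. N \<ge> n \<Longrightarrow> \<bar>x\<bar> ^ k * norm ((vderiv ^^ m) (F N) x - G m x) \<le> r / 2"
        using close[of "r / 2" k m] by auto
      have "Schwartz_seminorm k m (\<lambda>x. F N x - G 0 x) \<le> r / 2" if "N \<ge> n" for N
        using n[OF that]
        by (intro Schwartz_seminorm_least)
          (simp add: vderiv_funpow_diff[OF FS Hplus_imp_Schwartz[OF G0]] deriv_seq_vderiv_funpow[OF seq])
      then show "\<exists>n. \<forall>N\<ge>n. norm (Schwartz_seminorm k m (\<lambda>x. F N x - G 0 x) - 0) < r"
        using \<open>r > 0\<close> nn by (intro exI[of _ n]) fastforce
    qed
  qed
qed

section \<open>Continuity in seminorm topologies\<close>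

lemma openin_seminorm_ball:
  assumes "f \<in> V" "p \<in> P" "e > 0"
  shows "openin (seminorm_topology V P) {g\<in>V. p (\<lambda>x. g x - f x) < e}"
  unfolding seminorm_topology_def
  by (rule topology_generated_by_Basis, rule CollectI, intro exI[of _ f] exI[of _ p] exI[of _ e] conjI refl assms)

text \<open>Subbasic balls may be centred anywhere in \<open>W\<close>; the triangle inequality fits
  a ball around \<open>T f\<close> into each of them, so continuity is checked one point and one
  seminorm at a time. The seminorm \<open>r\<close> guarantees that the topspace is
  \<open>W\<close>.\<close>

lemma continuous_map_seminorm_topologyI:
  assumes W: "\<And>f. f \<in> topspace X \<Longrightarrow> T f \<in> W"
    and Q: "r \<in> Q" "r (\<lambda>x. 0) = 0"
    and tri: "\<And>q a b c. q \<in> Q \<Longrightarrow> a \<in> W \<Longrightarrow> b \<in> W \<Longrightarrow> c \<in> W \<Longrightarrow>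
      q (\<lambda>x. a x - c x) \<le> q (\<lambda>x. a x - b x) + q (\<lambda>x. b x - c x)"
    and nbhd: "\<And>f q e. f \<in> topspace X \<Longrightarrow> q \<in> Q \<Longrightarrow> e > 0 \<Longrightarrow>
      \<exists>U. openin X U \<and> f \<in> U \<and> (\<forall>g\<in>U. q (\<lambda>x. T g x - T f x) < e)"
  shows "continuous_map X (seminorm_topology W Q) T"
  unfolding seminorm_topology_def
proof (rule continuous_on_generated_topo)
  fix B assume "B \<in> {{g\<in>W. q (\<lambda>x. g x - w x) < e} | w q e. w \<in> W \<and> q \<in> Q \<and> 0 < e}"
  then obtain w q e where B: "B = {g\<in>W. q (\<lambda>x. g x - w x) < e}" and w: "w \<in> W" "q \<in> Q"
    unfolding mem_Collect_eq by (elim exE conjE) (rule that)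
  show "openin X (T -` B \<inter> topspace X)"
  proof (subst openin_subopen, intro ballI)
    fix f assume "f \<in> T -` B \<inter> topspace X"
    then have f: "f \<in> topspace X" "q (\<lambda>x. T f x - w x) < e"
      by (auto simp: B)
    then have "0 < e - q (\<lambda>x. T f x - w x)"
      by simp
    from nbhd[OF f(1) w(2) this]
    obtain U where U: "openin X U" "f \<in> U" "\<forall>g\<in>U. q (\<lambda>x. T g x - T f x) < e - q (\<lambda>x. T f x - w x)"
      by (elim exE conjE) (rule that)
    have "g \<in> T -` B \<inter> topspace X" if "g \<in> U" for g
    proof -
      have g: "g \<in> topspace X"
        using openin_subset[OF U(1)] that by blast
      have "q (\<lambda>x. T g x - w x) \<le> q (\<lambda>x. T g x - T f x) + q (\<lambda>x. T f x - w x)"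
        by (rule tri[OF w(2) W[OF g] W[OF f(1)] w(1)])
      then show ?thesis
        using bspec[OF U(3) that] W[OF g] g by (simp add: B)
    qed
    then show "\<exists>U. openin X U \<and> f \<in> U \<and> U \<subseteq> T -` B \<inter> topspace X"
      using U(1,2) by (intro exI[of _ U]) auto
  qed
next
  have eq: "\<Union> {{g\<in>W. q (\<lambda>x. g x - w x) < e} | w q e. w \<in> W \<and> q \<in> Q \<and> 0 < e} = W"
    using topspace_seminorm_topology[OF Q, of W]
    by (simp only: seminorm_topology_def topology_generated_by_topspace)
  show "T ` topspace X \<subseteq> \<Union> {{g\<in>W. q (\<lambda>x. g x - w x) < e} | w q e. w \<in> W \<and> q \<in> Q \<and> 0 < e}"
    unfolding eq by (rule image_subsetI) (rule W)
qed

lemma continuous_map_complexI: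
  fixes T :: "'a \<Rightarrow> complex"
  assumes nbhd: "\<And>f e. f \<in> topspace X \<Longrightarrow> e > 0 \<Longrightarrow>
      \<exists>U. openin X U \<and> f \<in> U \<and> (\<forall>g\<in>U. norm (T g - T f) < e)"
  shows "continuous_map X euclidean T"
  unfolding continuous_map_alt
proof (intro conjI strip)
  fix V :: "complex set" assume "openin euclidean V"
  then have V: "open V"
    by simp
  show "openin X (T -` V \<inter> topspace X)"
  proof (subst openin_subopen, intro ballI)
    fix f assume "f \<in> T -` V \<inter> topspace X"
    then have f: "f \<in> topspace X" "T f \<in> V"
      by auto
    obtain e where e: "e > 0" "\<And>z. norm (z - T f) < e \<Longrightarrow> z \<in> V"
      using V f(2) unfolding open_dist dist_norm by blast
    obtain U where U: "openin X U" "f \<in> U" "\<And>g. g \<in> U \<Longrightarrow> norm (T g - T f) < e"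
      using nbhd[OF f(1) e(1)] by blast
    then show "\<exists>U. openin X U \<and> f \<in> U \<and> U \<subseteq> T -` V \<inter> topspace X"
      using e(2) openin_subset[OF U(1)] by blast
  qed
qed simp

lemma controlled_lessE:
  assumes "controlled P q" "e > 0"
  obtains K d where "d > 0" "\<And>f. f \<in> Hplus \<Longrightarrow> P K d f \<Longrightarrow> q f < e"
proof -
  obtain C K where CK: "\<And>f \<delta>. f \<in> Hplus \<Longrightarrow> \<delta> \<ge> 0 \<Longrightarrow> P K \<delta> f \<Longrightarrow> q f \<le> C * \<delta>"
    by (rule controlledE[OF assms(1)], rule that)
  \<comment> \<open>The denominator |C| + 1 is positive whatever the sign of \<open>C\<close> and
    makes the final inequality strict.\<close>
  define d where "d = e / (\<bar>C\<bar> + 1)"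
  have d: "d > 0"
    using assms(2) by (simp add: d_def)
  have "C * d \<le> \<bar>C\<bar> * d"
    using d by (intro mult_right_mono) auto
  also have "\<dots> < (\<bar>C\<bar> + 1) * d"
    using d by (simp add: distrib_right)
  also have "\<dots> = e"
    by (simp add: d_def)
  finally have "C * d < e" .
  then have "q f < e" if "f \<in> Hplus" "P K d f" for f
    using CK[OF that(1) less_imp_le[OF d] that(2)] by simp
  with d show ?thesis
    using that by blast
qed

lemma Hplus_top_nbhd:
  assumes f: "f \<in> Hplus" and d: "d > 0"
  shows "\<exists>U. openin Hplus_top U \<and> f \<in> U \<and> (\<forall>g\<in>U. g \<in> Hplus \<and> Schwartz_small K d (\<lambda>x. g x - f x))"
proof -
  let ?B = "\<lambda>(i, j). {g\<in>Schwartz. Schwartz_seminorm i j (\<lambda>x. g x - f x) < d}"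
  have "openin Schwartz_top (\<Inter>ij\<in>{..K} \<times> {..K}. ?B ij)"
    unfolding Schwartz_top_def
  proof (rule openin_INT2)
    fix ij :: "nat \<times> nat" assume "ij \<in> {..K} \<times> {..K}"
    obtain i j where ij: "ij = (i, j)"
      by fastforce
    show "openin (seminorm_topology Schwartz {Schwartz_seminorm k m |k m. True}) (?B ij)"
      unfolding ij split by (intro openin_seminorm_ball Hplus_imp_Schwartz f d) blast
  qed auto
  then have "openin Hplus_top ((\<Inter>ij\<in>{..K} \<times> {..K}. ?B ij) \<inter> Hplus)"
    unfolding Hplus_top_def by (auto simp: openin_subtopology)
  moreover have "f \<in> (\<Inter>ij\<in>{..K} \<times> {..K}. ?B ij) \<inter> Hplus"
    using f d by (auto simp: Schwartz_seminorm_zero Hplus_imp_Schwartz)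
  ultimately show ?thesis
    by (intro exI conjI) (auto simp: Schwartz_small_def intro: less_imp_le)
qed

lemma Hplus_controlled_nbhd:
  assumes "Hplus_controlled q" "f \<in> Hplus" "e > 0"
  shows "\<exists>U. openin Hplus_top U \<and> f \<in> U \<and> (\<forall>g\<in>U. g \<in> Hplus \<and> q (\<lambda>x. g x - f x) < e)"
proof -
  obtain K d where Kd: "d > 0" "\<And>f. f \<in> Hplus \<Longrightarrow> Schwartz_small K d f \<Longrightarrow> q f < e"
    by (rule controlled_lessE[OF assms(1,3)], rule that)
  obtain U where "openin Hplus_top U" "f \<in> U" "\<forall>g\<in>U. g \<in> Hplus \<and> Schwartz_small K d (\<lambda>x. g x - f x)"
    using Hplus_top_nbhd[OF assms(2) Kd(1), of K] by blast
  then show ?thesis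
    using Kd(2) Hplus_diff[OF _ assms(2)] by (intro exI[of _ U]) blast
qed

lemma Fourier_diff:
  assumes "f \<in> Schwartz" "g \<in> Schwartz"
  shows "Fourier (\<lambda>x. f x - g x) y = Fourier f y - Fourier g y"
  using integrable_mult_cis[OF assms(1), of 0] integrable_mult_cis[OF assms(2), of 0]
  by (simp add: Fourier_cis left_diff_distrib)

lemma Zeta_rem_diff:
  assumes "f \<in> Hplus" "g \<in> Hplus"
  shows "Zeta_rem h0 (\<lambda>x. f x - g x) = (\<lambda>x. Zeta_rem h0 f x - Zeta_rem h0 g x)"
  unfolding Zeta_rem_def Zeta_diff[OF assms] Fourier_diff[OF assms[THEN Hplus_imp_Schwartz]]
  by (rule ext) (simp add: algebra_simps diff_divide_distrib)

lemma continuous_map_Zeta_rem: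
  assumes cut: "cutoff h0"
  shows "continuous_map Hplus_top Hminus_top (Zeta_rem h0)"
  unfolding Hminus_top_def
proof (rule continuous_map_seminorm_topologyI[where r="\<lambda>f. Hminus_seminorm 0 0 0 f"])
  show "Zeta_rem h0 f \<in> Hminus" if "f \<in> topspace Hplus_top" for f
    using that Zeta_rem_Hminus(1)[OF cut] by (simp add: topspace_Hplus_top)
  show "(\<lambda>f. Hminus_seminorm 0 0 0 f) \<in> {\<lambda>f. Schwartz_seminorm k m (twist s f \<circ> exp) |s k m. True}"
    by blast
  show "Hminus_seminorm 0 0 0 (\<lambda>x. 0) = 0"
    by (simp add: Schwartz_seminorm_zero twist_def o_def)
next
  fix q a b c
  assume "q \<in> {\<lambda>f. Schwartz_seminorm k m (twist s f \<circ> exp) |s k m. True}" "a \<in> Hminus" "b \<in> Hminus" "c \<in> Hminus"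
  then show "q (\<lambda>x. a x - c x) \<le> q (\<lambda>x. a x - b x) + q (\<lambda>x. b x - c x)"
    using Hminus_seminorm_triangle by blast
next
  fix f q and e :: real
  assume f: "f \<in> topspace Hplus_top" and "q \<in> {\<lambda>f. Schwartz_seminorm k m (twist s f \<circ> exp) |s k m. True}" and e: "e > 0"
  then obtain s k m where q: "q = (\<lambda>f. Hminus_seminorm s k m f)"
    by blast
  have f: "f \<in> Hplus"
    using f by (simp add: topspace_Hplus_top)
  show "\<exists>U. openin Hplus_top U \<and> f \<in> U \<and> (\<forall>g\<in>U. q (\<lambda>x. Zeta_rem h0 g x - Zeta_rem h0 f x) < e)"
  proof -
    obtain U where U: "openin Hplus_top U" "f \<in> U"
      "\<forall>g\<in>U. g \<in> Hplus \<and> Hminus_seminorm s k m (Zeta_rem h0 (\<lambda>x. g x - f x)) < e"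
      using Hplus_controlled_nbhd[OF Zeta_rem_Hminus(2)[OF cut, of k m s] f e] by blast
    have "q (\<lambda>x. Zeta_rem h0 g x - Zeta_rem h0 f x) < e" if "g \<in> U" for g
    proof -
      have g: "g \<in> Hplus"
        using U(3) that by blast
      show ?thesis
        using bspec[OF U(3) that] unfolding q Zeta_rem_diff[OF g f] by (rule conjunct2)
    qed
    then show ?thesis
      using U(1,2) by (intro exI[of _ U]) simp
  qed
qed

lemma continuous_map_Hplus_complex:
  fixes T :: "(real \<Rightarrow> complex) \<Rightarrow> complex"
  assumes "Hplus_controlled (\<lambda>f. norm (T f))"
    and "\<And>f g. f \<in> Hplus \<Longrightarrow> g \<in> Hplus \<Longrightarrow> T (\<lambda>x. f x - g x) = T f - T g"
  shows "continuous_map Hplus_top euclidean T"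
proof (rule continuous_map_complexI)
  fix f and e :: real assume f: "f \<in> topspace Hplus_top" and e: "e > 0"
  then have f: "f \<in> Hplus"
    by (simp add: topspace_Hplus_top)
  show "\<exists>U. openin Hplus_top U \<and> f \<in> U \<and> (\<forall>g\<in>U. norm (T g - T f) < e)"
  proof -
    obtain U where U: "openin Hplus_top U" "f \<in> U" "\<forall>g\<in>U. g \<in> Hplus \<and> norm (T (\<lambda>x. g x - f x)) < e"
      using Hplus_controlled_nbhd[OF assms(1) f e] by blast
    have "norm (T g - T f) < e" if "g \<in> U" for g
    proof -
      have g: "g \<in> Hplus"
        using U(3) that by blast
      show ?thesis
        using bspec[OF U(3) that] unfolding assms(2)[OF g f] by (rule conjunct2)
    qed
    then show ?thesis
      using U(1,2) by (intro exI[of _ U]) simp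
  qed
qed

lemma continuous_map_Zeta_coefficients:
  "continuous_map Hplus_top euclidean (\<lambda>f. - f 0 / 2)"
  "continuous_map Hplus_top euclidean (\<lambda>f. Fourier f 0 / 2)"
proof -
  show "continuous_map Hplus_top euclidean (\<lambda>f. - f 0 / 2)"
  proof (rule continuous_map_Hplus_complex)
    have "norm (- f 0 / 2) \<le> Schwartz_seminorm 0 0 f" if "f \<in> Hplus" for f
    proof -
      have "norm (f 0) \<le> Schwartz_seminorm 0 0 f"
        using Schwartz_seminorm_upper[OF Hplus_imp_Schwartz[OF that], of 0 0 0] by simp
      then show ?thesis
        using norm_ge_zero[of "f 0"] unfolding norm_divide norm_minus_cancel norm_numeral by linarith
    qed
    then show "Hplus_controlled (\<lambda>f. norm (- f 0 / 2))"
      by (rule controlled_mono[OF Hplus_controlled_seminorm])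
  qed (simp add: diff_divide_distrib)
  show "continuous_map Hplus_top euclidean (\<lambda>f. Fourier f 0 / 2)"
  proof (rule continuous_map_Hplus_complex)
    have "norm (Fourier f 0 / 2) \<le> pi * (Schwartz_seminorm 0 0 f + Schwartz_seminorm 2 0 f)" if "f \<in> Hplus" for f
      using norm_Fourier_0_le[OF that] norm_ge_zero[of "Fourier f 0"] unfolding norm_divide norm_numeral by linarith
    moreover have "Hplus_controlled (\<lambda>f. pi * (Schwartz_seminorm 0 0 f + Schwartz_seminorm 2 0 f))"
      by (intro controlled_cmult Hplus_controlled_add Hplus_controlled_seminorm) simp
    ultimately show "Hplus_controlled (\<lambda>f. norm (Fourier f 0 / 2))"
      by (rule controlled_mono[rotated])
  qed (simp add: Fourier_diff[OF Hplus_imp_Schwartz Hplus_imp_Schwartz] diff_divide_distrib)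
qed

text \<open>\<open>Hcup_top\<close> is pulled back along this inverse, so these are the coordinates
  in which every topological statement about \<open>Zeta\<close> is checked.\<close>

lemma Zeta_triple:
  assumes cut: "cutoff h0" and f: "f \<in> Hplus"
  shows "the_inv_into (Hminus \<times> UNIV \<times> UNIV) (Hcup_sum h0) (Zeta f) = (Zeta_rem h0 f, - f 0 / 2, Fourier f 0 / 2)"
  unfolding Zeta_eq_Hcup_sum[of f h0]
  using Zeta_rem_Hminus(1)[OF cut f] by (intro the_inv_into_f_f inj_on_Hcup_sum cut) simp

lemma Zeta_in_Hcup: "cutoff h0 \<Longrightarrow> f \<in> Hplus \<Longrightarrow> Zeta f \<in> Hcup h0"
  unfolding Hcup_def using Zeta_eq_Hcup_sum[of f h0] Zeta_rem_Hminus(1) by blast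

lemma continuous_map_Zeta:
  assumes cut: "cutoff h0"
  shows "continuous_map Hplus_top (Hcup_top h0) Zeta"
  unfolding Hcup_top_def
proof (rule continuous_map_pullback')
  have "continuous_map Hplus_top (prod_topology Hminus_top (prod_topology euclidean euclidean))
      (\<lambda>f. (Zeta_rem h0 f, - f 0 / 2, Fourier f 0 / 2))"
    by (intro continuous_map_pairedI continuous_map_Zeta_rem cut continuous_map_Zeta_coefficients)
  then show "continuous_map Hplus_top (prod_topology Hminus_top (prod_topology euclidean euclidean))
      (the_inv_into (Hminus \<times> UNIV \<times> UNIV) (Hcup_sum h0) \<circ> Zeta)"
    by (rule continuous_map_eq) (simp only: topspace_Hplus_top o_apply Zeta_triple[OF cut])
  show "topspace Hplus_top \<subseteq> Zeta -` Hcup h0"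
    using Zeta_in_Hcup[OF cut] by (auto simp: topspace_Hplus_top)
qed

text \<open>In contrast to \<open>Zeta_small\<close>, this measures the distance of
  \<open>Zeta f\<close> from an arbitrary point of \<open>Hcup\<close>, in the range or not.\<close>

definition Zeta_near ::
    "(real \<Rightarrow> real) \<Rightarrow> nat \<Rightarrow> real \<Rightarrow> (real \<Rightarrow> complex) \<Rightarrow> complex \<Rightarrow> complex \<Rightarrow> (real \<Rightarrow> complex) \<Rightarrow> bool" where
  "Zeta_near h0 J d g0 a0 b0 f \<longleftrightarrow>
     (\<forall>s::int. \<bar>s\<bar> \<le> int J \<longrightarrow> Hminus_seminorm (of_int s) 0 0 (\<lambda>x. Zeta_rem h0 f x - g0 x) < d) \<and>
     norm (- f 0 / 2 - a0) < d \<and> norm (Fourier f 0 / 2 - b0) < d"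

text \<open>Applied at a point of the range for continuity of the inverse, and at a point of the
  closure for closedness. Finitely many integer weights keep the intersection of balls open.\<close>

lemma Hcup_top_nbhd:
  assumes cut: "cutoff h0" and g0: "g0 \<in> Hminus" and d: "d > 0"
  shows "\<exists>U. openin (Hcup_top h0) U \<and> Hcup_sum h0 (g0, a0, b0) \<in> U \<and>
    (\<forall>f\<in>Hplus. Zeta f \<in> U \<longrightarrow> Zeta_near h0 J d g0 a0 b0 f)"
proof -
  let ?inv = "the_inv_into (Hminus \<times> UNIV \<times> UNIV) (Hcup_sum h0)"
  let ?S = "\<lambda>s::int. {g\<in>Hminus. Hminus_seminorm (of_int s) 0 0 (\<lambda>x. g x - g0 x) < d}"
  let ?G = "\<Inter>s\<in>{- int J..int J}. ?S s"
  let ?V = "?G \<times> ball a0 d \<times> ball b0 d"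
  have "openin Hminus_top ?G"
    unfolding Hminus_top_def
  proof (rule openin_INT2)
    fix s assume "s \<in> {- int J..int J}"
    show "openin (seminorm_topology Hminus {\<lambda>f. Schwartz_seminorm k m (twist s f \<circ> exp) |s k m. True}) (?S s)"
      by (rule openin_seminorm_ball[OF g0 _ d]) blast
  qed auto
  then have "openin (prod_topology Hminus_top (prod_topology euclidean euclidean)) ?V"
    by (simp add: openin_prod_Times_iff open_Times)
  then have "openin (Hcup_top h0) (?inv -` ?V \<inter> Hcup h0)"
    unfolding Hcup_top_def openin_pullback_topology by blast
  moreover have "Hcup_sum h0 (g0, a0, b0) \<in> ?inv -` ?V \<inter> Hcup h0"
  proof -
    have m: "(g0, a0, b0) \<in> Hminus \<times> UNIV \<times> UNIV"
      using g0 by simp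
    have "?inv (Hcup_sum h0 (g0, a0, b0)) = (g0, a0, b0)"
      by (rule the_inv_into_f_f[OF inj_on_Hcup_sum[OF cut] m])
    moreover have "(g0, a0, b0) \<in> ?V"
      using g0 d by (simp add: Schwartz_seminorm_zero twist_def o_def)
    moreover have "Hcup_sum h0 (g0, a0, b0) \<in> Hcup h0"
      unfolding Hcup_def using m by (rule imageI)
    ultimately show ?thesis
      by simp
  qed
  moreover have "Zeta_near h0 J d g0 a0 b0 f"
    if f: "f \<in> Hplus" and Z: "Zeta f \<in> ?inv -` ?V \<inter> Hcup h0" for f
  proof -
    have "(Zeta_rem h0 f, - f 0 / 2, Fourier f 0 / 2) \<in> ?V"
      using Z unfolding Int_iff vimage_eq Zeta_triple[OF cut f] by (rule conjunct1)
    then have G: "Zeta_rem h0 f \<in> ?G" and ab: "- f 0 / 2 \<in> ball a0 d" "Fourier f 0 / 2 \<in> ball b0 d"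
      by (simp_all only: mem_Times_iff fst_conv snd_conv)
    show ?thesis
      unfolding Zeta_near_def
    proof (intro conjI allI impI)
      show "norm (- f 0 / 2 - a0) < d" "norm (Fourier f 0 / 2 - b0) < d"
        using ab unfolding mem_ball dist_norm norm_minus_commute[of a0] norm_minus_commute[of b0] .
      fix s :: int assume "\<bar>s\<bar> \<le> int J"
      then have "s \<in> {- int J..int J}"
        by auto
      from INT_D[OF G this] show "Hminus_seminorm (of_int s) 0 0 (\<lambda>x. Zeta_rem h0 f x - g0 x) < d"
        by (simp only: mem_Collect_eq)
    qed
  qed
  ultimately show ?thesis
    by (intro exI[of _ "?inv -` ?V \<inter> Hcup h0"]) blast
qed

lemma Zeta_small_diffI:
  assumes f: "f \<in> Hplus" and g: "g \<in> Hplus"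
    and s: "\<And>s::int. \<bar>s\<bar> \<le> int J \<Longrightarrow> Hminus_seminorm (of_int s) 0 0 (\<lambda>x. Zeta_rem h0 f x - Zeta_rem h0 g x) \<le> d"
    and a: "norm (- f 0 / 2 - - g 0 / 2) \<le> d" and b: "norm (Fourier f 0 / 2 - Fourier g 0 / 2) \<le> d"
  shows "Zeta_small h0 J d (\<lambda>x. f x - g x)"
  unfolding Zeta_small_def Zeta_rem_diff[OF f g] Fourier_diff[OF f[THEN Hplus_imp_Schwartz] g[THEN Hplus_imp_Schwartz]]
proof (intro conjI allI impI s)
  have e: "- (f 0 - g 0) / 2 = - f 0 / 2 - - g 0 / 2" "(Fourier f 0 - Fourier g 0) / 2 = Fourier f 0 / 2 - Fourier g 0 / 2"
    by (simp_all add: field_simps)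
  show "norm (- (f 0 - g 0) / 2) \<le> d" "norm ((Fourier f 0 - Fourier g 0) / 2) \<le> d"
    unfolding e by (rule a, rule b)
qed

lemma Zeta_small_mono:
  assumes "K \<le> L" "d \<le> e" "Zeta_small h0 L d f"
  shows "Zeta_small h0 K e f"
proof -
  have "Zeta_small h0 K d f"
    using filtration_Zeta_small assms(1,3) unfolding filtration_def by blast
  then show ?thesis
    unfolding Zeta_small_def by (intro conjI allI impI; meson assms(2) order_trans)
qed

section \<open>The inverse map and the range\<close>

text \<open>Control with \<open>\<delta>\<close> = 0: the coordinates of the difference vanish,
  hence so does its supremum norm.\<close>

lemma inj_on_Zeta:
  assumes cut: "cutoff h0"
  shows "inj_on Zeta Hplus"
proof (rule inj_onI)
  fix f g assume f: "f \<in> Hplus" and g: "g \<in> Hplus" and eq: "Zeta f = Zeta g"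
  have t: "(Zeta_rem h0 f, - f 0 / 2, Fourier f 0 / 2) = (Zeta_rem h0 g, - g 0 / 2, Fourier g 0 / 2)"
    using Zeta_triple[OF cut f] Zeta_triple[OF cut g] eq by simp
  obtain C K where CK: "\<And>h \<delta>. h \<in> Hplus \<Longrightarrow> \<delta> \<ge> 0 \<Longrightarrow> Zeta_small h0 K \<delta> h \<Longrightarrow> Schwartz_seminorm 0 0 h \<le> C * \<delta>"
    by (rule controlledE[OF Zeta_controlled_seminorm[OF cut, of 0 0]], rule that)
  have "Zeta_small h0 K 0 (\<lambda>x. f x - g x)"
    using t by (intro Zeta_small_diffI f g) (auto simp: Schwartz_seminorm_zero twist_def o_def)
  from CK[OF Hplus_diff[OF f g] order_refl this] have 0: "Schwartz_seminorm 0 0 (\<lambda>x. f x - g x) \<le> 0"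
    by simp
  have "norm (f x - g x) \<le> Schwartz_seminorm 0 0 (\<lambda>x. f x - g x)" for x
    using Schwartz_seminorm_upper[OF Hplus_imp_Schwartz[OF Hplus_diff[OF f g]], of x 0 0] by simp
  from order_trans[OF this 0] have "norm (f x - g x) \<le> 0" for x .
  then show "f = g"
    by auto
qed

text \<open>By linearity, nearness of \<open>Zeta g\<close> to \<open>Zeta f\<close> is smallness of
  the coordinates of g - f, and these control every Schwartz seminorm of g - f.\<close>

lemma Zeta_inverse_continuous:
  assumes cut: "cutoff h0"
  shows "continuous_map (subtopology (Hcup_top h0) (Zeta ` Hplus)) Hplus_top (the_inv_into Hplus Zeta)"
proof -
  let ?Y = "subtopology (Hcup_top h0) (Zeta ` Hplus)"
  have top: "topspace ?Y = Zeta ` Hplus"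
    using Zeta_in_Hcup[OF cut] by (auto simp: topspace_Hcup_top[OF cut])
  have inv: "the_inv_into Hplus Zeta (Zeta f) = f" if "f \<in> Hplus" for f
    by (rule the_inv_into_f_f[OF inj_on_Zeta[OF cut] that])
  have "continuous_map ?Y Schwartz_top (the_inv_into Hplus Zeta)"
    unfolding Schwartz_top_def
  proof (rule continuous_map_seminorm_topologyI[where r="Schwartz_seminorm 0 0"])
    show "the_inv_into Hplus Zeta u \<in> Schwartz" if "u \<in> topspace ?Y" for u
      using that inv Hplus_imp_Schwartz unfolding top by auto
    show "Schwartz_seminorm 0 0 (\<lambda>x. 0) = 0"
      by (rule Schwartz_seminorm_zero)
  next
    fix q a b c
    assume "q \<in> {Schwartz_seminorm k m |k m. True}" "a \<in> Schwartz" "b \<in> Schwartz" "c \<in> Schwartz"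
    then show "q (\<lambda>x. a x - c x) \<le> q (\<lambda>x. a x - b x) + q (\<lambda>x. b x - c x)"
      using Schwartz_seminorm_triangle by blast
  next
    fix u q and e :: real
    assume u: "u \<in> topspace ?Y" and "q \<in> {Schwartz_seminorm k m |k m. True}" and e: "e > 0"
    then obtain k m f where q: "q = Schwartz_seminorm k m" and f: "f \<in> Hplus" and uf: "u = Zeta f"
      unfolding top by blast
    obtain K d where d: "d > 0" and Kd: "\<And>f. f \<in> Hplus \<Longrightarrow> Zeta_small h0 K d f \<Longrightarrow> Schwartz_seminorm k m f < e"
      by (rule controlled_lessE[OF Zeta_controlled_seminorm[OF cut, of k m] e], rule that)
    from Hcup_top_nbhd[OF cut Zeta_rem_Hminus(1)[OF cut f] d, of "- f 0 / 2" "Fourier f 0 / 2" K]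
    obtain U where U: "openin (Hcup_top h0) U" "Zeta f \<in> U"
      "\<forall>g\<in>Hplus. Zeta g \<in> U \<longrightarrow> Zeta_near h0 K d (Zeta_rem h0 f) (- f 0 / 2) (Fourier f 0 / 2) g"
      unfolding Zeta_eq_Hcup_sum[of f h0, symmetric] by blast
    have "q (\<lambda>x. the_inv_into Hplus Zeta v x - the_inv_into Hplus Zeta u x) < e" if v: "v \<in> U \<inter> Zeta ` Hplus" for v
    proof -
      obtain g where g: "g \<in> Hplus" "v = Zeta g"
        using v by blast
      have "Zeta_small h0 K d (\<lambda>x. g x - f x)"
        using U(3) g v unfolding Zeta_near_def by (intro Zeta_small_diffI g(1) f) (blast intro: less_imp_le)+
      from Kd[OF Hplus_diff[OF g(1) f] this] show ?thesis
        unfolding q uf g(2) inv[OF f] inv[OF g(1)] .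
    qed
    moreover have "openin ?Y (U \<inter> Zeta ` Hplus)"
      using U(1) by (auto simp: openin_subtopology)
    ultimately show "\<exists>U. openin ?Y U \<and> u \<in> U \<and>
        (\<forall>v\<in>U. q (\<lambda>x. the_inv_into Hplus Zeta v x - the_inv_into Hplus Zeta u x) < e)"
      using U(2) f uf by (intro exI[of _ "U \<inter> Zeta ` Hplus"]) auto
  qed blast
  moreover have "the_inv_into Hplus Zeta ` topspace ?Y \<subseteq> Hplus"
    using inv unfolding top by auto
  ultimately show ?thesis
    unfolding Hplus_top_def by (auto simp: continuous_map_in_subtopology)
qed

lemma homeomorphic_map_Zeta:
  assumes cut: "cutoff h0"
  shows "homeomorphic_map Hplus_top (subtopology (Hcup_top h0) (Zeta ` Hplus)) Zeta"
  unfolding homeomorphic_map_maps homeomorphic_maps_def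
proof (intro exI[of _ "the_inv_into Hplus Zeta"] conjI ballI)
  show "continuous_map Hplus_top (subtopology (Hcup_top h0) (Zeta ` Hplus)) Zeta"
    using continuous_map_Zeta[OF cut] by (auto simp: continuous_map_in_subtopology topspace_Hplus_top)
  show "continuous_map (subtopology (Hcup_top h0) (Zeta ` Hplus)) Hplus_top (the_inv_into Hplus Zeta)"
    by (rule Zeta_inverse_continuous[OF cut])
  show "the_inv_into Hplus Zeta (Zeta f) = f" if "f \<in> topspace Hplus_top" for f
    using that by (intro the_inv_into_f_f inj_on_Zeta[OF cut]) (simp add: topspace_Hplus_top)
  show "Zeta (the_inv_into Hplus Zeta u) = u" if "u \<in> topspace (subtopology (Hcup_top h0) (Zeta ` Hplus))" for u
    using that by (intro f_the_inv_into_f[OF inj_on_Zeta[OF cut]]) simp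
qed

text \<open>Only countably many weights occur in \<open>Zeta_small\<close>, so a sequence can
  replace a net: \<open>F N\<close> approximates the closure point with error 1/(N+1) in the weights
  up to N. Control turns this into a Cauchy sequence in \<open>Hplus\<close>.\<close>

lemma closedin_range_Zeta:
  assumes cut: "cutoff h0"
  shows "closedin (Hcup_top h0) (Zeta ` Hplus)"
proof -
  have sub: "Zeta ` Hplus \<subseteq> topspace (Hcup_top h0)"
    using Zeta_in_Hcup[OF cut] by (auto simp: topspace_Hcup_top[OF cut])
  have "u \<in> Zeta ` Hplus" if u: "u \<in> (Hcup_top h0) closure_of (Zeta ` Hplus)" for u
  proof -
    have cl: "\<exists>v\<in>Zeta ` Hplus. v \<in> U" if "openin (Hcup_top h0) U" "u \<in> U" for U
      using u that unfolding in_closure_of by blast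
    have "u \<in> Hcup h0"
      using u by (simp add: in_closure_of topspace_Hcup_top[OF cut])
    then obtain g0 a0 b0 where g0: "g0 \<in> Hminus" and u_eq: "u = Hcup_sum h0 (g0, a0, b0)"
      unfolding Hcup_def by auto
    let ?S = "\<lambda>s f. Hminus_seminorm (of_int s) 0 0 (\<lambda>x. Zeta_rem h0 f x - g0 x)"
    have "\<forall>N. \<exists>f. f \<in> Hplus \<and> Zeta_near h0 N (inverse (real (Suc N))) g0 a0 b0 f"
    proof
      fix N
      have "inverse (real (Suc N)) > 0"
        by simp
      then obtain U where U: "openin (Hcup_top h0) U" "u \<in> U"
        "\<forall>f\<in>Hplus. Zeta f \<in> U \<longrightarrow> Zeta_near h0 N (inverse (real (Suc N))) g0 a0 b0 f"
        using Hcup_top_nbhd[OF cut g0, of "inverse (real (Suc N))" a0 b0 N] unfolding u_eq by blast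
      then show "\<exists>f. f \<in> Hplus \<and> Zeta_near h0 N (inverse (real (Suc N))) g0 a0 b0 f"
        using cl[OF U(1,2)] by blast
    qed
    from choice[OF this] obtain F where F: "\<And>N. F N \<in> Hplus" "\<And>N s. \<bar>s\<bar> \<le> int N \<Longrightarrow> ?S s (F N) < inverse (real (Suc N))"
      "\<And>N. norm (- F N 0 / 2 - a0) < inverse (real (Suc N))" "\<And>N. norm (Fourier (F N) 0 / 2 - b0) < inverse (real (Suc N))"
      unfolding Zeta_near_def by blast
    have inv_le: "inverse (real (Suc M)) \<le> inverse (real (Suc n))" if "n \<le> M" for n M
      using that by (intro le_imp_inverse_le) auto
    have tri: "norm (x - y) \<le> 2 * r" if "norm (x - z) < d" "norm (y - z) < e" "d \<le> r" "e \<le> r"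
      for x y z :: complex and d e r :: real
      using norm_triangle_ineq4[of "x - z" "y - z"] that by simp
    have small: "Zeta_small h0 n (2 * inverse (real (Suc n))) (\<lambda>x. F M x - F N x)" if MN: "n \<le> M" "n \<le> N" for n M N
    proof (rule Zeta_small_diffI[OF F(1) F(1)])
      fix s :: int assume s: "\<bar>s\<bar> \<le> int n"
      note rem = Zeta_rem_Hminus(1)[OF cut F(1)]
      have "Hminus_seminorm (of_int s) 0 0 (\<lambda>x. Zeta_rem h0 (F M) x - Zeta_rem h0 (F N) x)
          \<le> ?S s (F M) + Hminus_seminorm (of_int s) 0 0 (\<lambda>x. g0 x - Zeta_rem h0 (F N) x)"
        by (rule Hminus_seminorm_triangle[OF rem g0 rem])
      also have "Hminus_seminorm (of_int s) 0 0 (\<lambda>x. g0 x - Zeta_rem h0 (F N) x) = ?S s (F N)"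
        by (simp add: Schwartz_seminorm_def twist_def norm_mult norm_minus_commute)
      finally show "Hminus_seminorm (of_int s) 0 0 (\<lambda>x. Zeta_rem h0 (F M) x - Zeta_rem h0 (F N) x)
          \<le> 2 * inverse (real (Suc n))"
        using F(2)[of s M] F(2)[of s N] s MN inv_le[OF MN(1)] inv_le[OF MN(2)] by linarith
    next
      show "norm (- F M 0 / 2 - - F N 0 / 2) \<le> 2 * inverse (real (Suc n))"
        by (rule tri[OF F(3) F(3) inv_le[OF MN(1)] inv_le[OF MN(2)]])
      show "norm (Fourier (F M) 0 / 2 - Fourier (F N) 0 / 2) \<le> 2 * inverse (real (Suc n))"
        by (rule tri[OF F(4) F(4) inv_le[OF MN(1)] inv_le[OF MN(2)]])
    qed
    have cauchy: "\<exists>n. \<forall>M\<ge>n. \<forall>N\<ge>n. Schwartz_seminorm k m (\<lambda>x. F M x - F N x) \<le> e" if e: "e > 0" for k m and e :: real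
    proof -
      obtain K d where d: "d > 0" and Kd: "\<And>f. f \<in> Hplus \<Longrightarrow> Zeta_small h0 K d f \<Longrightarrow> Schwartz_seminorm k m f < e"
        by (rule controlled_lessE[OF Zeta_controlled_seminorm[OF cut, of k m] e], rule that)
      obtain n0 where n0: "inverse (real (Suc n0)) < d / 2"
        using reals_Archimedean[of "d / 2"] d by auto
      \<comment> \<open>\<open>K\<close> provides the required weights, \<open>n0\<close> the
        required accuracy.\<close>
      define n where "n = max K n0"
      have "2 * inverse (real (Suc n)) \<le> d"
        using inv_le[of n0 n, unfolded n_def, OF max.cobounded2] n0 unfolding n_def by linarith
      then have "Zeta_small h0 K d (\<lambda>x. F M x - F N x)" if "n \<le> M" "n \<le> N" for M N
        using small[OF that] by (intro Zeta_small_mono[of K n]) (simp_all add: n_def)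
      then show ?thesis
        using Kd[OF Hplus_diff[OF F(1) F(1)]] by (intro exI[of _ n]) (auto intro: less_imp_le)
    qed
    obtain f where f: "f \<in> Hplus" "\<And>k m. (\<lambda>N. Schwartz_seminorm k m (\<lambda>x. F N x - f x)) \<longlonglongrightarrow> 0"
      by (rule Hplus_complete[OF F(1) cauchy], assumption, rule that)
    have inv0: "(\<lambda>N. inverse (real (Suc N))) \<longlonglongrightarrow> 0"
      by (rule LIMSEQ_inverse_real_of_nat)
    \<comment> \<open>The approximation of \<open>u\<close> is recorded only in sup seminorms, which
      is enough to identify it with \<open>Zeta f\<close> point by point.\<close>
    have "u x = Zeta f x" for x
    proof (cases "x > 0")
      case True
      have "(\<lambda>N. Zeta (F N) x - Zeta f x) \<longlonglongrightarrow> 0"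
      proof (rule Lim_null_comparison[OF always_eventually], rule allI)
        show "norm (Zeta (F N) x - Zeta f x) \<le> 2 / x\<^sup>2 * Schwartz_seminorm 2 0 (\<lambda>x. F N x - f x)" for N
          using Zeta_decay[OF Hplus_diff[OF F(1) f(1)] True order_refl, of N] True
          by (simp add: Zeta_diff[OF F(1) f(1)] field_simps)
        show "(\<lambda>N. 2 / x\<^sup>2 * Schwartz_seminorm 2 0 (\<lambda>x. F N x - f x)) \<longlonglongrightarrow> 0"
          using tendsto_mult_left[OF f(2), of "2 / x\<^sup>2" 2 0] by simp
      qed
      then have 1: "(\<lambda>N. Zeta (F N) x) \<longlonglongrightarrow> Zeta f x"
        by (rule LIM_zero_cancel)
      have "(\<lambda>N. Zeta_rem h0 (F N) x) \<longlonglongrightarrow> g0 x"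
      proof (rule LIM_zero_cancel, rule Lim_null_comparison[OF always_eventually inv0], rule allI)
        fix N
        have "norm (Zeta_rem h0 (F N) x - g0 x) \<le> ?S 0 (F N)"
          using Hminus_pointwise_bound[OF Hminus_diff[OF Zeta_rem_Hminus(1)[OF cut F(1)] g0] True, of 0] True by simp
        then show "norm (Zeta_rem h0 (F N) x - g0 x) \<le> inverse (real (Suc N))"
          using F(2)[of 0 N] by simp
      qed
      moreover have "(\<lambda>N. - F N 0 / 2) \<longlonglongrightarrow> a0"
        by (rule LIM_zero_cancel, rule Lim_null_comparison[OF always_eventually inv0], rule allI) (rule less_imp_le[OF F(3)])
      moreover have "(\<lambda>N. Fourier (F N) 0 / 2) \<longlonglongrightarrow> b0"
        by (rule LIM_zero_cancel, rule Lim_null_comparison[OF always_eventually inv0], rule allI) (rule less_imp_le[OF F(4)])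
      ultimately have "(\<lambda>N. Hcup_sum h0 (Zeta_rem h0 (F N), - F N 0 / 2, Fourier (F N) 0 / 2) x) \<longlonglongrightarrow> u x"
        unfolding u_eq Hcup_sum_def split by (intro tendsto_add tendsto_mult tendsto_const)
      then have "(\<lambda>N. Zeta (F N) x) \<longlonglongrightarrow> u x"
        unfolding Zeta_eq_Hcup_sum[symmetric] .
      then show ?thesis
        using 1 by (rule LIMSEQ_unique)
    next
      case False
      then show ?thesis
        using Hminus_nonpos[OF g0] by (simp add: u_eq Hcup_sum_def ext0_def Zeta_nonpos)
    qed
    then show ?thesis
      using f(1) by (intro image_eqI[of _ _ f]) auto
  qed
  then show ?thesis
    using sub by (auto simp: closure_of_subset_eq[symmetric])
qed

text \<open>Uniqueness of the decomposition in \<open>Hcup\<close>: an element of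
  \<open>Hminus\<close> has both scalar coordinates 0, and those of \<open>Zeta f\<close> are
  -f(0)/2 and Ff(0)/2.\<close>

lemma Zeta_Hminus_iff:
  assumes cut: "cutoff h0" and f: "f \<in> Hplus"
  shows "Zeta f \<in> Hminus \<longleftrightarrow> f \<in> Hcap"
proof
  assume Z: "Zeta f \<in> Hminus"
  have "Zeta f = Hcup_sum h0 (Zeta f, 0, 0)"
    by (simp add: Hcup_sum_def)
  then have "Hcup_sum h0 (Zeta f, 0, 0) = Hcup_sum h0 (Zeta_rem h0 f, - f 0 / 2, Fourier f 0 / 2)"
    using Zeta_eq_Hcup_sum[of f h0] by simp
  then have "(Zeta f, 0, 0) = (Zeta_rem h0 f, - f 0 / 2, Fourier f 0 / 2)"
    using Z Zeta_rem_Hminus(1)[OF cut f] by (intro inj_onD[OF inj_on_Hcup_sum[OF cut]]) auto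
  then show "f \<in> Hcap"
    using f by (simp add: Hcap_def)
next
  assume "f \<in> Hcap"
  then have "Zeta_rem h0 f = Zeta f"
    by (simp add: Hcap_def Zeta_rem_def)
  then show "Zeta f \<in> Hminus"
    using Zeta_rem_Hminus(1)[OF cut f] by simp
qed

theorem theorem3p3:
  fixes h0 :: "real \<Rightarrow> real"
  assumes "cutoff h0"
  shows "(\<forall>f\<in>Hplus. \<forall>x>0. summable (\<lambda>n. f (real (Suc n) * x)))
    \<and> Zeta ` Hplus \<subseteq> Hcup h0
    \<and> clinear_on Hplus Zeta
    \<and> continuous_map Hplus_top (Hcup_top h0) Zeta
    \<and> closedin (Hcup_top h0) (Zeta ` Hplus)
    \<and> homeomorphic_map Hplus_top (subtopology (Hcup_top h0) (Zeta ` Hplus)) Zeta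
    \<and> (\<forall>f\<in>Hplus. Zeta f \<in> Hminus \<longleftrightarrow> f \<in> Hcap)"
proof (intro conjI ballI allI impI)
  show "summable (\<lambda>n. f (real (Suc n) * x))" if "f \<in> Hplus" "x > 0" for f x
    by (rule Hplus_summable[OF that])
  show "Zeta ` Hplus \<subseteq> Hcup h0"
    using Zeta_in_Hcup[OF assms] by blast
  show "clinear_on Hplus Zeta"
    unfolding clinear_on_def
  proof (intro conjI ballI allI)
    show "Zeta (\<lambda>x. f x + g x) = (\<lambda>x. Zeta f x + Zeta g x)" if "f \<in> Hplus" "g \<in> Hplus" for f g
      using Zeta_lincomb[OF that, of 1 1] by simp
    show "Zeta (\<lambda>x. c * f x) = (\<lambda>x. c * Zeta f x)" if "f \<in> Hplus" for c f
      using Zeta_lincomb[OF that that, of c 0] by simp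
  qed
  show "continuous_map Hplus_top (Hcup_top h0) Zeta"
    by (rule continuous_map_Zeta[OF assms])
  show "closedin (Hcup_top h0) (Zeta ` Hplus)"
    by (rule closedin_range_Zeta[OF assms])
  show "homeomorphic_map Hplus_top (subtopology (Hcup_top h0) (Zeta ` Hplus)) Zeta"
    by (rule homeomorphic_map_Zeta[OF assms])
  show "Zeta f \<in> Hminus \<longleftrightarrow> f \<in> Hcap" if "f \<in> Hplus" for f
    by (rule Zeta_Hminus_iff[OF assms that])
qed

end
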